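(* For each increasing function $f:[0,\infty)\to[0,\infty)$ there exists a strongly decomposable forward Brownian motion $\{X_t, t\in\mathbb{R}\}$ for which, almost surely, $$\limsup_{t\to-\infty}\left(X_t-f(-t)\right)\ge 0\qquad\text{and}\qquad \liminf_{t\to-\infty}\left(X_t+f(-t)\right)\le 0.$$
   Context: Standard Brownian motion starts at $0$ at time $0$. A random time is a real-valued random variable (not necessarily a stopping time). Forward Brownian motion (FBM): a process $\{X_t,t\in\mathbb{R}\}$ for which there exist random times $S_n$, $n\in\{0,-1,-2,\dots\}$, such that $\lim_{n\to-\infty}S_n=-\infty$ a.s. and for every $n$ the process $\{X_{S_n+t}-X_{S_n},t\ge0\}$ is standard Brownian motion on $[0,\infty)$. Decomposable and strongly decomposable processes: for each $k\in\mathbb{Z}$ let $\{B^k_t,t\ge0\}$ be a standard Brownian motion with respect to some normal filtration $\{\mathcal{F}^k_t,t\ge0\}$ and let $T_k$ be a stopping time with respect to $\mathcal{F}^k$. Assume that $(T_k,\{B^k_t,t\in[0,T_k]\})$, $k\in\mathbb{Z}$, are independent and that a.s. $0\le T_k<\infty$ for all $k$, $\sum_{k=1}^\infty T_k=\infty$ and $\sum_{k=-\infty}^{-1}T_k=\infty$. Let $S_0=0$ and let $S_k$, $k\in\mathbb{Z}$, be determined by $S_{k+1}-S_k=T_k$. Let $X$ be the unique continuous process with $X_0=0$ and $X_{S_k+t}-X_{S_k}=B^k_t$ for $t\in[0,T_k)$, $k\in\mathbb{Z}$. A process $X'$ is called decomposable if for some random time $U$ the process $\{X'_{U+t}-X'_U,t\in\mathbb{R}\}$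 can be represented as such an $X$. If in addition $(T_k,\{B^k_t,t\in[0,T_k]\})$, $k\in\mathbb{Z}$, are i.i.d., then $X'$ is called strongly decomposable. (Every decomposable process is an FBM.) *)

theory Defs
  imports "HOL-Probability.Probability" "HOL-Probability.Stopping_Time"
begin

context prob_space
begin

text \<open>
  A process indexed by \<open>[0,\<infinity>)\<close> is a function \<open>real \<Rightarrow> 'a \<Rightarrow> real\<close> whose values at negative
  times are ignored.
\<close>

definition standard_brownian_motion :: "(real \<Rightarrow> 'a \<Rightarrow> real) \<Rightarrow> bool" where
  "standard_brownian_motion B \<longleftrightarrow>
     (\<forall>t\<ge>0. B t \<in> borel_measurable M) \<and>
     (AE \<omega> in M. B 0 \<omega> = 0) \<and>
     (AE \<omega> in M. continuous_on {0..} (\<lambda>t. B t \<omega>)) \<and>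
     (\<forall>s t. 0 \<le> s \<longrightarrow> s < t \<longrightarrow>
        distributed M lborel (\<lambda>\<omega>. B t \<omega> - B s \<omega>) (normal_density 0 (sqrt (t - s)))) \<and>
     (\<forall>(n::nat) \<tau>. 0 \<le> \<tau> 0 \<longrightarrow> (\<forall>i<n. \<tau> i < \<tau> (Suc i)) \<longrightarrow>
        indep_vars (\<lambda>_. borel) (\<lambda>i \<omega>. B (\<tau> (Suc i)) \<omega> - B (\<tau> i) \<omega>) {..<n})"

text \<open>
  The usual conditions: right-continuity, and \<open>\<F>\<^sub>0\<close> contains all subsets of null sets (so \<open>M\<close> is
  complete). Filtrations indexed by \<open>[0,\<infinity>)\<close> are regarded as real-indexed, for instance by
  \<open>\<F>\<^sub>t = \<F>\<^sub>0\<close> for \<open>t < 0\<close>, so that the library's \<^const>\<open>stopping_time\<close> applies to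
  real-valued random times.
\<close>

definition normal_filtration :: "(real \<Rightarrow> 'a measure) \<Rightarrow> bool" where
  "normal_filtration \<F> \<longleftrightarrow>
     filtration (space M) \<F> \<and>
     (\<forall>t. subalgebra M (\<F> t)) \<and>
     (\<forall>N\<in>null_sets M. Pow N \<subseteq> sets (\<F> 0)) \<and>
     (\<forall>t\<ge>0. sets (\<F> t) = (\<Inter>s\<in>{t<..}. sets (\<F> s)))"

definition standard_brownian_motion_wrt ::
    "(real \<Rightarrow> 'a measure) \<Rightarrow> (real \<Rightarrow> 'a \<Rightarrow> real) \<Rightarrow> bool" where
  "standard_brownian_motion_wrt \<F> B \<longleftrightarrow>
     standard_brownian_motion B \<and>
     (\<forall>t\<ge>0. B t \<in> borel_measurable (\<F> t)) \<and>
     (\<forall>s t. 0 \<le> s \<longrightarrow> s < t \<longrightarrow>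
        indep_set (sets (\<F> s))
          {(\<lambda>\<omega>. B t \<omega> - B s \<omega>) -` A \<inter> space M |A. A \<in> sets borel})"

text \<open>Only the random times \<open>S n\<close> with \<open>n \<le> 0\<close> matter.\<close>

definition forward_brownian_motion :: "(real \<Rightarrow> 'a \<Rightarrow> real) \<Rightarrow> bool" where
  "forward_brownian_motion X \<longleftrightarrow>
     (\<forall>t. X t \<in> borel_measurable M) \<and>
     (\<exists>S :: int \<Rightarrow> 'a \<Rightarrow> real.
        (\<forall>n\<le>0. S n \<in> borel_measurable M) \<and>
        (AE \<omega> in M. filterlim (\<lambda>n. S n \<omega>) at_bot at_bot) \<and>
        (\<forall>n\<le>0. standard_brownian_motion (\<lambda>t \<omega>. X (S n \<omega> + t) \<omega> - X (S n \<omega>) \<omega>)))"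

text \<open>
  The pair \<open>(T, {B\<^sub>t, t \<in> [0,T]})\<close> is encoded as \<open>T\<close> together with the stopped path
  \<open>t \<mapsto> B\<^bsub>min t T\<^esub>\<close>, which carries the same information and has the fixed index set \<open>[0,\<infinity>)\<close>.
\<close>

definition stopped_pair ::
    "('a \<Rightarrow> real) \<Rightarrow> (real \<Rightarrow> 'a \<Rightarrow> real) \<Rightarrow> 'a \<Rightarrow> real \<times> (real \<Rightarrow> real)" where
  "stopped_pair T B \<omega> = (T \<omega>, \<lambda>t\<in>{0..}. B (min t (T \<omega>)) \<omega>)"

definition (in -) stopped_pair_space :: "(real \<times> (real \<Rightarrow> real)) measure" where
  "stopped_pair_space = borel \<Otimes>\<^sub>M (\<Pi>\<^sub>M t\<in>{0..}. borel)"

definition decomposition ::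
    "(int \<Rightarrow> real \<Rightarrow> 'a measure) \<Rightarrow> (int \<Rightarrow> real \<Rightarrow> 'a \<Rightarrow> real) \<Rightarrow> (int \<Rightarrow> 'a \<Rightarrow> real) \<Rightarrow>
     (int \<Rightarrow> 'a \<Rightarrow> real) \<Rightarrow> (real \<Rightarrow> 'a \<Rightarrow> real) \<Rightarrow> bool" where
  "decomposition \<F> B T S X \<longleftrightarrow>
     (\<forall>k. normal_filtration (\<F> k)) \<and>
     (\<forall>k. standard_brownian_motion_wrt (\<F> k) (B k)) \<and>
     (\<forall>k. stopping_time (\<F> k) (T k)) \<and>
     indep_vars (\<lambda>_. stopped_pair_space) (\<lambda>k. stopped_pair (T k) (B k)) UNIV \<and>
     (AE \<omega> in M. \<forall>k. 0 \<le> T k \<omega>) \<and>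
     (AE \<omega> in M. (\<Sum>n. ennreal (T (int (Suc n)) \<omega>)) = \<infinity>) \<and>
     (AE \<omega> in M. (\<Sum>n. ennreal (T (- int (Suc n)) \<omega>)) = \<infinity>) \<and>
     (\<forall>\<omega>\<in>space M. S 0 \<omega> = 0) \<and>
     (\<forall>k. \<forall>\<omega>\<in>space M. S (k + 1) \<omega> - S k \<omega> = T k \<omega>) \<and>
     (\<forall>t. X t \<in> borel_measurable M) \<and>
     (AE \<omega> in M. continuous_on UNIV (\<lambda>t. X t \<omega>)) \<and>
     (AE \<omega> in M. X 0 \<omega> = 0) \<and>
     (AE \<omega> in M. \<forall>k. \<forall>t\<in>{0..<T k \<omega>}. X (S k \<omega> + t) \<omega> - X (S k \<omega>) \<omega> = B k t \<omega>)"

definition decomposable :: "(real \<Rightarrow> 'a \<Rightarrow> real) \<Rightarrow> bool" where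
  "decomposable X \<longleftrightarrow>
     (\<forall>t. X t \<in> borel_measurable M) \<and>
     (\<exists>U \<F> B T S. U \<in> borel_measurable M \<and>
        decomposition \<F> B T S (\<lambda>t \<omega>. X (U \<omega> + t) \<omega> - X (U \<omega>) \<omega>))"

definition strongly_decomposable :: "(real \<Rightarrow> 'a \<Rightarrow> real) \<Rightarrow> bool" where
  "strongly_decomposable X \<longleftrightarrow>
     (\<forall>t. X t \<in> borel_measurable M) \<and>
     (\<exists>U \<F> B T S. U \<in> borel_measurable M \<and>
        decomposition \<F> B T S (\<lambda>t \<omega>. X (U \<omega> + t) \<omega> - X (U \<omega>) \<omega>) \<and>
        (\<forall>j k. distr M stopped_pair_space (stopped_pair (T j) (B j)) =
               distr M stopped_pair_space (stopped_pair (T k) (B k))))"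

end

end

theory Submission
  imports Defs
begin

text \<open>
  The blocks are driven by independent standard Brownian motions \<open>B\<^sup>k\<close>, and all stopping times
  are integers. The first unit increment of a block determines its level
  \<open>m = \<lfloor>\<bar>B\<^sup>k\<^sub>1\<bar>\<rfloor>\<close>; the block then waits until its last unit increment lies in \<open>[-b\<^sub>m - 1, -b\<^sub>m]\<close>
  and the one before it is at least \<open>2 b\<^sub>m + 1\<close>. Relative to the value at the end of the block, the
  path is therefore at least \<open>b\<^sub>m\<close> higher one time unit earlier and at least \<open>b\<^sub>m\<close> lower two time
  units earlier.

  Let \<open>K\<close> be the first block of level at least \<open>m\<close> when counting backwards from time \<open>0\<close>. The
  blocks passed before \<open>K\<close> have levels below \<open>m\<close>, so their total duration \<open>R\<close> and the value
  \<open>X(-R)\<close> only depend on \<open>b\<^sub>0, \<dots>, b\<^sub>m\<^sub>-\<^sub>1\<close>. Hence \<open>b\<^sub>m\<close> can be chosen recursively such that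
  \<open>f(R + 2) + \<bar>X(-R)\<bar> > b\<^sub>m\<close> has probability at most \<open>2\<^sup>-\<^sup>m\<close>. By Borel-Cantelli this occurs for
  finitely many \<open>m\<close> only, and for all other \<open>m\<close> the block \<open>K\<close> carries \<open>X\<close> above \<open>f\<close> and below \<open>-f\<close>.

  Since the stopping times are integers, \<open>X\<close> after the start of block \<open>n\<close> is a fixed functional of
  a spliced sequence of unit-interval noises: each i.i.d. sequence is cut at its stopping time and
  continued by the next one. Splicing preserves the i.i.d. law, so \<open>X\<close> is a forward Brownian motion.
\<close>

subsection \<open>Independence and Gaussian limits\<close>

text \<open>Strong decomposability is the obstacle. If the blocks could have different laws, the
  spikes could simply grow with the block index; identically distributed blocks must outrun
  \<open>f\<close> with a single law. An unbounded random level takes over the role of the index: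
  going backwards, every level is exceeded eventually, but only after a run of lower ones. The
  thresholds face a circle: they must dominate \<open>f\<close> at the elapsed time, which itself
  grows with the thresholds. It is cut by letting the rule of a block read no threshold except that
  of its own level. Waiting times may have arbitrarily heavy tails, as they only have to be finite.
  The level is read off the block's own first increment, so that the stopping time uses no
  randomness besides the Brownian motion it stops. Integer stopping times turn the strong Markov
  property into a statement about i.i.d. sequences. Brownian motion is built by hand from such
  sequences so that this statement applies to it directly.\<close>

text \<open>A finite intersection of events is sorted by groups: the events of one group form a
  single event about the tuple of that group, so \<open>outer\<close> splits the groups and
  \<open>inner\<close> splits each of them.\<close>

lemma (in prob_space) indep_vars_UNION:
  assumes disj: "disjoint_family_on J I"
    and outer: "indep_vars (\<lambda>i. PiM (J i) N) (\<lambda>i \<omega>. \<lambda>j\<in>J i. X j \<omega>) I"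
    and inner: "\<And>i. i \<in> I \<Longrightarrow> indep_vars N X (J i)"
  shows "indep_vars N X (\<Union>i\<in>I. J i)"
  unfolding indep_vars_def2
proof (intro conjI ballI indep_setsI)
  have rv: "X j \<in> measurable M (N j)" if "j \<in> (\<Union>i\<in>I. J i)" for j
    using that inner unfolding indep_vars_def2 by blast
  then show "\<And>j. j \<in> (\<Union>i\<in>I. J i) \<Longrightarrow> random_variable (N j) (X j)" .
  then show "{X j -` A \<inter> space M |A. A \<in> sets (N j)} \<subseteq> events" if "j \<in> (\<Union>i\<in>I. J i)" for j
    using that measurable_sets by blast
  fix A K
  assume K: "K \<noteq> {}" "K \<subseteq> (\<Union>i\<in>I. J i)" "finite K"
    and "\<forall>j\<in>K. A j \<in> {X j -` A \<inter> space M |A. A \<in> sets (N j)}"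
  then have "\<forall>j\<in>K. \<exists>B. A j = X j -` B \<inter> space M \<and> B \<in> sets (N j)"
    by blast
  then obtain B where B: "\<And>j. j \<in> K \<Longrightarrow> A j = X j -` B j \<inter> space M"
      "\<And>j. j \<in> K \<Longrightarrow> B j \<in> sets (N j)"
    by metis
  \<comment> \<open>Groups that miss \<open>K\<close> are dropped, since their empty intersection of
    events would be \<open>UNIV\<close> instead of \<open>space M\<close>.\<close>
  define I' where "I' = {i\<in>I. J i \<inter> K \<noteq> {}}"
  obtain g where g: "\<And>j. j \<in> K \<Longrightarrow> g j \<in> I \<and> j \<in> J (g j)"
    using K(2) by (metis UN_E subsetD)
  have "I' \<subseteq> g ` K"
    using disj g unfolding I'_def disjoint_family_on_def by blast
  then have fin: "finite I'"
    using K(3) finite_surj by blast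
  have I'I: "I' \<subseteq> I"
    by (auto simp: I'_def)
  have KU: "K = (\<Union>i\<in>I'. J i \<inter> K)"
    using K(2) unfolding I'_def by blast
  have I'0: "I' \<noteq> {}"
    using KU K(1) by auto
  define C where "C i = {y\<in>space (PiM (J i) N). \<forall>j\<in>J i \<inter> K. y j \<in> B j}" for i
  have C: "C i \<in> sets (PiM (J i) N)" for i
    unfolding C_def using K(3) B(2)
    by (intro sets.sets_Collect_finite_All) (auto intro!: measurable_sets_Collect)
  have CA: "(\<lambda>\<omega>. \<lambda>j\<in>J i. X j \<omega>) -` C i \<inter> space M = (\<Inter>j\<in>J i \<inter> K. A j)" if "i \<in> I'" for i
  proof -
    have "(\<lambda>j\<in>J i. X j \<omega>) \<in> space (PiM (J i) N)" if "\<omega> \<in> space M" for \<omega>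
      using rv \<open>i \<in> I'\<close> that unfolding space_PiM I'_def
      by (auto intro!: PiE_I dest: measurable_space)
    moreover have "J i \<inter> K \<noteq> {}"
      using that by (auto simp: I'_def)
    ultimately show ?thesis
      using B(1) by (auto simp: C_def)
  qed
  have "(\<Inter>j\<in>K. A j) = (\<Inter>i\<in>I'. \<Inter>j\<in>J i \<inter> K. A j)"
    using KU by blast
  then have "prob (\<Inter>j\<in>K. A j) = prob (\<Inter>i\<in>I'. (\<lambda>\<omega>. \<lambda>j\<in>J i. X j \<omega>) -` C i \<inter> space M)"
    by (simp add: CA)
  also have "\<dots> = (\<Prod>i\<in>I'. prob ((\<lambda>\<omega>. \<lambda>j\<in>J i. X j \<omega>) -` C i \<inter> space M))"
    by (rule indep_varsD[OF outer I'0 fin I'I C])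
  also have "\<dots> = (\<Prod>i\<in>I'. \<Prod>j\<in>J i \<inter> K. prob (A j))"
  proof (rule prod.cong[OF refl])
    fix i assume i: "i \<in> I'"
    have "prob (\<Inter>j\<in>J i \<inter> K. A j) = prob (\<Inter>j\<in>J i \<inter> K. X j -` B j \<inter> space M)"
      using B by auto
    also have "\<dots> = (\<Prod>j\<in>J i \<inter> K. prob (X j -` B j \<inter> space M))"
      using i K(3) B(2) by (intro indep_varsD[OF inner]) (auto simp: I'_def)
    finally show "prob ((\<lambda>\<omega>. \<lambda>j\<in>J i. X j \<omega>) -` C i \<inter> space M) = (\<Prod>j\<in>J i \<inter> K. prob (A j))"
      using B by (simp add: CA i)
  qed
  also have "\<dots> = (\<Prod>j\<in>(\<Union>i\<in>I'. J i \<inter> K). prob (A j))"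
    using disj K(3) fin I'I unfolding disjoint_family_on_def
    by (intro prod.UNION_disjoint[symmetric]) blast+
  finally show "prob (\<Inter>j\<in>K. A j) = (\<Prod>j\<in>K. prob (A j))"
    using KU by simp
qed

lemma (in prob_space) indep_vars_reindex:
  assumes "indep_vars N X I" "inj_on g J" "g ` J \<subseteq> I"
  shows "indep_vars (\<lambda>j. N (g j)) (\<lambda>j. X (g j)) J"
  unfolding indep_vars_def2
proof (intro conjI ballI indep_setsI)
  have rv: "X i \<in> measurable M (N i)" if "i \<in> I" for i
    using that assms(1) unfolding indep_vars_def2 by blast
  show "random_variable (N (g j)) (X (g j))" if "j \<in> J" for j
    using assms(3) rv that by auto
  then show "{X (g j) -` A \<inter> space M |A. A \<in> sets (N (g j))} \<subseteq> events" if "j \<in> J" for j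
    using that measurable_sets by blast
  fix A K
  assume K: "K \<noteq> {}" "K \<subseteq> J" "finite K"
    and "\<forall>j\<in>K. A j \<in> {X (g j) -` A \<inter> space M |A. A \<in> sets (N (g j))}"
  then have "\<forall>j\<in>K. \<exists>B. A j = X (g j) -` B \<inter> space M \<and> B \<in> sets (N (g j))"
    by blast
  then obtain B where B: "\<And>j. j \<in> K \<Longrightarrow> A j = X (g j) -` B j \<inter> space M"
      "\<And>j. j \<in> K \<Longrightarrow> B j \<in> sets (N (g j))"
    by metis
  have inj: "inj_on g K"
    using assms(2) K(2) inj_on_subset by blast
  define B' where "B' i = B (the_inv_into K g i)" for i
  have B': "B' (g j) = B j" if "j \<in> K" for j
    using that inj by (simp add: B'_def the_inv_into_f_f)
  have "prob (\<Inter>j\<in>K. A j) = prob (\<Inter>i\<in>g ` K. X i -` B' i \<inter> space M)"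
    using B(1) B' K(1) by (intro arg_cong[where f = prob]) auto
  also have "\<dots> = (\<Prod>i\<in>g ` K. prob (X i -` B' i \<inter> space M))"
    using K assms(3) B(2) B' by (intro indep_varsD[OF assms(1)]) auto
  also have "\<dots> = (\<Prod>j\<in>K. prob (A j))"
    using B(1) B' by (simp add: prod.reindex[OF inj])
  finally show "prob (\<Inter>j\<in>K. A j) = (\<Prod>j\<in>K. prob (A j))" .
qed

lemma (in prob_space) indep_vars_singleton:
  assumes "random_variable (N i) (X i)"
  shows "indep_vars N X {i}"
  unfolding indep_vars_def2
proof (intro conjI ballI indep_setsI)
  show "{X j -` A \<inter> space M |A. A \<in> sets (N j)} \<subseteq> events" if "j \<in> {i}" for j
    using that measurable_sets[OF assms] by blast
  fix A K assume "K \<noteq> {}" "K \<subseteq> {i}"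
  then have "K = {i}" by blast
  then show "prob (\<Inter>j\<in>K. A j) = (\<Prod>j\<in>K. prob (A j))" by simp
qed (use assms in auto)

lemma (in prob_space) indep_vars_pair:
  assumes "indep_var (N i) (X i) (N j) (X j)" "i \<noteq> j"
  shows "indep_vars N X {i, j}"
proof -
  have eq: "case_bool (N i) (N j) = (\<lambda>b. N (case_bool i j b))"
      "case_bool (X i) (X j) = (\<lambda>b. X (case_bool i j b))"
    by (auto split: bool.split)
  have "indep_vars (\<lambda>b. N (case_bool i j b)) (\<lambda>b. X (case_bool i j b)) UNIV"
    using assms(1) unfolding indep_var_def eq .
  then have "indep_vars (\<lambda>l. N (case_bool i j (l = i))) (\<lambda>l. X (case_bool i j (l = i))) {i, j}"
    by (rule indep_vars_reindex) (use assms(2) in auto)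
  then show ?thesis
    by (subst indep_vars_cong[OF refl]) (auto split: bool.split)
qed

section \<open>Rotation of a Gaussian pair\<close>

text \<open>The substitution \<open>u = x + y\<close>, \<open>v = x - y\<close> is made one
  coordinate at a time, with Tonelli in between, so that only affine substitutions on the line
  occur.\<close>

lemma nn_integral_normal_rotate:
  fixes A B :: "real set"
  assumes \<sigma>: "0 < \<sigma>" and [measurable]: "A \<in> sets borel" "B \<in> sets borel"
  shows "(\<integral>\<^sup>+x. \<integral>\<^sup>+y. ennreal (normal_density 0 \<sigma> x) * ennreal (normal_density 0 \<sigma> y) *
      (indicator A (x + y) * indicator B (x - y)) \<partial>lborel \<partial>lborel) =
    (\<integral>\<^sup>+u. ennreal (normal_density 0 (sqrt 2 * \<sigma>) u) * indicator A u \<partial>lborel) *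
    (\<integral>\<^sup>+v. ennreal (normal_density 0 (sqrt 2 * \<sigma>) v) * indicator B v \<partial>lborel)"
    (is "?L = ?a * ?b")
proof -
  let ?d = "\<lambda>x. ennreal (normal_density 0 \<sigma> x)"
  let ?e = "\<lambda>x. ennreal (normal_density 0 (sqrt 2 * \<sigma>) x)"
  \<comment> \<open>The leading \<open>1/2\<close> is the Jacobian of
    \<open>x = (u + v) / 2\<close>; the rest is
    \<open>((u + v) / 2)^2 + ((u - v) / 2)^2 = (u^2 + v^2) / 2\<close>.\<close>
  have dens: "1/2 * (normal_density 0 \<sigma> ((u + v) / 2) * normal_density 0 \<sigma> ((u - v) / 2))
      = normal_density 0 (sqrt 2 * \<sigma>) u * normal_density 0 (sqrt 2 * \<sigma>) v" for u v
  proof -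
    have ex: "- (((u + v) / 2 - 0)\<^sup>2 / (2 * \<sigma>\<^sup>2)) + - (((u - v) / 2 - 0)\<^sup>2 / (2 * \<sigma>\<^sup>2))
      = - ((u - 0)\<^sup>2 / (2 * (sqrt 2 * \<sigma>)\<^sup>2)) + - ((v - 0)\<^sup>2 / (2 * (sqrt 2 * \<sigma>)\<^sup>2))"
      using \<sigma> by (simp add: power_mult_distrib power2_eq_square field_simps)
    have s: "sqrt (2 * pi * (sqrt 2 * \<sigma>)\<^sup>2) * sqrt (2 * pi * (sqrt 2 * \<sigma>)\<^sup>2)
        = 2 * (sqrt (2 * pi * \<sigma>\<^sup>2) * sqrt (2 * pi * \<sigma>\<^sup>2))"
      by (simp add: power_mult_distrib)
    have "normal_density 0 \<sigma> ((u + v) / 2) * normal_density 0 \<sigma> ((u - v) / 2)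
      = 1 / (sqrt (2 * pi * \<sigma>\<^sup>2) * sqrt (2 * pi * \<sigma>\<^sup>2)) *
        exp (- (((u + v) / 2 - 0)\<^sup>2 / (2 * \<sigma>\<^sup>2)) + - (((u - v) / 2 - 0)\<^sup>2 / (2 * \<sigma>\<^sup>2)))"
      unfolding normal_density_def exp_add by simp
    moreover have "normal_density 0 (sqrt 2 * \<sigma>) u * normal_density 0 (sqrt 2 * \<sigma>) v
      = 1 / (sqrt (2 * pi * (sqrt 2 * \<sigma>)\<^sup>2) * sqrt (2 * pi * (sqrt 2 * \<sigma>)\<^sup>2)) *
        exp (- ((u - 0)\<^sup>2 / (2 * (sqrt 2 * \<sigma>)\<^sup>2)) + - ((v - 0)\<^sup>2 / (2 * (sqrt 2 * \<sigma>)\<^sup>2)))"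
      unfolding normal_density_def exp_add by simp
    ultimately show ?thesis
      unfolding ex s by simp
  qed
  have "?L = (\<integral>\<^sup>+x. \<integral>\<^sup>+u. ?d x * ?d (u - x) * (indicator A u * indicator B (2 * x - u)) \<partial>lborel \<partial>lborel)"
  proof (rule nn_integral_cong)
    fix x :: real
    show "(\<integral>\<^sup>+y. ?d x * ?d y * (indicator A (x + y) * indicator B (x - y)) \<partial>lborel) =
      (\<integral>\<^sup>+u. ?d x * ?d (u - x) * (indicator A u * indicator B (2 * x - u)) \<partial>lborel)"
      by (subst nn_integral_real_affine[where c = 1 and t = "- x"])
        (auto simp: algebra_simps)
  qed
  also have "\<dots> = (\<integral>\<^sup>+u. \<integral>\<^sup>+x. ?d x * ?d (u - x) * (indicator A u * indicator B (2 * x - u)) \<partial>lborel \<partial>lborel)"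
    by (rule lborel_pair.Fubini') simp
  also have "\<dots> = (\<integral>\<^sup>+u. \<integral>\<^sup>+v. (?e u * indicator A u) * (?e v * indicator B v) \<partial>lborel \<partial>lborel)"
  proof (rule nn_integral_cong)
    fix u :: real
    have "(\<integral>\<^sup>+x. ?d x * ?d (u - x) * (indicator A u * indicator B (2 * x - u)) \<partial>lborel) =
      (\<integral>\<^sup>+v. ennreal (1/2) * (?d ((u + v) / 2) * ?d (u - (u + v) / 2) * (indicator A u * indicator B (2 * ((u + v) / 2) - u))) \<partial>lborel)"
      by (subst nn_integral_real_affine[where c = "1/2" and t = "u/2"])
        (auto simp: nn_integral_cmult add_divide_distrib)
    also have "\<dots> = (\<integral>\<^sup>+v. (?e u * indicator A u) * (?e v * indicator B v) \<partial>lborel)"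
    proof (rule nn_integral_cong)
      fix v :: real
      have "u - (u + v) / 2 = (u - v) / 2" "2 * ((u + v) / 2) - u = v"
        by (simp_all add: field_simps)
      moreover have "ennreal (1/2) * (?d ((u + v) / 2) * ?d ((u - v) / 2)) = ?e u * ?e v"
      proof -
        have "ennreal a * (ennreal b * ennreal c) = ennreal (a * (b * c))" if "0 \<le> a" "0 \<le> b" "0 \<le> c" for a b c
          using that by (simp add: ennreal_mult)
        then show ?thesis
          by (simp only: dens normal_density_nonneg ennreal_mult)
      qed
      then have "ennreal (1/2) * (?d ((u + v) / 2) * ?d ((u - v) / 2) * (indicator A u * indicator B v))
          = ?e u * ?e v * (indicator A u * indicator B v)"
        by (simp only: mult.assoc[symmetric])
      ultimately show "ennreal (1/2) * (?d ((u + v) / 2) * ?d (u - (u + v) / 2) *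
          (indicator A u * indicator B (2 * ((u + v) / 2) - u)))
          = (?e u * indicator A u) * (?e v * indicator B v)"
        by (simp only: mult_ac)
    qed
    finally show "(\<integral>\<^sup>+x. ?d x * ?d (u - x) * (indicator A u * indicator B (2 * x - u)) \<partial>lborel) =
      (\<integral>\<^sup>+v. (?e u * indicator A u) * (?e v * indicator B v) \<partial>lborel)" .
  qed
  also have "\<dots> = ?a * ?b"
    by (simp add: nn_integral_cmult nn_integral_multc)
  finally show ?thesis .
qed

text \<open>The bisection step of Levy's construction. One formula \<open>AB\<close> for the joint
  event yields everything: the marginals by taking the other set to be \<open>UNIV\<close>, and then
  the product form.\<close>

lemma (in prob_space) normal_rotate:
  assumes ind: "indep_var borel X borel Y" and \<sigma>: "0 < \<sigma>"
    and X: "distributed M lborel X (normal_density 0 \<sigma>)"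
    and Y: "distributed M lborel Y (normal_density 0 \<sigma>)"
  shows "indep_var borel (\<lambda>\<omega>. X \<omega> + Y \<omega>) borel (\<lambda>\<omega>. X \<omega> - Y \<omega>)"
    and "distributed M lborel (\<lambda>\<omega>. X \<omega> + Y \<omega>) (normal_density 0 (sqrt 2 * \<sigma>))"
    and "distributed M lborel (\<lambda>\<omega>. X \<omega> - Y \<omega>) (normal_density 0 (sqrt 2 * \<sigma>))"
proof -
  let ?e = "\<lambda>x. ennreal (normal_density 0 (sqrt 2 * \<sigma>) x)"
  have [measurable]: "X \<in> borel_measurable M" "Y \<in> borel_measurable M"
    using ind by (auto simp: indep_var_eq)
  have e1: "(\<integral>\<^sup>+u. ?e u \<partial>lborel) = 1"
    using prob_space.emeasure_space_1[OF prob_space_normal_density[of "sqrt 2 * \<sigma>" 0]] \<sigma>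
    by (simp add: emeasure_density)
  have joint: "distributed M (lborel \<Otimes>\<^sub>M lborel) (\<lambda>\<omega>. (X \<omega>, Y \<omega>))
      (\<lambda>(x, y). ennreal (normal_density 0 \<sigma> x) * ennreal (normal_density 0 \<sigma> y))"
    by (rule distributed_joint_indep[OF lborel.sigma_finite_measure_axioms
        lborel.sigma_finite_measure_axioms X Y])
      (use ind in \<open>simp add: indep_var_eq\<close>)
  have AB: "emeasure M {\<omega>\<in>space M. X \<omega> + Y \<omega> \<in> A \<and> X \<omega> - Y \<omega> \<in> B} =
    (\<integral>\<^sup>+u. ?e u * indicator A u \<partial>lborel) * (\<integral>\<^sup>+v. ?e v * indicator B v \<partial>lborel)"
    if [measurable]: "A \<in> sets borel" "B \<in> sets borel" for A B
  proof -
    have "emeasure M {\<omega>\<in>space M. X \<omega> + Y \<omega> \<in> A \<and> X \<omega> - Y \<omega> \<in> B} =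
      (\<integral>\<^sup>+\<omega>. (\<lambda>(x, y). indicator A (x + y) * indicator B (x - y)) (X \<omega>, Y \<omega>) \<partial>M)"
    proof -
      have "emeasure M {\<omega>\<in>space M. X \<omega> + Y \<omega> \<in> A \<and> X \<omega> - Y \<omega> \<in> B} =
        (\<integral>\<^sup>+\<omega>. indicator {\<omega>\<in>space M. X \<omega> + Y \<omega> \<in> A \<and> X \<omega> - Y \<omega> \<in> B} \<omega> \<partial>M)"
        by simp
      also have "\<dots> = (\<integral>\<^sup>+\<omega>. (\<lambda>(x, y). indicator A (x + y) * indicator B (x - y)) (X \<omega>, Y \<omega>) \<partial>M)"
        by (intro nn_integral_cong) (auto simp: indicator_def)
      finally show ?thesis .
    qed
    also have "\<dots> = (\<integral>\<^sup>+p. (\<lambda>(x, y). ennreal (normal_density 0 \<sigma> x) * ennreal (normal_density 0 \<sigma> y)) p *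
        (\<lambda>(x, y). indicator A (x + y) * indicator B (x - y)) p \<partial>(lborel \<Otimes>\<^sub>M lborel))"
      by (subst distributed_nn_integral[OF joint, symmetric]) auto
    also have "\<dots> = (\<integral>\<^sup>+x. \<integral>\<^sup>+y. ennreal (normal_density 0 \<sigma> x) * ennreal (normal_density 0 \<sigma> y) *
      (indicator A (x + y) * indicator B (x - y)) \<partial>lborel \<partial>lborel)"
      by (subst lborel.nn_integral_fst[symmetric]) (auto simp: split_beta')
    also note nn_integral_normal_rotate[OF \<sigma> that]
    finally show ?thesis .
  qed
  have A: "emeasure M {\<omega>\<in>space M. X \<omega> + Y \<omega> \<in> A} = (\<integral>\<^sup>+u. ?e u * indicator A u \<partial>lborel)"
    if "A \<in> sets borel" for A
    using AB[OF that, of UNIV] by (simp add: e1)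
  have B: "emeasure M {\<omega>\<in>space M. X \<omega> - Y \<omega> \<in> B} = (\<integral>\<^sup>+u. ?e u * indicator B u \<partial>lborel)"
    if "B \<in> sets borel" for B
    using AB[of UNIV, OF _ that] by (simp add: e1)
  show "distributed M lborel (\<lambda>\<omega>. X \<omega> + Y \<omega>) (normal_density 0 (sqrt 2 * \<sigma>))"
    unfolding distributed_def
    by (auto intro!: measure_eqI simp: emeasure_distr emeasure_density A[symmetric] vimage_def Int_def conj_commute)
  show "distributed M lborel (\<lambda>\<omega>. X \<omega> - Y \<omega>) (normal_density 0 (sqrt 2 * \<sigma>))"
    unfolding distributed_def
    by (auto intro!: measure_eqI simp: emeasure_distr emeasure_density B[symmetric] vimage_def Int_def conj_commute)
  show "indep_var borel (\<lambda>\<omega>. X \<omega> + Y \<omega>) borel (\<lambda>\<omega>. X \<omega> - Y \<omega>)"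
    unfolding indep_var_distribution_eq
  proof (intro conjI)
    let ?S = "distr M borel (\<lambda>\<omega>. X \<omega> + Y \<omega>)" and ?T = "distr M borel (\<lambda>\<omega>. X \<omega> - Y \<omega>)"
    interpret S: prob_space ?S by (rule prob_space_distr) simp
    interpret T: prob_space ?T by (rule prob_space_distr) simp
    show "?S \<Otimes>\<^sub>M ?T = distr M (borel \<Otimes>\<^sub>M borel) (\<lambda>x. (X x + Y x, X x - Y x))"
    proof (rule pair_measure_eqI)
      fix A B assume "A \<in> sets ?S" "B \<in> sets ?T"
      then have [measurable]: "A \<in> sets borel" "B \<in> sets borel" by auto
      have "emeasure (distr M (borel \<Otimes>\<^sub>M borel) (\<lambda>x. (X x + Y x, X x - Y x))) (A \<times> B)
        = emeasure M {\<omega>\<in>space M. X \<omega> + Y \<omega> \<in> A \<and> X \<omega> - Y \<omega> \<in> B}"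
        by (subst emeasure_distr) (auto intro!: arg_cong[where f = "emeasure M"])
      also have "\<dots> = emeasure ?S A * emeasure ?T B"
        unfolding AB[OF \<open>A \<in> sets borel\<close> \<open>B \<in> sets borel\<close>]
          A[OF \<open>A \<in> sets borel\<close>, symmetric] B[OF \<open>B \<in> sets borel\<close>, symmetric]
        by (simp add: emeasure_distr vimage_def Int_def conj_commute)
      finally show "emeasure ?S A * emeasure ?T B =
        emeasure (distr M (borel \<Otimes>\<^sub>M borel) (\<lambda>x. (X x + Y x, X x - Y x))) (A \<times> B)" by simp
    qed (simp_all add: S.sigma_finite_measure_axioms T.sigma_finite_measure_axioms)
  qed simp_all
qed

section \<open>Almost sure limits through characteristic functions\<close>

lemma (in prob_space) char_distr_eq:
  assumes [measurable]: "Y \<in> borel_measurable M"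
  shows "char (distr M borel Y) t = (\<integral>\<omega>. iexp (t * Y \<omega>) \<partial>M)"
  unfolding char_def by (subst integral_distr) auto

lemma (in prob_space) char_distr_tendsto:
  assumes [measurable]: "\<And>n. Y n \<in> borel_measurable M" "Y' \<in> borel_measurable M"
    and lim: "AE \<omega> in M. (\<lambda>n. Y n \<omega>) \<longlonglongrightarrow> Y' \<omega>"
  shows "(\<lambda>n. char (distr M borel (Y n)) t) \<longlonglongrightarrow> char (distr M borel Y') t"
  unfolding char_distr_eq[OF assms(1)] char_distr_eq[OF assms(2)]
proof (rule integral_dominated_convergence[where w = "\<lambda>_. 1"])
  show "AE \<omega> in M. (\<lambda>n. iexp (t * Y n \<omega>)) \<longlonglongrightarrow> iexp (t * Y' \<omega>)"
    using lim by eventually_elim (auto intro!: tendsto_intros)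
qed auto

text \<open>Independence of \<open>A\<close> means that \<open>Y n\<close> has the same law under
  \<open>M\<close> as under \<open>M\<close> conditioned on \<open>A\<close>. Characteristic
  functions converge under both measures, and Levy's uniqueness theorem identifies the two laws of
  the limit.\<close>

lemma (in prob_space) indep_event_limit:
  fixes Y :: "nat \<Rightarrow> 'a \<Rightarrow> real"
  assumes A: "A \<in> events" and [measurable]: "\<And>n. Y n \<in> borel_measurable M" "Y' \<in> borel_measurable M"
    and lim: "AE \<omega> in M. (\<lambda>n. Y n \<omega>) \<longlonglongrightarrow> Y' \<omega>"
    and ind: "\<And>n C. C \<in> sets borel \<Longrightarrow>
      prob (A \<inter> (Y n -` C \<inter> space M)) = prob A * prob (Y n -` C \<inter> space M)"
    and C: "C \<in> sets borel"
  shows "prob (A \<inter> (Y' -` C \<inter> space M)) = prob A * prob (Y' -` C \<inter> space M)"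
proof (cases "prob A = 0")
  case True
  have "prob (A \<inter> (Y' -` C \<inter> space M)) \<le> prob A"
    using A by (intro finite_measure_mono) auto
  with True show ?thesis
    using measure_nonneg[of M "A \<inter> (Y' -` C \<inter> space M)"] by simp
next
  case False
  let ?U = "uniform_measure M A"
  have eA: "emeasure M A \<noteq> 0" "emeasure M A \<noteq> \<infinity>"
    using False by (simp_all add: emeasure_eq_measure)
  interpret U: prob_space ?U
    using eA by (rule prob_space_uniform_measure)
  have U: "U.prob B = prob (A \<inter> B) / prob A" if "B \<in> events" for B
    using A that eA by (intro measure_uniform_measure) auto
  have eq: "distr ?U borel (Y n) = distr M borel (Y n)" for n
  proof (rule measure_eqI)
    fix D assume "D \<in> sets (distr ?U borel (Y n))"
    then have D: "D \<in> sets borel" by simp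
    then have "U.prob (Y n -` D \<inter> space M) = prob (Y n -` D \<inter> space M)"
      using False by (simp add: U ind)
    then show "emeasure (distr ?U borel (Y n)) D = emeasure (distr M borel (Y n)) D"
      using D by (simp add: emeasure_distr emeasure_eq_measure U.emeasure_eq_measure)
  qed simp
  have "AE \<omega> in ?U. (\<lambda>n. Y n \<omega>) \<longlonglongrightarrow> Y' \<omega>"
    using A lim by (intro AE_uniform_measureI) auto
  then have "(\<lambda>n. char (distr ?U borel (Y n)) t) \<longlonglongrightarrow> char (distr ?U borel Y') t" for t
    by (intro U.char_distr_tendsto) auto
  moreover have "(\<lambda>n. char (distr ?U borel (Y n)) t) \<longlonglongrightarrow> char (distr M borel Y') t" for t
    unfolding eq by (intro char_distr_tendsto lim) auto
  ultimately have "char (distr ?U borel Y') = char (distr M borel Y')"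
    using LIMSEQ_unique by blast
  then have "distr ?U borel Y' = distr M borel Y'"
    by (intro Levy_uniqueness) auto
  then have "measure (distr ?U borel Y') C = measure (distr M borel Y') C"
    by simp
  then have "U.prob (Y' -` C \<inter> space M) = prob (Y' -` C \<inter> space M)"
    using C by (simp add: measure_distr)
  then show ?thesis
    using False C by (simp add: U field_simps)
qed

lemma (in prob_space) normal_iff_char:
  assumes [measurable]: "X \<in> borel_measurable M" and \<sigma>: "0 < \<sigma>"
  shows "distributed M lborel X (normal_density 0 \<sigma>) \<longleftrightarrow>
    (\<forall>t. char (distr M borel X) t = exp (- ((\<sigma> * t)\<^sup>2) / 2))"
proof -
  have lb: "distr M lborel (\<lambda>x. X x / \<sigma>) = distr M borel (\<lambda>x. X x / \<sigma>)"
    by (rule distr_cong) auto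
  have "distributed M lborel X (normal_density 0 \<sigma>) \<longleftrightarrow>
      distributed M lborel (\<lambda>x. X x / \<sigma>) std_normal_density"
    using normal_standard_normal_convert[OF \<sigma>, of X 0] by simp
  also have "\<dots> \<longleftrightarrow> distr M borel (\<lambda>x. X x / \<sigma>) = std_normal_distribution"
    unfolding distributed_def lb by auto
  also have "\<dots> \<longleftrightarrow> char (distr M borel (\<lambda>x. X x / \<sigma>)) = char std_normal_distribution"
    by (auto intro!: Levy_uniqueness real_dist_normal_dist)
  also have "\<dots> \<longleftrightarrow> (\<forall>t. char (distr M borel (\<lambda>x. X x / \<sigma>)) (\<sigma> * t) = exp (- ((\<sigma> * t)\<^sup>2) / 2))"
  proof -
    have "\<exists>s. t = \<sigma> * s" for t
      using \<sigma> by (intro exI[of _ "t / \<sigma>"]) simp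
    then show ?thesis
      unfolding char_std_normal_distribution fun_eq_iff by metis
  qed
  also have "\<dots> \<longleftrightarrow> (\<forall>t. char (distr M borel X) t = exp (- ((\<sigma> * t)\<^sup>2) / 2))"
    using \<sigma> by (simp add: char_distr_eq)
  finally show ?thesis .
qed

lemma (in prob_space) distributed_normal_limit:
  fixes Y :: "nat \<Rightarrow> 'a \<Rightarrow> real"
  assumes Y: "\<And>n. distributed M lborel (Y n) (normal_density 0 (\<sigma> n))" "\<And>n. 0 < \<sigma> n"
    and [measurable]: "Y' \<in> borel_measurable M"
    and lim: "AE \<omega> in M. (\<lambda>n. Y n \<omega>) \<longlonglongrightarrow> Y' \<omega>"
    and \<sigma>: "\<sigma> \<longlonglongrightarrow> \<sigma>'" "0 < \<sigma>'"
  shows "distributed M lborel Y' (normal_density 0 \<sigma>')"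
proof -
  have [measurable]: "Y n \<in> borel_measurable M" for n
    using distributed_measurable[OF Y(1)] by simp
  have "char (distr M borel Y') t = exp (- ((\<sigma>' * t)\<^sup>2) / 2)" for t
  proof (rule LIMSEQ_unique)
    show "(\<lambda>n. char (distr M borel (Y n)) t) \<longlonglongrightarrow> char (distr M borel Y') t"
      by (intro char_distr_tendsto lim) auto
    have "char (distr M borel (Y n)) t = exp (- ((\<sigma> n * t)\<^sup>2) / 2)" for n
      using Y normal_iff_char[of "Y n" "\<sigma> n"] by auto
    then show "(\<lambda>n. char (distr M borel (Y n)) t) \<longlonglongrightarrow> complex_of_real (exp (- ((\<sigma>' * t)\<^sup>2) / 2))"
      by (simp only:) (intro tendsto_intros \<sigma>, simp)
  qed
  then show ?thesis
    using \<sigma>(2) by (simp add: normal_iff_char)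
qed

subsection \<open>Levy's construction of Brownian motion\<close>

text \<open>
  At stage \<open>n\<close> the entries below \<open>2\<^sup>n\<close> are the increments over the dyadic intervals of length
  \<open>2\<^sup>-\<^sup>n\<close>, and entry \<open>2\<^sup>n + j\<close> is still unused noise, which splits interval \<open>j\<close> at the next stage.
\<close>

fun levy :: "nat \<Rightarrow> (nat \<Rightarrow> real) \<Rightarrow> nat \<Rightarrow> real" where
  "levy 0 z j = z j"
| "levy (Suc n) z j = (if j < 2 ^ Suc n
     then (levy n z (j div 2) + (if even j then 1 else -1) * (sqrt (1 / 2 ^ n) * levy n z (2 ^ n + j div 2))) / 2
     else levy n z j)"

lemma measurable_levy [measurable]:
  "levy n \<in> measurable (\<Pi>\<^sub>M j\<in>UNIV. borel) (\<Pi>\<^sub>M j\<in>UNIV. borel)"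
proof -
  have "(\<lambda>z. levy n z j) \<in> borel_measurable (\<Pi>\<^sub>M j\<in>UNIV. borel)" for j
    by (induction n arbitrary: j) simp_all
  then show ?thesis
    by (intro measurable_PiM_single') auto
qed

lemma levy_children: "j < 2 ^ n \<Longrightarrow> levy (Suc n) z (2 * j) + levy (Suc n) z (2 * j + 1) = levy n z j"
  by (simp add: field_simps)

lemma (in prob_space) levy_normal:
  assumes "indep_vars (\<lambda>_. borel) Z UNIV" "\<And>j. distributed M lborel (Z j) std_normal_density"
  shows "indep_vars (\<lambda>_. borel) (\<lambda>j \<omega>. levy n (\<lambda>i. Z i \<omega>) j) UNIV \<and>
    (\<forall>j. distributed M lborel (\<lambda>\<omega>. levy n (\<lambda>i. Z i \<omega>) j)
       (normal_density 0 (if j < 2 ^ n then sqrt (1 / 2 ^ n) else 1)))"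
proof (induction n)
  case 0
  then show ?case using assms by simp
next
  case (Suc n)
  define V where "V j \<omega> = levy n (\<lambda>i. Z i \<omega>) j" for j \<omega>
  define W where "W j \<omega> = levy (Suc n) (\<lambda>i. Z i \<omega>) j" for j \<omega>
  define s where "s = sqrt (1 / 2 ^ n)"
  have s: "0 < s" by (simp add: s_def)
  have V: "indep_vars (\<lambda>_. borel) V UNIV"
    and Vd: "\<And>j. distributed M lborel (V j) (normal_density 0 (if j < 2 ^ n then s else 1))"
    using Suc unfolding V_def[abs_def] s_def by blast+
  have W_eq: "W j = (\<lambda>\<omega>. if j < 2 ^ Suc n
     then (V (j div 2) \<omega> + (if even j then 1 else -1) * (s * V (2 ^ n + j div 2) \<omega>)) / 2 else V j \<omega>)" for j
    by (simp add: fun_eq_iff W_def V_def s_def)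
  \<comment> \<open>Group \<open>g < 2 ^ n\<close> turns its inputs \<open>K g\<close>, an increment
    and its noise, into the two halves \<open>J g\<close>; entries from \<open>2 ^ Suc n\<close> on
    are copied. \<open>I\<close> leaves out the indices in between, whose noise is used up
    here.\<close>
  define K where "K g = (if g < 2 ^ n then {g, 2 ^ n + g} else {g})" for g :: nat
  define J where "J g = (if g < 2 ^ n then {2 * g, 2 * g + 1} else {g})" for g :: nat
  define I where "I = {g::nat. g < 2 ^ n \<or> 2 ^ Suc n \<le> g}"
  have disjK: "disjoint_family_on K I" and disjJ: "disjoint_family_on J I"
    by (auto simp: disjoint_family_on_def K_def J_def I_def split: if_splits)
  have UJ: "(\<Union>g\<in>I. J g) = UNIV"
  proof -
    have "j \<in> (\<Union>g\<in>I. J g)" for j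
    proof (cases "j < 2 ^ Suc n")
      case True
      then have "j div 2 \<in> I" "j \<in> J (j div 2)"
        by (auto simp: I_def J_def)
      then show ?thesis by blast
    next
      case False
      then have "j \<in> I" "j \<in> J j"
        by (auto simp: I_def J_def)
      then show ?thesis by blast
    qed
    then show ?thesis by blast
  qed
  have pair: "indep_var borel (W (2 * g)) borel (W (2 * g + 1)) \<and>
      distributed M lborel (W (2 * g)) (normal_density 0 (sqrt (1 / 2 ^ Suc n))) \<and>
      distributed M lborel (W (2 * g + 1)) (normal_density 0 (sqrt (1 / 2 ^ Suc n)))"
    if g: "g < 2 ^ n" for g
  proof -
    \<comment> \<open>The factor \<open>s\<close> brings the unit noise to the standard deviation of
      the parent increment, as the rotation requires equal variances.\<close>
    let ?X = "\<lambda>\<omega>. V g \<omega> / 2" and ?Y = "\<lambda>\<omega>. s * V (2 ^ n + g) \<omega> / 2"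
    have "indep_vars (\<lambda>b. borel) (\<lambda>b. V (case_bool g (2 ^ n + g) b)) UNIV"
      by (rule indep_vars_reindex[OF V]) (auto simp: inj_on_def split: bool.splits)
    then have "indep_vars (\<lambda>b. borel) (\<lambda>b \<omega>. (case b of True \<Rightarrow> (\<lambda>x. x / 2) | False \<Rightarrow> (\<lambda>x. s * x / 2))
        (V (case_bool g (2 ^ n + g) b) \<omega>)) UNIV"
      by (rule indep_vars_compose2) (auto split: bool.split)
    moreover have "(\<lambda>b \<omega>. (case b of True \<Rightarrow> (\<lambda>x. x / 2) | False \<Rightarrow> (\<lambda>x. s * x / 2))
        (V (case_bool g (2 ^ n + g) b) \<omega>)) = case_bool ?X ?Y"
      by (auto split: bool.split)
    moreover have "(\<lambda>b. borel) = case_bool borel borel"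
      by (auto split: bool.split)
    ultimately have ind: "indep_var borel ?X borel ?Y"
      unfolding indep_var_def by metis
    have X: "distributed M lborel ?X (normal_density 0 (s / 2))"
      using normal_density_affine[OF Vd[of g], of "1/2" 0] g s by (simp add: field_simps)
    have Y: "distributed M lborel ?Y (normal_density 0 (s / 2))"
      using normal_density_affine[OF Vd[of "2 ^ n + g"], of "s/2" 0] s by (simp add: field_simps)
    have "sqrt 2 * (s / 2) = sqrt (1 / 2 ^ Suc n)"
      by (simp add: s_def real_sqrt_divide real_sqrt_mult field_simps)
    moreover have "W (2 * g) = (\<lambda>\<omega>. ?X \<omega> + ?Y \<omega>)" "W (2 * g + 1) = (\<lambda>\<omega>. ?X \<omega> - ?Y \<omega>)"
      using g by (auto simp: W_eq fun_eq_iff field_simps)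
    ultimately show ?thesis
      using normal_rotate[OF ind _ X Y] s by simp
  qed
  have Wrest: "W j = V j" if "2 ^ Suc n \<le> j" for j
    using that by (simp add: W_eq fun_eq_iff)
  have "indep_vars (\<lambda>_. borel) W (\<Union>g\<in>I. J g)"
  proof (rule indep_vars_UNION[OF disjJ])
    define F where "F g y = (\<lambda>j\<in>J g. if j < 2 ^ Suc n
      then (y (j div 2) + (if even j then 1 else -1) * (s * y (2 ^ n + j div 2))) / 2 else y j)"
      for g and y :: "nat \<Rightarrow> real"
    have F: "F g \<in> measurable (PiM (K g) (\<lambda>_. borel)) (PiM (J g) (\<lambda>_. borel))" if "g \<in> I" for g
      unfolding F_def
    proof (intro measurable_restrict)
      fix j assume j: "j \<in> J g"
      show "(\<lambda>y. if j < 2 ^ Suc n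
        then (y (j div 2) + (if even j then 1 else -1) * (s * y (2 ^ n + j div 2))) / 2 else y j)
        \<in> borel_measurable (PiM (K g) (\<lambda>_. borel))"
      proof (cases "g < 2 ^ n")
        case True
        then have "j div 2 = g" "j < 2 ^ Suc n" "g \<in> K g" "2 ^ n + g \<in> K g"
          using j by (auto simp: J_def K_def)
        then show ?thesis by simp
      next
        case False
        then have "\<not> j < 2 ^ Suc n" "j \<in> K g"
          using j that by (auto simp: J_def K_def I_def)
        then show ?thesis by simp
      qed
    qed
    have "indep_vars (\<lambda>g. PiM (K g) (\<lambda>_. borel)) (\<lambda>g \<omega>. \<lambda>j\<in>K g. V j \<omega>) I"
      by (rule indep_vars_restrict[OF V _ disjK]) simp
    then have "indep_vars (\<lambda>g. PiM (J g) (\<lambda>_. borel)) (\<lambda>g \<omega>. F g (\<lambda>j\<in>K g. V j \<omega>)) I"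
      by (rule indep_vars_compose2) (rule F)
    moreover have "F g (\<lambda>j\<in>K g. V j \<omega>) = (\<lambda>j\<in>J g. W j \<omega>)" if "g \<in> I" for g \<omega>
      using that by (auto simp: F_def W_eq J_def K_def I_def fun_eq_iff restrict_def)
    ultimately show "indep_vars (\<lambda>g. PiM (J g) (\<lambda>_. borel)) (\<lambda>g \<omega>. \<lambda>j\<in>J g. W j \<omega>) I"
      by (subst indep_vars_cong[OF refl]) (auto simp: fun_eq_iff)
  next
    fix g assume "g \<in> I"
    then consider "g < 2 ^ n" | "2 ^ Suc n \<le> g"
      by (auto simp: I_def)
    then show "indep_vars (\<lambda>_. borel) W (J g)"
    proof cases
      case 1
      then show ?thesis
        using pair[OF 1] by (auto simp: J_def intro!: indep_vars_pair)
    next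
      case 2
      then have "J g = {g}"
        by (auto simp: J_def)
      then show ?thesis
        using Wrest[OF 2] distributed_measurable[OF Vd[of g]] by (auto intro!: indep_vars_singleton)
    qed
  qed
  moreover have "distributed M lborel (W j) (normal_density 0 (if j < 2 ^ Suc n then sqrt (1 / 2 ^ Suc n) else 1))" for j
  proof (cases "j < 2 ^ Suc n")
    case True
    then obtain g where "g < 2 ^ n" "j = 2 * g \<or> j = 2 * g + 1"
      by (intro that[of "j div 2"]) auto
    with pair[of g] True show ?thesis by auto
  next
    case False
    then show ?thesis
      using Vd[of j] Wrest[of j] by auto
  qed
  ultimately show ?case
    unfolding UJ W_def[abs_def] by simp
qed

text \<open>Row \<open>x i\<close> of an array is the noise for the unit interval \<open>[i, i + 1]\<close>.\<close>

definition dinc :: "nat \<Rightarrow> (nat \<Rightarrow> nat \<Rightarrow> real) \<Rightarrow> nat \<Rightarrow> real" where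
  "dinc n x k = levy n (x (k div 2 ^ n)) (k mod 2 ^ n)"

definition dyad :: "nat \<Rightarrow> (nat \<Rightarrow> nat \<Rightarrow> real) \<Rightarrow> nat \<Rightarrow> real" where
  "dyad n x m = (\<Sum>k<m. dinc n x k)"

text \<open>\<open>lim\<close> makes this total and measurable; where the sums diverge the value is
  junk, which almost surely does not occur.\<close>

definition unit_path :: "(nat \<Rightarrow> real) \<Rightarrow> real \<Rightarrow> real" where
  "unit_path z s = lim (\<lambda>n. \<Sum>j<nat \<lfloor>2 ^ n * s\<rfloor>. levy n z j)"

text \<open>Splitting off the integer part makes the value at \<open>t\<close> depend on the rows up
  to \<open>nat \<lfloor>t\<rfloor>\<close> alone, for every array. This is what allows splicing at
  integer times.\<close>

definition brown :: "(nat \<Rightarrow> nat \<Rightarrow> real) \<Rightarrow> real \<Rightarrow> real" where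
  "brown x t = (\<Sum>i<nat \<lfloor>t\<rfloor>. x i 0) + unit_path (x (nat \<lfloor>t\<rfloor>)) (frac t)"

text \<open>
  The base \<open>9/10\<close> only has to satisfy \<open>1/2 < (9/10)\<^sup>4\<close>, so that fourth moments give a summable
  bound, and the window \<open>[0, n]\<close> grows so that a single event controls the path on the half-line.
\<close>

definition tame :: "(nat \<Rightarrow> nat \<Rightarrow> real) \<Rightarrow> bool" where
  "tame x \<longleftrightarrow> (\<exists>N. \<forall>n\<ge>N. \<forall>k<n * 2 ^ n. \<bar>dinc n x k\<bar> \<le> (9/10) ^ n)"

section \<open>Dyadic sums and their limit\<close>

lemma dinc_children: "dinc (Suc n) x (2 * k) + dinc (Suc n) x (Suc (2 * k)) = dinc n x k"
proof -
  have 1: "(2 * k) div 2 ^ Suc n = k div 2 ^ n" "(2 * k) mod 2 ^ Suc n = 2 * (k mod 2 ^ n)"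
    by (simp_all only: power_Suc div_mult_mult1 mod_mult_mult1)
  have 2: "Suc (2 * k) div 2 ^ Suc n = k div 2 ^ n"
    by (simp add: div_mult2_eq)
  have 3: "Suc (2 * k) mod 2 ^ Suc n = 2 * (k mod 2 ^ n) + 1"
    by (simp add: mod_mult2_eq)
  show ?thesis
    unfolding dinc_def 1 2 3 by (rule levy_children) simp
qed

lemma dyad_Suc_double: "dyad (Suc n) x (2 * m) = dyad n x m"
proof (induction m)
  case (Suc m)
  then show ?case using dinc_children[of n x m] by (simp add: dyad_def)
qed (simp add: dyad_def)

lemma dyad_refine: "dyad (n + d) x (2 ^ d * m) = dyad n x m"
proof (induction d)
  case (Suc d)
  have "dyad (n + Suc d) x (2 ^ Suc d * m) = dyad (Suc (n + d)) x (2 * (2 ^ d * m))"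
    by (simp add: mult.assoc)
  then show ?case using Suc dyad_Suc_double by simp
qed simp

lemma dyad_0: "dyad 0 x m = (\<Sum>i<m. x i 0)"
  by (simp add: dyad_def dinc_def)

lemma dyad_split:
  assumes "j \<le> 2 ^ n"
  shows "dyad n x (2 ^ n * i + j) = (\<Sum>i'<i. x i' 0) + (\<Sum>j'<j. levy n (x i) j')"
  using assms
proof (induction j)
  case 0
  then show ?case using dyad_refine[of 0 n x i] by (simp add: dyad_0)
next
  case (Suc j)
  then have "dinc n x (2 ^ n * i + j) = levy n (x i) j"
    by (simp add: dinc_def)
  with Suc show ?case by (simp add: dyad_def)
qed

lemma floor_power2_split:
  assumes "0 \<le> t"
  shows "nat \<lfloor>2 ^ n * t\<rfloor> = 2 ^ n * nat \<lfloor>t\<rfloor> + nat \<lfloor>2 ^ n * frac t\<rfloor>"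
proof -
  have "2 ^ n * t = of_int (2 ^ n * \<lfloor>t\<rfloor>) + 2 ^ n * frac t"
    by (simp add: frac_def algebra_simps)
  then have "\<lfloor>2 ^ n * t\<rfloor> = 2 ^ n * \<lfloor>t\<rfloor> + \<lfloor>2 ^ n * frac t\<rfloor>"
    by (simp only: int_add_floor[symmetric])
  moreover have "0 \<le> \<lfloor>t\<rfloor>" "0 \<le> \<lfloor>2 ^ n * frac t\<rfloor>"
    using assms by (simp_all add: frac_ge_0)
  ultimately show ?thesis
    by (simp add: nat_add_distrib nat_mult_distrib nat_power_eq)
qed

lemma dyad_floor:
  assumes "0 \<le> t"
  shows "dyad n x (nat \<lfloor>2 ^ n * t\<rfloor>) = (\<Sum>i<nat \<lfloor>t\<rfloor>. x i 0) +
    (\<Sum>j<nat \<lfloor>2 ^ n * frac t\<rfloor>. levy n (x (nat \<lfloor>t\<rfloor>)) j)"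
proof -
  have "2 ^ n * frac t < 2 ^ n * 1"
    by (intro mult_strict_left_mono frac_lt_1) simp
  then have "\<lfloor>2 ^ n * frac t\<rfloor> < 2 ^ n"
    by (simp add: floor_less_iff)
  then have "nat \<lfloor>2 ^ n * frac t\<rfloor> \<le> 2 ^ n"
    by (simp add: nat_le_iff)
  then show ?thesis
    unfolding floor_power2_split[OF assms] by (rule dyad_split)
qed

text \<open>The integer part is subtracted inside the limit, so that the identity survives
  divergence; \<open>brown_past\<close> uses it on all of \<open>space M\<close>.\<close>

lemma brown_eq_lim:
  assumes "0 \<le> t"
  shows "brown x t = dyad 0 x (nat \<lfloor>t\<rfloor>) +
    lim (\<lambda>n. dyad n x (nat \<lfloor>2 ^ n * t\<rfloor>) - dyad 0 x (nat \<lfloor>t\<rfloor>))"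
  unfolding brown_def unit_path_def dyad_floor[OF assms] dyad_0 by simp

lemma brown_LIMSEQ:
  assumes "0 \<le> t" "(\<lambda>n. dyad n x (nat \<lfloor>2 ^ n * t\<rfloor>)) \<longlonglongrightarrow> L"
  shows "brown x t = L"
proof -
  have "(\<lambda>n. dyad n x (nat \<lfloor>2 ^ n * t\<rfloor>) - dyad 0 x (nat \<lfloor>t\<rfloor>)) \<longlonglongrightarrow> L - dyad 0 x (nat \<lfloor>t\<rfloor>)"
    by (intro tendsto_intros assms(2))
  then show ?thesis
    unfolding brown_eq_lim[OF assms(1)] by (simp add: limI)
qed

text \<open>At a dyadic time the approximating sums are constant from stage \<open>n\<close> on, so
  this holds for every array.\<close>

lemma brown_dyadic: "brown x (real k / 2 ^ n) = dyad n x k"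
proof (rule brown_LIMSEQ)
  have "dyad m x (nat \<lfloor>2 ^ m * (real k / 2 ^ n)\<rfloor>) = dyad n x k" if "n \<le> m" for m
  proof -
    have "(2::real) ^ m = 2 ^ n * 2 ^ (m - n)"
      using that by (simp flip: power_add)
    then have "2 ^ m * (real k / 2 ^ n) = real (2 ^ (m - n) * k)"
      by simp
    then have "nat \<lfloor>2 ^ m * (real k / 2 ^ n)\<rfloor> = 2 ^ (m - n) * k"
      by (metis floor_of_nat nat_int)
    then show ?thesis
      using dyad_refine[of n "m - n" x k] that by simp
  qed
  then show "(\<lambda>m. dyad m x (nat \<lfloor>2 ^ m * (real k / 2 ^ n)\<rfloor>)) \<longlonglongrightarrow> dyad n x k"
    by (intro tendsto_eventually) (auto simp: eventually_sequentially)
qed simp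

lemma brown_of_nat: "brown x (real k) = (\<Sum>i<k. x i 0)"
  using brown_dyadic[of x k 0] by (simp add: dyad_0)

lemma brown_0 [simp]: "brown x 0 = 0"
  using brown_of_nat[of x 0] by simp

lemma brown_cong:
  assumes "\<And>i. i \<le> nat \<lfloor>t\<rfloor> \<Longrightarrow> x i = y i"
  shows "brown x t = brown y t"
  using assms by (simp add: brown_def)

section \<open>Geometric convergence and continuity of paths\<close>

text \<open>The factor \<open>10\<close> is \<open>1 / (1 - 9/10)\<close>, from the tail of the
  geometric series.\<close>

lemma geometric_increments:
  fixes a :: "nat \<Rightarrow> real"
  assumes inc: "\<And>n. N \<le> n \<Longrightarrow> \<bar>a (Suc n) - a n\<bar> \<le> (9/10) ^ n"
  shows "convergent a" and "\<And>L n. a \<longlonglongrightarrow> L \<Longrightarrow> N \<le> n \<Longrightarrow> \<bar>L - a n\<bar> \<le> 10 * (9/10) ^ n"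
proof -
  have diff: "\<bar>a (n + k) - a n\<bar> \<le> 10 * ((9/10) ^ n - (9/10) ^ (n + k))" if "N \<le> n" for n k
  proof (induction k)
    case (Suc k)
    then show ?case using inc[of "n + k"] that by simp
  qed simp
  show "convergent a"
  proof (rule Cauchy_convergent, rule metric_CauchyI)
    fix e :: real assume "0 < e"
    then have "\<forall>\<^sub>F n in sequentially. 20 * (9/10) ^ n < e"
      by (intro order_tendstoD(2)[of _ 0]) (auto intro!: tendsto_eq_intros)
    then obtain n0 where n0: "\<And>n. n0 \<le> n \<Longrightarrow> 20 * (9/10) ^ n < e"
      by (auto simp: eventually_sequentially)
    define p where "p = max N n0"
    then have Np: "N \<le> p" by simp
    have p: "\<bar>a m - a p\<bar> \<le> 10 * (9/10) ^ p" if "p \<le> m" for m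
    proof -
      obtain k where "m = p + k" using \<open>p \<le> m\<close> le_Suc_ex by blast
      moreover have "\<bar>a (p + k) - a p\<bar> \<le> 10 * (9/10) ^ p"
        by (rule order_trans[OF diff[OF Np]]) simp
      ultimately show ?thesis by simp
    qed
    show "\<exists>M. \<forall>m\<ge>M. \<forall>n\<ge>M. dist (a m) (a n) < e"
    proof (intro exI[of _ p] allI impI)
      fix m n assume "p \<le> m" "p \<le> n"
      then show "dist (a m) (a n) < e"
        using p[of m] p[of n] n0[of p] by (auto simp: dist_real_def p_def)
    qed
  qed
  fix L n assume L: "a \<longlonglongrightarrow> L" and n: "N \<le> n"
  have "(\<lambda>k. \<bar>a (n + k) - a n\<bar>) \<longlonglongrightarrow> \<bar>L - a n\<bar>"
    using LIMSEQ_ignore_initial_segment[OF L, of n] by (intro tendsto_intros) (simp add: add.commute)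
  moreover have "\<bar>a (n + k) - a n\<bar> \<le> 10 * (9/10) ^ n" for k
    by (rule order_trans[OF diff[OF n]]) simp
  ultimately show "\<bar>L - a n\<bar> \<le> 10 * (9/10) ^ n"
    by (auto intro: LIMSEQ_le_const2)
qed

lemma dyad_near:
  assumes b: "\<And>k. k < m \<Longrightarrow> \<bar>dinc n x k\<bar> \<le> c" and "i \<le> m" "j \<le> m" "i \<le> Suc j" "j \<le> Suc i" "0 \<le> c"
  shows "\<bar>dyad n x i - dyad n x j\<bar> \<le> c"
proof -
  consider "i = j" | "i = Suc j" | "j = Suc i"
    using assms by linarith
  then show ?thesis
    by cases (use b[of i] b[of j] assms in \<open>auto simp: dyad_def\<close>)
qed

text \<open>From one stage to the next the grid index \<open>k\<close> of \<open>t\<close> becomes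
  \<open>2 * k\<close> or \<open>2 * k + 1\<close>, so the partial sum changes by at most one
  increment of the finer stage, and tameness makes these changes geometrically small.\<close>

lemma tame_brown:
  assumes "tame x"
  obtains N where
    "\<And>t n. N \<le> n \<Longrightarrow> 0 \<le> t \<Longrightarrow> t < real n \<Longrightarrow> \<bar>brown x t - dyad n x (nat \<lfloor>2 ^ n * t\<rfloor>)\<bar> \<le> 10 * (9/10) ^ n"
    "\<And>n k. N \<le> n \<Longrightarrow> k < n * 2 ^ n \<Longrightarrow> \<bar>dinc n x k\<bar> \<le> (9/10) ^ n"
proof -
  from assms obtain N where N: "\<And>n k. N \<le> n \<Longrightarrow> k < n * 2 ^ n \<Longrightarrow> \<bar>dinc n x k\<bar> \<le> (9/10) ^ n"
    by (auto simp: tame_def)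
  have "\<bar>brown x t - dyad n x (nat \<lfloor>2 ^ n * t\<rfloor>)\<bar> \<le> 10 * (9/10) ^ n"
    if n: "N \<le> n" and t: "0 \<le> t" "t < real n" for t n
  proof -
    define a where "a m = dyad m x (nat \<lfloor>2 ^ m * t\<rfloor>)" for m
    have inc: "\<bar>a (Suc m) - a m\<bar> \<le> (9/10) ^ m" if m: "n \<le> m" for m
    proof -
      let ?k = "nat \<lfloor>2 ^ m * t\<rfloor>"
      have fl: "real ?k \<le> 2 ^ m * t" "2 ^ m * t < real ?k + 1"
        using t by (simp_all add: of_nat_floor)
      let ?k' = "nat \<lfloor>2 ^ Suc m * t\<rfloor>"
      have fl': "real ?k' \<le> 2 ^ Suc m * t" "2 ^ Suc m * t < real ?k' + 1"
        using t by (simp_all add: of_nat_floor)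
      have "real (2 * ?k) < real ?k' + 1" "real ?k' < real (2 * ?k) + 2"
      proof -
        have "2 ^ Suc m * t = 2 * (2 ^ m * t)" by simp
        then show "real (2 * ?k) < real ?k' + 1" "real ?k' < real (2 * ?k) + 2"
          using fl fl' unfolding of_nat_mult of_nat_numeral by linarith+
      qed
      then have kk: "2 * ?k \<le> ?k'" "?k' \<le> Suc (2 * ?k)"
        by linarith+
      have "2 ^ Suc m * t \<le> 2 ^ Suc m * real m"
        using t m by (intro mult_left_mono) auto
      with fl'(1) have "real ?k' \<le> 2 ^ Suc m * real m"
        by (rule order_trans)
      also have "\<dots> = real (m * 2 ^ Suc m)" by simp
      finally have km: "?k' \<le> m * 2 ^ Suc m"
        by linarith
      have "\<bar>dyad (Suc m) x ?k' - dyad (Suc m) x (2 * ?k)\<bar> \<le> (9/10) ^ m"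
      proof (rule dyad_near[of "m * 2 ^ Suc m"])
        fix k assume "k < m * 2 ^ Suc m"
        also have "\<dots> \<le> Suc m * 2 ^ Suc m" by simp
        finally have "\<bar>dinc (Suc m) x k\<bar> \<le> (9/10) ^ Suc m"
          using N[of "Suc m" k] n m by simp
        also have "\<dots> \<le> (9/10) ^ m" by simp
        finally show "\<bar>dinc (Suc m) x k\<bar> \<le> (9/10) ^ m" .
      qed (use kk km in auto)
      then show ?thesis
        by (simp add: a_def dyad_Suc_double del: power_Suc)
    qed
    obtain L where L: "a \<longlonglongrightarrow> L"
      using geometric_increments(1)[of n a] inc by (auto simp: convergent_def)
    then have "brown x t = L"
      using t unfolding a_def by (intro brown_LIMSEQ) auto
    then show ?thesis
      using geometric_increments(2)[of n a L n] inc L by (simp add: a_def)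
  qed
  with N show ?thesis using that by blast
qed

lemma tame_continuous:
  assumes "tame x"
  shows "continuous_on {0..} (brown x)"
proof -
  obtain N where
    N: "\<And>t n. N \<le> n \<Longrightarrow> 0 \<le> t \<Longrightarrow> t < real n \<Longrightarrow> \<bar>brown x t - dyad n x (nat \<lfloor>2 ^ n * t\<rfloor>)\<bar> \<le> 10 * (9/10) ^ n"
    "\<And>n k. N \<le> n \<Longrightarrow> k < n * 2 ^ n \<Longrightarrow> \<bar>dinc n x k\<bar> \<le> (9/10) ^ n"
    using tame_brown[OF assms] by blast
  show ?thesis
    unfolding continuous_on_iff
  proof (intro ballI allI impI)
    fix t e :: real assume t: "t \<in> {0..}" and "0 < e"
    \<comment> \<open>\<open>21 = 10 + 10 + 1\<close>: the approximation errors at \<open>s\<close>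
      and \<open>t\<close>, and one dyadic increment between their grid points.\<close>
    then have "\<forall>\<^sub>F n in sequentially. 21 * (9/10) ^ n < e"
      by (intro order_tendstoD(2)[of _ 0]) (auto intro!: tendsto_eq_intros)
    then obtain n0 where n0: "\<And>n. n0 \<le> n \<Longrightarrow> 21 * (9/10) ^ n < e"
      by (auto simp: eventually_sequentially)
    \<comment> \<open>The window of stage \<open>n\<close> must also contain all points within
      distance \<open>1\<close> of \<open>t\<close>.\<close>
    define n where "n = max (max N n0) (nat \<lceil>t\<rceil> + 2)"
    have n: "N \<le> n" "n0 \<le> n" "t + 1 < real n"
      unfolding n_def by linarith+
    show "\<exists>d>0. \<forall>s\<in>{0..}. dist s t < d \<longrightarrow> dist (brown x s) (brown x t) < e"
    proof (intro exI[of _ "1 / 2 ^ n"] conjI ballI impI)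
      fix s :: real assume s: "s \<in> {0..}" and d: "dist s t < 1 / 2 ^ n"
      have "1 / 2 ^ n \<le> (1::real)" by simp
      with d have "dist s t < 1" by (rule less_le_trans)
      then have sn: "s < real n" "t < real n"
        using n by (auto simp: dist_real_def)
      let ?i = "nat \<lfloor>2 ^ n * s\<rfloor>" and ?j = "nat \<lfloor>2 ^ n * t\<rfloor>"
      have "2 ^ n * \<bar>s - t\<bar> < 1"
        using d by (simp add: dist_real_def field_simps)
      then have "\<bar>2 ^ n * s - 2 ^ n * t\<bar> < 1"
        by (simp add: abs_mult right_diff_distrib[symmetric])
      moreover have "0 \<le> 2 ^ n * s" "0 \<le> 2 ^ n * t"
        using s t by auto
      ultimately have ij: "?i \<le> Suc ?j" "?j \<le> Suc ?i"
        by linarith+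
      have "2 ^ n * s \<le> 2 ^ n * real n" "2 ^ n * t \<le> 2 ^ n * real n"
        using sn by (auto intro!: mult_left_mono)
      then have "2 ^ n * s \<le> real (n * 2 ^ n)" "2 ^ n * t \<le> real (n * 2 ^ n)"
        by (simp_all add: mult.commute)
      then have "?i \<le> n * 2 ^ n" "?j \<le> n * 2 ^ n"
        by linarith+
      then have "\<bar>dyad n x ?i - dyad n x ?j\<bar> \<le> (9/10) ^ n"
        using N(2)[OF n(1)] ij by (intro dyad_near[of "n * 2 ^ n"]) auto
      moreover have "\<bar>brown x s - dyad n x ?i\<bar> \<le> 10 * (9/10) ^ n" "\<bar>brown x t - dyad n x ?j\<bar> \<le> 10 * (9/10) ^ n"
        using N(1)[OF n(1)] s t sn by auto
      ultimately show "dist (brown x s) (brown x t) < e"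
        using n0[OF n(2)] by (simp add: dist_real_def)
    qed simp
  qed
qed

section \<open>Gaussian arrays\<close>

lemma (in prob_space) coordinates_of_PiM:
  fixes N :: "'i \<Rightarrow> 'b measure"
  assumes [measurable]: "Y \<in> measurable M (PiM UNIV N)"
    and law: "distr M (PiM UNIV N) Y = PiM UNIV N" and N: "\<And>i. prob_space (N i)"
  shows "distr M (N i) (\<lambda>\<omega>. Y \<omega> i) = N i"
    and "indep_vars N (\<lambda>i \<omega>. Y \<omega> i) UNIV"
proof -
  interpret PP: product_prob_space N UNIV
    by (intro product_prob_spaceI N)
  have *: "distr M (N i) (\<lambda>\<omega>. Y \<omega> i) = N i" for i
  proof -
    have "distr M (N i) (\<lambda>\<omega>. Y \<omega> i) = distr (distr M (PiM UNIV N) Y) (N i) (\<lambda>x. x i)"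
      by (subst distr_distr) (auto simp: comp_def)
    also have "\<dots> = N i"
      unfolding law by (rule PP.PiM_component) simp
    finally show ?thesis .
  qed
  then show "distr M (N i) (\<lambda>\<omega>. Y \<omega> i) = N i" .
  show "indep_vars N (\<lambda>i \<omega>. Y \<omega> i) UNIV"
    by (subst indep_vars_iff_distr_eq_PiM') (simp_all add: * law restrict_def)
qed

definition gauss_seq :: "(nat \<Rightarrow> real) measure" where
  "gauss_seq = PiM UNIV (\<lambda>_. std_normal_distribution)"

definition gauss_array :: "(nat \<Rightarrow> nat \<Rightarrow> real) measure" where
  "gauss_array = PiM UNIV (\<lambda>_. gauss_seq)"

lemma sets_gauss_seq [measurable_cong]: "sets gauss_seq = sets (\<Pi>\<^sub>M j\<in>UNIV. borel)"
  unfolding gauss_seq_def by (intro sets_PiM_cong) auto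

lemma sets_gauss_array [measurable_cong]:
  "sets gauss_array = sets (\<Pi>\<^sub>M i\<in>UNIV. \<Pi>\<^sub>M j\<in>UNIV. borel)"
  unfolding gauss_array_def by (intro sets_PiM_cong sets_gauss_seq) auto

lemma space_gauss_array [simp]: "space gauss_array = UNIV"
  using sets_eq_imp_space_eq[OF sets_gauss_array] by (simp add: space_PiM)

lemma prob_space_std_normal: "prob_space std_normal_distribution"
  by (intro prob_space_normal_density) simp

lemma prob_space_gauss_seq: "prob_space gauss_seq"
  unfolding gauss_seq_def by (intro prob_space_PiM prob_space_std_normal)

lemma prob_space_gauss_array: "prob_space gauss_array"
  unfolding gauss_array_def by (intro prob_space_PiM prob_space_gauss_seq)

lemma measurable_array_component:
  "(\<lambda>x. x i) \<in> measurable gauss_array (\<Pi>\<^sub>M j\<in>UNIV. borel)"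
  by measurable

lemma measurable_array_entry [measurable]: "(\<lambda>x. x i j) \<in> borel_measurable gauss_array"
  by (rule measurable_compose[OF measurable_array_component measurable_component_singleton]) simp

lemma measurable_levy_entry: "(\<lambda>z. levy n z j) \<in> borel_measurable (\<Pi>\<^sub>M j\<in>UNIV. borel)"
  by (rule measurable_compose[OF measurable_levy measurable_component_singleton]) simp

lemma measurable_dinc [measurable]: "(\<lambda>x. dinc n x k) \<in> borel_measurable gauss_array"
  unfolding dinc_def by (rule measurable_compose[OF measurable_array_component measurable_levy_entry])

lemma measurable_unit_path [measurable]:
  "(\<lambda>z. unit_path z s) \<in> borel_measurable (\<Pi>\<^sub>M j\<in>UNIV. borel)"
  unfolding unit_path_def
  by (intro borel_measurable_lim_metric borel_measurable_sum measurable_levy_entry)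

lemma measurable_brown [measurable]: "(\<lambda>x. brown x t) \<in> borel_measurable gauss_array"
proof -
  have "(\<lambda>x. unit_path (x i) s) \<in> borel_measurable gauss_array" for i s
    by (rule measurable_compose[OF measurable_array_component measurable_unit_path])
  then show ?thesis
    unfolding brown_def by measurable
qed

section \<open>The path driven by a Gaussian array\<close>

text \<open>Second moments would not do: a variance \<open>1 / 2 ^ n\<close> only compensates the
  number \<open>2 ^ n\<close> of increments per unit interval. The fourth moment gains another
  factor \<open>1 / 2 ^ n\<close>.\<close>

lemma (in prob_space) normal_fourth_moment:
  assumes D: "distributed M lborel D (normal_density 0 \<sigma>)" and \<sigma>: "0 < \<sigma>" and a: "0 < a"
  shows "prob {\<omega>\<in>space M. a \<le> \<bar>D \<omega>\<bar>} \<le> 3 * \<sigma> ^ 4 / a ^ 4"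
proof -
  have [measurable]: "D \<in> borel_measurable M"
    using distributed_measurable[OF D] by simp
  have mom: "has_bochner_integral lborel (\<lambda>x. normal_density 0 \<sigma> x * x ^ 4) (3 * \<sigma> ^ 4)"
    using normal_moment_even[OF \<sigma>, of 0 2] \<sigma>
    by (simp add: fact_numeral power_divide power2_eq_square power4_eq_xxxx mult.assoc)
  have int: "integrable M (\<lambda>\<omega>. D \<omega> ^ 4)"
    using distributed_integrable[OF D, of "\<lambda>x. x ^ 4"] mom
    by (auto simp: has_bochner_integral_iff)
  have "(\<integral>\<omega>. D \<omega> ^ 4 \<partial>M) = 3 * \<sigma> ^ 4"
    using distributed_integral[OF D, of "\<lambda>x. x ^ 4"] mom
    by (auto simp: has_bochner_integral_iff)
  moreover have "prob {\<omega>\<in>space M. a ^ 4 \<le> D \<omega> ^ 4} \<le> (\<integral>\<omega>. D \<omega> ^ 4 \<partial>M) / a ^ 4"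
    using a by (intro integral_Markov_inequality_measure[OF int sets.empty_sets]) auto
  moreover have "(a ^ 4 \<le> D \<omega> ^ 4) = (a \<le> \<bar>D \<omega>\<bar>)" for \<omega>
  proof -
    have "D \<omega> ^ 4 = \<bar>D \<omega>\<bar> ^ 4"
      by (simp add: power_even_abs)
    moreover have "(a ^ 4 \<le> \<bar>D \<omega>\<bar> ^ 4) = (a \<le> \<bar>D \<omega>\<bar>)"
      using a by (intro power_mono_iff) auto
    ultimately show ?thesis by metis
  qed
  ultimately show ?thesis by simp
qed

text \<open>Stated for a random array on any space because it is used for the array of each block,
  for the spliced array from each block onwards, and for the identity on
  \<open>gauss_array\<close>.\<close>

locale brownian_source = prob_space M for M :: "'a measure" +
  fixes Y :: "'a \<Rightarrow> nat \<Rightarrow> nat \<Rightarrow> real"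
  assumes measurable_Y [measurable]: "Y \<in> measurable M gauss_array"
    and law_Y: "distr M gauss_array Y = gauss_array"
begin

lemma array_entry_normal:
  "indep_vars (\<lambda>_. borel) (\<lambda>j \<omega>. Y \<omega> i j) UNIV"
  "distributed M lborel (\<lambda>\<omega>. Y \<omega> i j) std_normal_density"
proof -
  have Yi: "(\<lambda>\<omega>. Y \<omega> i) \<in> measurable M gauss_seq"
    using measurable_compose[OF measurable_Y measurable_array_component]
    by (simp add: measurable_cong_sets[OF refl sets_gauss_seq])
  have row: "distr M gauss_seq (\<lambda>\<omega>. Y \<omega> i) = gauss_seq"
    using coordinates_of_PiM(1)[of Y "\<lambda>_. gauss_seq" i] measurable_Y law_Y prob_space_gauss_seq
    by (simp add: gauss_array_def)
  note c = coordinates_of_PiM[of "\<lambda>\<omega>. Y \<omega> i" "\<lambda>_. std_normal_distribution",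
      folded gauss_seq_def, OF Yi row prob_space_std_normal]
  show "indep_vars (\<lambda>_. borel) (\<lambda>j \<omega>. Y \<omega> i j) UNIV"
    by (rule indep_vars_compose2[OF c(2), of "\<lambda>_ x. x"]) simp
  have "distr M lborel (\<lambda>\<omega>. Y \<omega> i j) = distr M std_normal_distribution (\<lambda>\<omega>. Y \<omega> i j)"
    by (rule distr_cong) auto
  then show "distributed M lborel (\<lambda>\<omega>. Y \<omega> i j) std_normal_density"
    unfolding distributed_def by (auto simp: c(1))
qed

lemma array_rows_indep: "indep_vars (\<lambda>_. \<Pi>\<^sub>M j\<in>UNIV. borel) (\<lambda>i \<omega>. Y \<omega> i) UNIV"
proof -
  have "indep_vars (\<lambda>_. gauss_seq) (\<lambda>i \<omega>. Y \<omega> i) UNIV"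
    using coordinates_of_PiM(2)[of Y "\<lambda>_. gauss_seq"] measurable_Y law_Y prob_space_gauss_seq
    by (simp add: gauss_array_def)
  then show ?thesis
    by (rule indep_vars_compose2[where Y = "\<lambda>_ x. x"]) measurable
qed

lemma dinc_normal: "distributed M lborel (\<lambda>\<omega>. dinc n (Y \<omega>) k) (normal_density 0 (sqrt (1 / 2 ^ n)))"
proof -
  have "k mod 2 ^ n < 2 ^ n" by simp
  then show ?thesis
    using levy_normal[OF array_entry_normal[where i = "k div 2 ^ n"], where n = n, THEN conjunct2,
        THEN spec, of "k mod 2 ^ n"]
    by (simp add: dinc_def)
qed

text \<open>Rows are independent, and so are the increments inside each row; the pairs of row and
  position are then renumbered by \<open>k\<close>.\<close>

lemma dinc_indep: "indep_vars (\<lambda>_. borel) (\<lambda>k \<omega>. dinc n (Y \<omega>) k) UNIV"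
proof -
  define X where "X p \<omega> = levy n (Y \<omega> (fst p)) (snd p)" for p \<omega>
  have "indep_vars (\<lambda>_. borel) X (\<Union>i\<in>UNIV. {i} \<times> UNIV)"
  proof (rule indep_vars_UNION)
    have "indep_vars (\<lambda>i. \<Pi>\<^sub>M p\<in>{i} \<times> UNIV. borel)
        (\<lambda>i \<omega>. (\<lambda>z. \<lambda>p\<in>{i} \<times> UNIV. levy n z (snd p)) (Y \<omega> i)) UNIV"
      by (rule indep_vars_compose2[OF array_rows_indep])
        (intro measurable_restrict measurable_levy_entry)
    moreover have "(\<lambda>i \<omega>. (\<lambda>z. \<lambda>p\<in>{i} \<times> UNIV. levy n z (snd p)) (Y \<omega> i)) =
        (\<lambda>i \<omega>. \<lambda>p\<in>{i} \<times> UNIV. X p \<omega>)"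
      by (auto simp: X_def fun_eq_iff restrict_def)
    ultimately show "indep_vars (\<lambda>i. \<Pi>\<^sub>M p\<in>{i} \<times> UNIV. borel) (\<lambda>i \<omega>. \<lambda>p\<in>{i} \<times> UNIV. X p \<omega>) UNIV"
      by simp
    fix i
    have "indep_vars (\<lambda>_. borel) (\<lambda>j \<omega>. levy n (\<lambda>l. Y \<omega> i l) j) UNIV"
      using levy_normal[OF array_entry_normal] by blast
    then have "indep_vars (\<lambda>_. borel) (\<lambda>p \<omega>. levy n (\<lambda>l. Y \<omega> i l) (snd p)) ({i} \<times> UNIV)"
      by (rule indep_vars_reindex) (auto simp: inj_on_def)
    then show "indep_vars (\<lambda>_. borel) X ({i} \<times> UNIV)"
      by (subst indep_vars_cong[OF refl]) (auto simp: X_def fun_eq_iff)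
  qed (auto simp: disjoint_family_on_def)
  then have "indep_vars (\<lambda>_. borel) (\<lambda>k. X (k div 2 ^ n, k mod 2 ^ n)) UNIV"
    by (rule indep_vars_reindex) (auto simp: inj_on_def, metis div_mult_mod_eq)
  then show ?thesis
    by (simp add: X_def[abs_def] dinc_def)
qed

lemma AE_tame: "AE \<omega> in M. tame (Y \<omega>)"
proof -
  define E where "E n = (\<Union>k<n * 2 ^ n. {\<omega>\<in>space M. (9/10) ^ n \<le> \<bar>dinc n (Y \<omega>) k\<bar>})" for n
  have [measurable]: "E n \<in> events" for n
    unfolding E_def by measurable
  \<comment> \<open>\<open>c\<close> is \<open>(1/2) / (9/10)^4\<close>: stage \<open>n\<close> has
    \<open>n * 2 ^ n\<close> events, each of probability at most
    \<open>3 * (1/4)^n / (9/10)^(4 * n)\<close>. The bound is written with \<open>Suc n\<close> to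
    match the derivative of the geometric series.\<close>
  define c :: real where "c = 10000 / 13122"
  have le: "prob (E n) \<le> 3 * (real (Suc n) * c ^ n)" for n
  proof -
    have "prob (E n) \<le> (\<Sum>k<n * 2 ^ n. prob {\<omega>\<in>space M. (9/10) ^ n \<le> \<bar>dinc n (Y \<omega>) k\<bar>})"
      unfolding E_def by (intro finite_measure_subadditive_finite) auto
    also have "\<dots> \<le> (\<Sum>k<n * 2 ^ n. 3 * sqrt (1 / 2 ^ n) ^ 4 / ((9/10) ^ n) ^ 4)"
      by (intro sum_mono normal_fourth_moment dinc_normal) auto
    also have "\<dots> = real (n * 2 ^ n) * (3 * sqrt (1 / 2 ^ n) ^ 4 / ((9/10) ^ n) ^ 4)"
      by simp
    also have "sqrt (1 / 2 ^ n) ^ 4 = (1 / 2 ^ n) ^ 2"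
      using real_sqrt_pow2[of "1 / 2 ^ n"] by (simp only: power4_eq_xxxx power2_eq_square) simp
    also have "real (n * 2 ^ n) * (3 * (1 / 2 ^ n) ^ 2 / ((9/10) ^ n) ^ 4) = 3 * (real n * c ^ n)"
    proof -
      have "((9/10::real) ^ n) ^ 4 = ((9/10) ^ 4) ^ n"
        by (simp only: power_mult[symmetric] mult.commute)
      moreover have "(2::real) ^ n * (1 / 2 ^ n) ^ 2 = (1/2) ^ n"
        by (simp add: power2_eq_square power_divide)
      moreover have "(1/2) / (9/10) ^ 4 = c"
        by (simp add: c_def power4_eq_xxxx)
      then have "(1/2) ^ n / ((9/10) ^ 4) ^ n = c ^ n"
        by (metis power_divide)
      ultimately show ?thesis
        by (metis (no_types, opaque_lifting) mult.assoc mult.left_commute of_nat_mult of_nat_numeral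
            of_nat_power times_divide_eq_right)
    qed
    also have "\<dots> \<le> 3 * (real (Suc n) * c ^ n)"
      by (simp add: c_def)
    finally show ?thesis .
  qed
  have "summable (\<lambda>n. 3 * (real (Suc n) * c ^ n))"
    using geometric_deriv_sums[of c] by (intro summable_mult) (auto simp: c_def sums_iff)
  then have "summable (\<lambda>n. prob (E n))"
    by (rule summable_comparison_test'[where N = 0]) (simp only: real_norm_def abs_of_nonneg[OF measure_nonneg] le)
  then have "AE \<omega> in M. \<forall>\<^sub>F n in sequentially. \<omega> \<in> space M - E n"
    by (intro borel_cantelli_AE1) (auto simp: emeasure_eq_measure)
  then show ?thesis
  proof eventually_elim
    case (elim \<omega>)
    then obtain N where "\<And>n. N \<le> n \<Longrightarrow> \<omega> \<in> space M - E n"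
      by (auto simp: eventually_sequentially)
    then show "tame (Y \<omega>)"
      unfolding tame_def E_def by (intro exI[of _ N]) (force simp: not_le)
  qed
qed

end

subsection \<open>The augmented filtration\<close>

text \<open>Reduces joint independence to one step at a time: the event about the first
  \<open>m\<close> variables lies in \<open>F m\<close>, so each new variable splits off one
  factor.\<close>

lemma (in prob_space) indep_vars_sequentially:
  fixes W :: "nat \<Rightarrow> 'a \<Rightarrow> real"
  assumes W: "\<And>i. i < n \<Longrightarrow> W i \<in> borel_measurable M"
    and F: "\<And>i. i < n \<Longrightarrow> sigma_algebra (space M) (F i)"
    and adapted: "\<And>i j C. j < i \<Longrightarrow> i < n \<Longrightarrow> C \<in> sets borel \<Longrightarrow> W j -` C \<inter> space M \<in> F i"
    and ind: "\<And>i A C. i < n \<Longrightarrow> A \<in> F i \<Longrightarrow> C \<in> sets borel \<Longrightarrow>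
      prob (A \<inter> (W i -` C \<inter> space M)) = prob A * prob (W i -` C \<inter> space M)"
  shows "indep_vars (\<lambda>_. borel) W {..<n}"
proof (cases "n = 0")
  case True
  then show ?thesis
    by (auto simp: indep_vars_def2 indep_sets_def)
next
  case False
  \<comment> \<open>\<open>space M\<close> is put in front because the intersection of no events is
    \<open>UNIV\<close>.\<close>
  have eq: "prob (space M \<inter> (\<Inter>j<m. W j -` A j \<inter> space M)) = (\<Prod>j<m. prob (W j -` A j \<inter> space M))"
    if A: "\<And>j. j < n \<Longrightarrow> A j \<in> sets borel" and "m \<le> n" for A m
    using \<open>m \<le> n\<close>
  proof (induction m)
    case 0
    then show ?case by (simp add: prob_space)
  next
    case (Suc m)
    interpret Fm: sigma_algebra "space M" "F m"
      using F Suc.prems by simp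
    let ?I = "space M \<inter> (\<Inter>j<m. W j -` A j \<inter> space M)"
    have "?I \<in> F m"
    proof (cases "m = 0")
      case False
      then have "(\<Inter>j<m. W j -` A j \<inter> space M) \<in> F m"
        using adapted A Suc.prems by (intro Fm.finite_INT) auto
      then show ?thesis by blast
    qed (use Fm.top in simp)
    moreover have "space M \<inter> (\<Inter>j<Suc m. W j -` A j \<inter> space M) = ?I \<inter> (W m -` A m \<inter> space M)"
      by (auto simp: less_Suc_eq)
    ultimately show ?case
      using ind[of m ?I "A m"] A Suc by simp
  qed
  have sp: "space M \<inter> (\<Inter>j<n. W j -` A j \<inter> space M) = (\<Inter>j<n. W j -` A j \<inter> space M)" for A
    using False by auto
  show ?thesis
  proof (subst indep_vars_finite[where E = "\<lambda>_. sets borel"])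
    show "\<forall>A\<in>{..<n} \<rightarrow> sets borel. prob (\<Inter>j<n. W j -` A j \<inter> space M) =
        (\<Prod>j<n. prob (W j -` A j \<inter> space M))"
    proof
      fix A assume "A \<in> {..<n} \<rightarrow> sets (borel :: real measure)"
      then have "\<And>j. j < n \<Longrightarrow> A j \<in> sets borel" by auto
      from eq[of A n, OF this order_refl]
      show "prob (\<Inter>j<n. W j -` A j \<inter> space M) = (\<Prod>j<n. prob (W j -` A j \<inter> space M))"
        unfolding sp .
    qed
    show "sets borel = sigma_sets (space borel) (sets (borel :: real measure))"
      by (rule sets.sigma_sets_eq[symmetric])
    show "Int_stable (sets (borel :: real measure))"
      by (rule sets.Int_stable)
  qed (use False W in auto)
qed

context brownian_source
begin

text \<open>The inequality says that interval \<open>k\<close> of stage \<open>n\<close> ends by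
  time \<open>r\<close>. Increments serve as generators, rather than values of the path, because
  those of one stage are independent.\<close>

definition past_gen :: "real \<Rightarrow> 'a set set" where
  "past_gen r = {(\<lambda>\<omega>. dinc n (Y \<omega>) k) -` B \<inter> space M | n k B. B \<in> sets borel \<and> real (Suc k) \<le> r * 2 ^ n}"

definition past :: "real \<Rightarrow> 'a measure" where
  "past r = sigma (space M) (past_gen r)"

text \<open>
  Working modulo null sets and demanding the condition for all \<open>r > t\<close> makes the filtration complete
  and right-continuous by construction.
\<close>

definition filt :: "real \<Rightarrow> 'a measure" where
  "filt t = sigma (space M)
     {A\<in>events. \<forall>r>max t 0. \<exists>A'\<in>sets (past r). (A - A') \<union> (A' - A) \<in> null_sets M}"

lemma past_gen_Pow: "past_gen r \<subseteq> Pow (space M)"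
  by (auto simp: past_gen_def)

lemma space_past [simp]: "space (past r) = space M"
  unfolding past_def by (rule space_measure_of[OF past_gen_Pow])

lemma sets_past: "sets (past r) = sigma_sets (space M) (past_gen r)"
  unfolding past_def by (rule sets_measure_of[OF past_gen_Pow])

lemma past_events: "sets (past r) \<subseteq> events"
  unfolding sets_past by (rule sets.sigma_sets_subset) (auto simp: past_gen_def)

lemma past_mono: "r \<le> s \<Longrightarrow> sets (past r) \<subseteq> sets (past s)"
proof -
  assume "r \<le> s"
  then have "r * 2 ^ n \<le> s * 2 ^ n" for n
    by (intro mult_right_mono) auto
  then have "past_gen r \<subseteq> past_gen s"
    unfolding past_gen_def by (blast intro: order_trans)
  then show ?thesis
    unfolding sets_past by (rule sigma_sets_mono')
qed

lemma dinc_past: "real (Suc k) \<le> r * 2 ^ n \<Longrightarrow> (\<lambda>\<omega>. dinc n (Y \<omega>) k) \<in> borel_measurable (past r)"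
  by (intro measurableI) (auto simp: sets_past past_gen_def intro!: sigma_sets.Basic)

lemma brown_past:
  assumes "0 \<le> t"
  shows "(\<lambda>\<omega>. brown (Y \<omega>) t) \<in> borel_measurable (past t)"
proof -
  have "(\<lambda>\<omega>. dyad n (Y \<omega>) (nat \<lfloor>2 ^ n * t\<rfloor>)) \<in> borel_measurable (past t)" for n
    unfolding dyad_def
  proof (intro borel_measurable_sum dinc_past)
    fix k assume "k \<in> {..<nat \<lfloor>2 ^ n * t\<rfloor>}"
    then have "real (Suc k) \<le> real (nat \<lfloor>2 ^ n * t\<rfloor>)" by simp
    also have "\<dots> \<le> 2 ^ n * t"
      using assms by (intro of_nat_floor) simp
    finally show "real (Suc k) \<le> t * 2 ^ n"
      by (simp add: mult.commute)
  qed
  from this this[of 0] show ?thesis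
    unfolding brown_eq_lim[OF assms]
    by (intro borel_measurable_add borel_measurable_lim_metric borel_measurable_diff) simp_all
qed

text \<open>The increments of stage \<open>n + m\<close> before time \<open>a / 2 ^ n\<close>
  generate \<open>F m\<close>, which is independent of any later increment. The \<open>F m\<close>
  grow with \<open>m\<close>, so their union is stable under intersection, and since it contains the
  generators of the past, independence extends to the generated sigma-algebra.\<close>

lemma past_indep:
  assumes A: "A \<in> sets (past (real a / 2 ^ n))" and C: "C \<in> sets borel" and ab: "a \<le> b"
  shows "prob (A \<inter> ((\<lambda>\<omega>. dyad n (Y \<omega>) b - dyad n (Y \<omega>) a) -` C \<inter> space M)) =
    prob A * prob ((\<lambda>\<omega>. dyad n (Y \<omega>) b - dyad n (Y \<omega>) a) -` C \<inter> space M)"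
proof -
  let ?S = "\<lambda>\<omega>. dyad n (Y \<omega>) b - dyad n (Y \<omega>) a"
  define R where "R m \<omega> = (\<lambda>k\<in>{..<2 ^ m * a}. dinc (n + m) (Y \<omega>) k)" for m \<omega>
  define F where "F m = vimage_algebra (space M) (R m) (\<Pi>\<^sub>M k\<in>{..<2 ^ m * a}. borel)" for m
  have Rsp: "R m \<in> space M \<rightarrow> space (\<Pi>\<^sub>M k\<in>{..<2 ^ m * a}. borel)" for m
    by (auto simp: R_def space_PiM)
  have setsF: "sets (F m) = {R m -` B \<inter> space M | B. B \<in> sets (\<Pi>\<^sub>M k\<in>{..<2 ^ m * a}. borel)}" for m
    unfolding F_def by (rule sets_vimage_algebra2[OF Rsp])
  have spF [simp]: "space (F m) = space M" for m
    by (simp add: F_def)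
  have RF: "R m \<in> measurable (F m) (\<Pi>\<^sub>M k\<in>{..<2 ^ m * a}. borel)" for m
    unfolding F_def by (rule measurable_vimage_algebra1[OF Rsp])
  have dF: "(\<lambda>\<omega>. dinc (n + m) (Y \<omega>) k) \<in> borel_measurable (F m)" if "k < 2 ^ m * a" for m k
  proof -
    have "(\<lambda>\<omega>. R m \<omega> k) \<in> borel_measurable (F m)"
      by (rule measurable_compose[OF RF measurable_component_singleton]) (use that in simp)
    then show ?thesis
      using that by (simp add: R_def)
  qed
  have dyF: "(\<lambda>\<omega>. dyad (n + m) (Y \<omega>) k) \<in> borel_measurable (F m)" if "k \<le> 2 ^ m * a" for m k
    unfolding dyad_def using that by (intro borel_measurable_sum dF) auto
  have F_mono1: "sets (F m) \<subseteq> sets (F (Suc m))" for m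
  proof -
    have "(\<lambda>\<omega>. dinc (n + m) (Y \<omega>) k) \<in> borel_measurable (F (Suc m))" if "k < 2 ^ m * a" for k
    proof -
      have "2 * k < 2 ^ Suc m * a" "Suc (2 * k) < 2 ^ Suc m * a"
        using that by auto
      from this[THEN dF] have "(\<lambda>\<omega>. dinc (n + Suc m) (Y \<omega>) (2 * k) + dinc (n + Suc m) (Y \<omega>) (Suc (2 * k)))
          \<in> borel_measurable (F (Suc m))"
        by (rule borel_measurable_add)
      then show ?thesis
        by (simp add: dinc_children)
    qed
    then have "R m \<in> measurable (F (Suc m)) (\<Pi>\<^sub>M k\<in>{..<2 ^ m * a}. borel)"
      unfolding R_def by (intro measurable_restrict) auto
    from measurable_sets[OF this] show ?thesis
      by (auto simp: setsF[of m])
  qed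
  have F_mono: "sets (F m) \<subseteq> sets (F m')" if "m \<le> m'" for m m'
    using F_mono1 that by (rule lift_Suc_mono_le)
  have ind: "prob (E \<inter> (?S -` D \<inter> space M)) = prob E * prob (?S -` D \<inter> space M) \<and> E \<in> events"
    if E: "E \<in> sets (F m)" and D: "D \<in> sets borel" for E D m
  proof -
    obtain B where B: "E = R m -` B \<inter> space M" "B \<in> sets (\<Pi>\<^sub>M k\<in>{..<2 ^ m * a}. borel)"
      using E by (auto simp: setsF)
    let ?T = "\<lambda>\<omega>. \<lambda>k\<in>{2 ^ m * a..<2 ^ m * b}. dinc (n + m) (Y \<omega>) k"
    let ?N = "\<Pi>\<^sub>M k\<in>{2 ^ m * a..<2 ^ m * b}. borel :: real measure"
    define D' where "D' = (\<lambda>y. \<Sum>k\<in>{2 ^ m * a..<2 ^ m * b}. y k) -` D \<inter> space ?N"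
    have D': "D' \<in> sets ?N"
      unfolding D'_def using D by (intro measurable_sets[of _ _ borel]) auto
    have iv: "indep_var (\<Pi>\<^sub>M k\<in>{..<2 ^ m * a}. borel) (R m) ?N ?T"
      unfolding R_def by (rule indep_var_restrict[OF dinc_indep]) auto
    have "?S \<omega> = (\<Sum>k\<in>{2 ^ m * a..<2 ^ m * b}. dinc (n + m) (Y \<omega>) k)" for \<omega>
    proof -
      have "?S \<omega> = dyad (n + m) (Y \<omega>) (2 ^ m * b) - dyad (n + m) (Y \<omega>) (2 ^ m * a)"
        by (simp add: dyad_refine)
      also have "\<dots> = (\<Sum>k\<in>{2 ^ m * a..<2 ^ m * b}. dinc (n + m) (Y \<omega>) k)"
        unfolding dyad_def lessThan_atLeast0 using ab by (intro sum_diff_nat_ivl) auto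
      finally show ?thesis .
    qed
    then have SD: "?S -` D \<inter> space M = ?T -` D' \<inter> space M"
      by (auto simp: D'_def space_PiM)
    have "E \<inter> (?S -` D \<inter> space M) = (\<lambda>\<omega>. (R m \<omega>, ?T \<omega>)) -` (B \<times> D') \<inter> space M"
      unfolding SD by (auto simp: B)
    then have "prob (E \<inter> (?S -` D \<inter> space M)) = prob (R m -` B \<inter> space M) * prob (?S -` D \<inter> space M)"
      unfolding SD using indep_varD[OF iv B(2) D'] by simp
    moreover have "E \<in> events"
      using measurable_sets[OF indep_var_rv1[OF iv] B(2)] B(1) by simp
    ultimately show ?thesis
      by (simp add: B(1))
  qed
  let ?P = "\<Union>m. sets (F m)" and ?Q = "{?S -` D \<inter> space M | D. D \<in> sets borel}"
  have SM: "?S \<in> borel_measurable M"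
    unfolding dyad_def by measurable
  have "indep_set ?P ?Q"
    unfolding indep_sets2_eq using ind measurable_sets[OF SM] by blast
  moreover have "Int_stable ?P"
  proof (rule Int_stableI)
    fix E E' assume "E \<in> ?P" "E' \<in> ?P"
    then obtain m m' where "E \<in> sets (F m)" "E' \<in> sets (F m')"
      by blast
    then have "E \<in> sets (F (max m m'))" "E' \<in> sets (F (max m m'))"
      using F_mono[of m "max m m'"] F_mono[of m' "max m m'"] by auto
    then have "E \<inter> E' \<in> sets (F (max m m'))"
      by (rule sets.Int)
    then show "E \<inter> E' \<in> ?P" by blast
  qed
  moreover have "Int_stable ?Q"
  proof (rule Int_stableI)
    fix E E' assume "E \<in> ?Q" "E' \<in> ?Q"
    then obtain D D' where "E = ?S -` D \<inter> space M" "E' = ?S -` D' \<inter> space M"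
        "D \<in> sets borel" "D' \<in> sets borel"
      by blast
    then show "E \<inter> E' \<in> ?Q"
      by (intro CollectI exI[of _ "D \<inter> D'"]) auto
  qed
  ultimately have ind': "indep_set (sigma_sets (space M) ?P) (sigma_sets (space M) ?Q)"
    by (rule indep_set_sigma_sets)
  \<comment> \<open>An interval of stage \<open>n'\<close> is a union of intervals of the common
    refinement \<open>n + n'\<close>, so its increment is measurable in \<open>F n'\<close>.\<close>
  have "past_gen (real a / 2 ^ n) \<subseteq> ?P"
  proof
    fix E assume "E \<in> past_gen (real a / 2 ^ n)"
    then obtain n' k B where E: "E = (\<lambda>\<omega>. dinc n' (Y \<omega>) k) -` B \<inter> space M" "B \<in> sets borel"
        and "real (Suc k) \<le> real a / 2 ^ n * 2 ^ n'"
      unfolding past_gen_def by blast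
    then have "real (2 ^ n * Suc k) \<le> real (2 ^ n' * a)"
      by (simp add: field_simps)
    then have k: "2 ^ n * Suc k \<le> 2 ^ n' * a"
      by linarith
    have "2 ^ n * k \<le> 2 ^ n * Suc k" by simp
    also note k
    finally have k': "2 ^ n * k \<le> 2 ^ n' * a" .
    have eq: "dyad (n + n') (Y \<omega>) (2 ^ n * Suc k) - dyad (n + n') (Y \<omega>) (2 ^ n * k) = dinc n' (Y \<omega>) k" for \<omega>
      by (simp only: add.commute[of n n'] dyad_refine) (simp add: dyad_def)
    have "(\<lambda>\<omega>. dyad (n + n') (Y \<omega>) (2 ^ n * Suc k) - dyad (n + n') (Y \<omega>) (2 ^ n * k))
        \<in> borel_measurable (F n')"
      by (rule borel_measurable_diff[OF dyF[OF k] dyF[OF k']])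
    from measurable_sets[OF this[unfolded eq] E(2)] have "E \<in> sets (F n')"
      by (simp add: E(1))
    then show "E \<in> ?P" by blast
  qed
  then have "A \<in> sigma_sets (space M) ?P"
    using A sigma_sets_mono'[of "past_gen (real a / 2 ^ n)" ?P "space M"] unfolding sets_past by blast
  moreover have "?S -` C \<inter> space M \<in> sigma_sets (space M) ?Q"
    using C by (intro sigma_sets.Basic) blast
  ultimately show ?thesis
    using indep_setD[OF ind'] by blast
qed

lemma symdiff_null_UN:
  assumes "\<And>i::nat. A i \<in> events" "\<And>i. B i \<in> events" "\<And>i. (A i - B i) \<union> (B i - A i) \<in> null_sets M"
  shows "((\<Union>i. A i) - (\<Union>i. B i)) \<union> ((\<Union>i. B i) - (\<Union>i. A i)) \<in> null_sets M"
proof (rule null_sets_subset)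
  show "(\<Union>i. (A i - B i) \<union> (B i - A i)) \<in> null_sets M"
    by (rule null_sets_UN) (rule assms(3))
qed (use assms(1,2) in auto)

text \<open>The defining family is already a sigma-algebra, since complements and countable unions
  of approximants are approximants. \<open>max t 0\<close> extends the filtration to negative times
  as a constant.\<close>

lemma sets_filt: "sets (filt t) =
    {A\<in>events. \<forall>r>max t 0. \<exists>A'\<in>sets (past r). (A - A') \<union> (A' - A) \<in> null_sets M}" (is "_ = ?F")
proof -
  have "sigma_algebra (space M) ?F"
    unfolding sigma_algebra_iff2
  proof (intro conjI ballI allI impI)
    show "?F \<subseteq> Pow (space M)"
      using sets.sets_into_space by auto
    show "{} \<in> ?F"
      by (auto intro!: bexI[of _ "{}"])
    fix s assume s: "s \<in> ?F"
    show "space M - s \<in> ?F"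
    proof (intro CollectI conjI allI impI)
      fix r :: real assume "max t 0 < r"
      then obtain A' where A': "A' \<in> sets (past r)" "(s - A') \<union> (A' - s) \<in> null_sets M"
        using s by blast
      moreover have "(space M - s - (space M - A')) \<union> (space M - A' - (space M - s)) = (s - A') \<union> (A' - s)"
        using s A'(1) sets.sets_into_space[of s M] sets.sets_into_space[of A' "past r"] by auto
      ultimately show "\<exists>A'\<in>sets (past r). (space M - s - A') \<union> (A' - (space M - s)) \<in> null_sets M"
        using sets.compl_sets[of A' "past r"] by (intro bexI[of _ "space M - A'"]) auto
    qed (use s in auto)
  next
    fix A :: "nat \<Rightarrow> 'a set" assume A: "range A \<subseteq> ?F"
    show "(\<Union>i. A i) \<in> ?F"
    proof (intro CollectI conjI allI impI)
      show "(\<Union>i. A i) \<in> events"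
        using A by auto
      fix r :: real assume "max t 0 < r"
      then have "\<forall>i. \<exists>A'. A' \<in> sets (past r) \<and> (A i - A') \<union> (A' - A i) \<in> null_sets M"
        using A by blast
      then obtain B where B: "\<And>i. B i \<in> sets (past r)" "\<And>i. (A i - B i) \<union> (B i - A i) \<in> null_sets M"
        by metis
      then have "((\<Union>i. A i) - (\<Union>i. B i)) \<union> ((\<Union>i. B i) - (\<Union>i. A i)) \<in> null_sets M"
        using A past_events by (intro symdiff_null_UN) blast+
      moreover have "(\<Union>i. B i) \<in> sets (past r)"
        using B(1) by blast
      ultimately show "\<exists>A'\<in>sets (past r). ((\<Union>i. A i) - A') \<union> (A' - (\<Union>i. A i)) \<in> null_sets M"
        by blast
    qed
  qed
  then show ?thesis
    unfolding filt_def by (rule sigma_algebra.sets_measure_of_eq)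
qed

lemma space_filt [simp]: "space (filt t) = space M"
  unfolding filt_def using sets.sets_into_space by (intro space_measure_of) auto

lemma past_filt: "0 \<le> t \<Longrightarrow> sets (past t) \<subseteq> sets (filt t)"
proof
  fix A assume "0 \<le> t" "A \<in> sets (past t)"
  then show "A \<in> sets (filt t)"
  proof -
    have "A \<in> sets (past r)" if "max t 0 < r" for r
      using that past_mono[of t r] \<open>A \<in> sets (past t)\<close> by auto
    then show ?thesis
      unfolding sets_filt using past_events \<open>A \<in> sets (past t)\<close> by (auto intro!: bexI[of _ A])
  qed
qed

lemma brown_filt:
  assumes "0 \<le> s" "s \<le> t"
  shows "(\<lambda>\<omega>. brown (Y \<omega>) s) \<in> borel_measurable (filt t)"
proof -
  have sub: "sets (past s) \<subseteq> sets (filt t)"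
    using past_mono[OF assms(2)] past_filt[of t] assms by (meson order_trans)
  show ?thesis
  proof (rule measurableI)
    fix C :: "real set" assume "C \<in> sets borel"
    from measurable_sets[OF brown_past[OF assms(1)] this] sub
    show "(\<lambda>\<omega>. brown (Y \<omega>) s) -` C \<inter> space (filt t) \<in> sets (filt t)"
      by auto
  qed simp
qed

section \<open>Increments between arbitrary times\<close>

lemma dyad_normal:
  assumes "a < b"
  shows "distributed M lborel (\<lambda>\<omega>. dyad n (Y \<omega>) b - dyad n (Y \<omega>) a)
    (normal_density 0 (sqrt (real (b - a) / 2 ^ n)))"
proof -
  have "distributed M lborel (\<lambda>\<omega>. \<Sum>k\<in>{a..<b}. dinc n (Y \<omega>) k)
      (normal_density (\<Sum>k\<in>{a..<b}. 0) (sqrt (\<Sum>k\<in>{a..<b}. (sqrt (1 / 2 ^ n))\<^sup>2)))"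
    using assms
    by (intro sum_indep_normal dinc_normal indep_vars_subset[OF dinc_indep]) auto
  moreover have "(\<lambda>\<omega>. \<Sum>k\<in>{a..<b}. dinc n (Y \<omega>) k) = (\<lambda>\<omega>. dyad n (Y \<omega>) b - dyad n (Y \<omega>) a)"
    unfolding dyad_def lessThan_atLeast0 fun_eq_iff
    using assms by (intro allI sum_diff_nat_ivl[symmetric]) auto
  ultimately show ?thesis by simp
qed

text \<open>The approximation of \<open>s\<close> is strictly from above because an event of
  \<open>filt s\<close> has approximants only in \<open>past r\<close> with \<open>r > s\<close>.
  The stage \<open>n0\<close> is where the grid point above \<open>s\<close> lies before
  \<open>t\<close>.\<close>

lemma dyadic_approximation:
  assumes st: "0 \<le> s" "s < t"
  obtains n0 a b where "\<forall>m. a m < b m" "\<forall>m. s < real (a m) / 2 ^ (n0 + m)"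
    "(\<lambda>m. real (a m) / 2 ^ (n0 + m)) \<longlonglongrightarrow> s" "(\<lambda>m. real (b m) / 2 ^ (n0 + m)) \<longlonglongrightarrow> t"
proof -
  define c where "c u n = Suc (nat \<lfloor>2 ^ n * u\<rfloor>)" for u :: real and n
  have c: "u < real (c u n) / 2 ^ n" "real (c u n) / 2 ^ n \<le> u + 1 / 2 ^ n" if "0 \<le> u" for u n
  proof -
    have "0 \<le> 2 ^ n * u" using that by simp
    then have "2 ^ n * u < real (c u n)" "real (c u n) \<le> 2 ^ n * u + 1"
      unfolding c_def by linarith+
    then show "u < real (c u n) / 2 ^ n" "real (c u n) / 2 ^ n \<le> u + 1 / 2 ^ n"
      by (simp_all add: field_simps)
  qed
  have lim: "(\<lambda>n. real (c u n) / 2 ^ n) \<longlonglongrightarrow> u" if "0 \<le> u" for u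
  proof (rule tendsto_sandwich[of "\<lambda>_. u" _ _ "\<lambda>n. u + 1 / 2 ^ n"])
    have "(\<lambda>n. u + (1 / 2) ^ n) \<longlonglongrightarrow> u + 0"
      by (intro tendsto_intros) simp
    then show "(\<lambda>n. u + 1 / 2 ^ n) \<longlonglongrightarrow> u"
      by (simp add: power_divide)
  qed (use c[OF that] in \<open>auto intro: always_eventually less_imp_le\<close>)
  have t0: "0 \<le> t" using st by simp
  have "\<forall>\<^sub>F n in sequentially. real (c s n) / 2 ^ n < t"
    using lim[OF st(1)] st(2) by (rule order_tendstoD)
  then obtain n0 where n0: "\<And>n. n0 \<le> n \<Longrightarrow> real (c s n) / 2 ^ n < t"
    by (auto simp: eventually_sequentially)
  show ?thesis
  proof (rule that[of "\<lambda>m. c s (n0 + m)" "\<lambda>m. c t (n0 + m)" n0])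
    have "real (c s (n0 + m)) / 2 ^ (n0 + m) < real (c t (n0 + m)) / 2 ^ (n0 + m)" for m
      by (rule less_trans[OF n0 c(1)]) (use st in auto)
    then have "c s (n0 + m) < c t (n0 + m)" for m
      by (subst (asm) divide_less_cancel) auto
    then show "\<forall>m. c s (n0 + m) < c t (n0 + m)" ..
    show "\<forall>m. s < real (c s (n0 + m)) / 2 ^ (n0 + m)"
      using c(1)[OF st(1)] ..
  next
    show "(\<lambda>m. real (c s (n0 + m)) / 2 ^ (n0 + m)) \<longlonglongrightarrow> s"
      using LIMSEQ_ignore_initial_segment[OF lim[OF st(1)], of n0] by (simp only: add.commute[of n0])
    show "(\<lambda>m. real (c t (n0 + m)) / 2 ^ (n0 + m)) \<longlonglongrightarrow> t"
      using LIMSEQ_ignore_initial_segment[OF lim[OF t0], of n0] by (simp only: add.commute[of n0])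
  qed
qed

text \<open>By continuity the increment is the almost sure limit of the dyadic increments
  \<open>W m\<close>, and both normality and independence of a fixed event pass to such
  limits.\<close>

lemma brown_increment:
  assumes st: "0 \<le> s" "s < t"
  shows "distributed M lborel (\<lambda>\<omega>. brown (Y \<omega>) t - brown (Y \<omega>) s) (normal_density 0 (sqrt (t - s)))"
    and "A \<in> sets (filt s) \<Longrightarrow> C \<in> sets borel \<Longrightarrow>
      prob (A \<inter> ((\<lambda>\<omega>. brown (Y \<omega>) t - brown (Y \<omega>) s) -` C \<inter> space M)) =
      prob A * prob ((\<lambda>\<omega>. brown (Y \<omega>) t - brown (Y \<omega>) s) -` C \<inter> space M)"
proof -
  obtain n0 a b where ab': "\<forall>m. a m < b m" and s': "\<forall>m. s < real (a m) / 2 ^ (n0 + m)"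
    and a: "(\<lambda>m. real (a m) / 2 ^ (n0 + m)) \<longlonglongrightarrow> s" and b: "(\<lambda>m. real (b m) / 2 ^ (n0 + m)) \<longlonglongrightarrow> t"
    by (rule dyadic_approximation[OF st])
  have ab: "a m < b m" and s: "s < real (a m) / 2 ^ (n0 + m)" for m
    using ab' s' by auto
  define W where "W m \<omega> = dyad (n0 + m) (Y \<omega>) (b m) - dyad (n0 + m) (Y \<omega>) (a m)" for m \<omega>
  let ?B = "\<lambda>\<omega>. brown (Y \<omega>) t - brown (Y \<omega>) s"
  have [measurable]: "W m \<in> borel_measurable M" for m
    unfolding W_def dyad_def by measurable
  have lim: "AE \<omega> in M. (\<lambda>m. W m \<omega>) \<longlonglongrightarrow> ?B \<omega>"
    using AE_tame
  proof eventually_elim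
    case (elim \<omega>)
    then have c: "continuous_on {0..} (brown (Y \<omega>))"
      by (rule tame_continuous)
    have "(\<lambda>m. brown (Y \<omega>) (real (b m) / 2 ^ (n0 + m))) \<longlonglongrightarrow> brown (Y \<omega>) t"
      by (rule continuous_on_tendsto_compose[OF c b]) (use st in auto)
    moreover have "(\<lambda>m. brown (Y \<omega>) (real (a m) / 2 ^ (n0 + m))) \<longlonglongrightarrow> brown (Y \<omega>) s"
      by (rule continuous_on_tendsto_compose[OF c a]) (use st in auto)
    ultimately show "(\<lambda>m. W m \<omega>) \<longlonglongrightarrow> ?B \<omega>"
      unfolding W_def brown_dyadic by (rule tendsto_diff)
  qed
  have "(\<lambda>m. sqrt (real (b m) / 2 ^ (n0 + m) - real (a m) / 2 ^ (n0 + m))) \<longlonglongrightarrow> sqrt (t - s)"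
    by (intro tendsto_intros a b)
  moreover have "real (b m) / 2 ^ (n0 + m) - real (a m) / 2 ^ (n0 + m) = real (b m - a m) / 2 ^ (n0 + m)" for m
    using ab[of m] by (simp add: diff_divide_distrib of_nat_diff)
  ultimately have sl: "(\<lambda>m. sqrt (real (b m - a m) / 2 ^ (n0 + m))) \<longlonglongrightarrow> sqrt (t - s)"
    by simp
  show "distributed M lborel ?B (normal_density 0 (sqrt (t - s)))"
    by (rule distributed_normal_limit[where Y = W, OF _ _ _ lim sl])
      (use st ab in \<open>auto simp: W_def[abs_def] intro!: dyad_normal\<close>)
  assume A: "A \<in> sets (filt s)" and C: "C \<in> sets borel"
  show "prob (A \<inter> (?B -` C \<inter> space M)) = prob A * prob (?B -` C \<inter> space M)"
  proof (rule indep_event_limit[OF _ _ _ lim _ C])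
    show Ae: "A \<in> events"
      using A by (simp add: sets_filt)
    fix m and D :: "real set" assume D: "D \<in> sets borel"
    \<comment> \<open>The approximant changes with \<open>m\<close>, but only by null sets, so the
      probabilities are those of \<open>A\<close> throughout.\<close>
    obtain A' where A': "A' \<in> sets (past (real (a m) / 2 ^ (n0 + m)))" "(A - A') \<union> (A' - A) \<in> null_sets M"
      using A s[of m] st(1) by (auto simp: sets_filt)
    have A'e: "A' \<in> events"
      using A'(1) past_events by blast
    have ae: "AE \<omega> in M. \<omega> \<in> A \<longleftrightarrow> \<omega> \<in> A'"
      by (rule AE_I'[OF A'(2)]) auto
    have D': "W m -` D \<inter> space M \<in> events"
      using D by measurable
    have "prob (A \<inter> (W m -` D \<inter> space M)) = prob (A' \<inter> (W m -` D \<inter> space M))"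
      using ae Ae A'e D' by (intro finite_measure_eq_AE) auto
    also have "\<dots> = prob A' * prob (W m -` D \<inter> space M)"
      unfolding W_def using ab[of m] by (intro past_indep[OF A'(1) D]) simp
    also have "prob A' = prob A"
      using ae Ae A'e by (intro finite_measure_eq_AE) auto
    finally show "prob (A \<inter> (W m -` D \<inter> space M)) = prob A * prob (W m -` D \<inter> space M)" .
  qed measurable
qed

lemma brown_standard: "standard_brownian_motion (\<lambda>t \<omega>. brown (Y \<omega>) t)"
  unfolding standard_brownian_motion_def
proof (intro conjI allI impI)
  show "AE \<omega> in M. continuous_on {0..} (\<lambda>t. brown (Y \<omega>) t)"
    using AE_tame by eventually_elim (rule tame_continuous)
  fix n :: nat and \<tau> :: "nat \<Rightarrow> real"
  assume \<tau>: "0 \<le> \<tau> 0" "\<forall>i<n. \<tau> i < \<tau> (Suc i)"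
  have mono: "\<tau> i \<le> \<tau> j" if "i \<le> j" "j \<le> n" for i j
    using that
  proof (induction rule: dec_induct)
    case (step k)
    then show ?case using \<tau>(2) by (metis Suc_le_lessD less_imp_le order_trans)
  qed simp
  have pos: "0 \<le> \<tau> j" if "j \<le> n" for j
    using mono[of 0 j] that \<tau>(1) by simp
  show "indep_vars (\<lambda>_. borel) (\<lambda>i \<omega>. brown (Y \<omega>) (\<tau> (Suc i)) - brown (Y \<omega>) (\<tau> i)) {..<n}"
  proof (rule indep_vars_sequentially[where F = "\<lambda>i. sets (filt (\<tau> i))"])
    fix i j and C :: "real set" assume ij: "j < i" "i < n" and C: "C \<in> sets borel"
    have "(\<lambda>\<omega>. brown (Y \<omega>) (\<tau> (Suc j)) - brown (Y \<omega>) (\<tau> j)) \<in> borel_measurable (filt (\<tau> i))"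
      using ij by (intro borel_measurable_diff brown_filt pos mono) auto
    from measurable_sets[OF this C]
    show "(\<lambda>\<omega>. brown (Y \<omega>) (\<tau> (Suc j)) - brown (Y \<omega>) (\<tau> j)) -` C \<inter> space M \<in> sets (filt (\<tau> i))"
      by simp
  next
    fix i show "sigma_algebra (space M) (sets (filt (\<tau> i)))"
      using sets.sigma_algebra_axioms[of "filt (\<tau> i)"] by simp
  next
    fix i A and C :: "real set" assume "i < n" "A \<in> sets (filt (\<tau> i))" "C \<in> sets borel"
    then show "prob (A \<inter> ((\<lambda>\<omega>. brown (Y \<omega>) (\<tau> (Suc i)) - brown (Y \<omega>) (\<tau> i)) -` C \<inter> space M)) =
        prob A * prob ((\<lambda>\<omega>. brown (Y \<omega>) (\<tau> (Suc i)) - brown (Y \<omega>) (\<tau> i)) -` C \<inter> space M)"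
      using \<tau>(2) pos[of i] by (intro brown_increment(2)) auto
  qed measurable
qed (auto intro!: brown_increment(1))

lemma filt_normal:
  assumes "complete_measure M"
  shows "normal_filtration filt"
  unfolding normal_filtration_def
proof (intro conjI allI ballI impI)
  show "filtration (space M) filt"
  proof
    fix i j :: real assume "i \<le> j"
    then show "sets (filt i) \<subseteq> sets (filt j)"
      by (auto simp: sets_filt)
  qed simp
  show "subalgebra M (filt t)" for t
    unfolding subalgebra_def by (auto simp: sets_filt)
  show "Pow N \<subseteq> sets (filt 0)" if "N \<in> null_sets M" for N
  proof
    fix A assume "A \<in> Pow N"
    then have "A \<in> null_sets M"
      using that complete_measure.complete2[OF assms] by auto
    then show "A \<in> sets (filt 0)"
      by (auto simp: sets_filt intro!: bexI[of _ "{}"])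
  qed
  fix t :: real assume t: "0 \<le> t"
  show "sets (filt t) = (\<Inter>s\<in>{t<..}. sets (filt s))"
  proof
    show "sets (filt t) \<subseteq> (\<Inter>s\<in>{t<..}. sets (filt s))"
      by (auto simp: sets_filt)
    show "(\<Inter>s\<in>{t<..}. sets (filt s)) \<subseteq> sets (filt t)"
    proof
      fix A assume A: "A \<in> (\<Inter>s\<in>{t<..}. sets (filt s))"
      then have "A \<in> sets (filt (t + 1))" by simp
      then have "A \<in> events" by (simp add: sets_filt)
      moreover have "\<exists>A'\<in>sets (past r). (A - A') \<union> (A' - A) \<in> null_sets M" if r: "max t 0 < r" for r
      proof -
        obtain s where s: "t < s" "s < r"
          using dense[of t r] r by auto
        then have "A \<in> sets (filt s)" "max s 0 < r"
          using A t by auto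
        then show ?thesis
          unfolding sets_filt by blast
      qed
      ultimately show "A \<in> sets (filt t)"
        by (simp add: sets_filt)
    qed
  qed
qed

lemma brown_wrt_filt: "standard_brownian_motion_wrt filt (\<lambda>t \<omega>. brown (Y \<omega>) t)"
  unfolding standard_brownian_motion_wrt_def
proof (intro conjI allI impI brown_standard)
  show "(\<lambda>\<omega>. brown (Y \<omega>) t) \<in> borel_measurable (filt t)" if "0 \<le> t" for t
    using brown_filt that by simp
  fix s t :: real assume st: "0 \<le> s" "s < t"
  have "(\<lambda>\<omega>. brown (Y \<omega>) t - brown (Y \<omega>) s) \<in> borel_measurable M"
    by measurable
  note meas = measurable_sets[OF this]
  show "indep_set (sets (filt s)) {(\<lambda>\<omega>. brown (Y \<omega>) t - brown (Y \<omega>) s) -` A \<inter> space M |A. A \<in> sets borel}"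
    unfolding indep_sets2_eq
  proof (intro conjI ballI)
    show "sets (filt s) \<subseteq> events"
      by (auto simp: sets_filt)
    show "{(\<lambda>\<omega>. brown (Y \<omega>) t - brown (Y \<omega>) s) -` A \<inter> space M |A. A \<in> sets borel} \<subseteq> events"
      using meas by blast
    fix a b
    assume a: "a \<in> sets (filt s)"
      and "b \<in> {(\<lambda>\<omega>. brown (Y \<omega>) t - brown (Y \<omega>) s) -` A \<inter> space M |A. A \<in> sets borel}"
    then obtain A where "A \<in> sets borel" "b = (\<lambda>\<omega>. brown (Y \<omega>) t - brown (Y \<omega>) s) -` A \<inter> space M"
      by blast
    then show "prob (a \<inter> b) = prob a * prob b"
      using brown_increment(2)[OF st a] by simp
  qed
qed

end

subsection \<open>Concatenation at integer stopping times\<close>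

text \<open>The column \<open>x i 0\<close> holds the increments over whole unit intervals, so the
  rule sees the path at integer times only. \<open>P_pos\<close> gives blocks a length of at least
  one, whence infinite concatenations exist and the durations sum to infinity.\<close>

locale stopping_rule =
  fixes P :: "nat \<Rightarrow> (nat \<Rightarrow> real) \<Rightarrow> bool"
  assumes P_measurable [measurable]: "\<And>n. Measurable.pred (\<Pi>\<^sub>M i\<in>UNIV. borel) (P n)"
    and P_cong: "\<And>n g g'. (\<And>i. i < n \<Longrightarrow> g i = g' i) \<Longrightarrow> P n g \<Longrightarrow> P n g'"
    and P_pos: "\<And>n g. P n g \<Longrightarrow> 0 < n"
    and AE_P: "AE x in gauss_array. \<exists>n. P n (\<lambda>i. x i 0)"
begin

definition fin :: "(nat \<Rightarrow> nat \<Rightarrow> real) \<Rightarrow> bool" where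
  "fin x \<longleftrightarrow> (\<exists>n. P n (\<lambda>i. x i 0))"

text \<open>On the null set where the rule never applies, \<open>tau\<close> has the junk value \<open>1\<close>.\<close>

definition tau :: "(nat \<Rightarrow> nat \<Rightarrow> real) \<Rightarrow> nat" where
  "tau x = (if fin x then LEAST n. P n (\<lambda>i. x i 0) else 1)"

lemma tau_pos: "0 < tau x"
  unfolding tau_def fin_def using P_pos by (auto intro: LeastI2_ex)

text \<open>Galmarino's test for integer times. It requires \<open>fin x\<close> because the junk
  value does not survive a change of later rows.\<close>

lemma tau_cong:
  assumes "fin x" "\<And>i. i < tau x \<Longrightarrow> x i = y i"
  shows "fin y \<and> tau y = tau x"
proof -
  have Px: "P (tau x) (\<lambda>i. x i 0)"
    using assms(1) unfolding tau_def fin_def by (auto intro: LeastI_ex)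
  then have Py: "P (tau x) (\<lambda>i. y i 0)"
    using assms(2) by (auto intro: P_cong[of "tau x" "\<lambda>i. x i 0"])
  have "tau x \<le> n" if "P n (\<lambda>i. y i 0)" for n
  proof (rule ccontr)
    assume "\<not> tau x \<le> n"
    then have "P n (\<lambda>i. x i 0)"
      using that assms(2) by (auto intro: P_cong[of n "\<lambda>i. y i 0"])
    then have "tau x \<le> n"
      using assms(1) by (simp add: tau_def Least_le)
    with \<open>\<not> tau x \<le> n\<close> show False ..
  qed
  with Py show ?thesis
    unfolding tau_def[of y] fin_def by (auto intro: Least_equality)
qed

lemma measurable_hd [measurable]:
  "(\<lambda>x i. x i 0) \<in> measurable gauss_array (\<Pi>\<^sub>M i\<in>UNIV. borel)"
  by (rule measurable_PiM_single') auto

lemma fin_measurable [measurable]: "Measurable.pred gauss_array fin"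
  unfolding fin_def[abs_def] by measurable

lemma tau_measurable [measurable]: "tau \<in> measurable gauss_array (count_space UNIV)"
  unfolding tau_def[abs_def] by measurable

lemma AE_fin: "AE x in gauss_array. fin x"
  using AE_P by (simp add: fin_def)

lemma gauss_array_comb_seq:
  "distr (gauss_array \<Otimes>\<^sub>M gauss_array) gauss_array (\<lambda>(x, y). comb_seq m x y) = gauss_array"
proof -
  interpret gauss_seq: prob_space gauss_seq by (rule prob_space_gauss_seq)
  interpret sequence_space gauss_seq ..
  show ?thesis
    using PiM_comb_seq[of m] by (simp add: gauss_array_def)
qed

lemma comb_seq_measurable [measurable]:
  "(\<lambda>(x, y). comb_seq m x y) \<in> measurable (gauss_array \<Otimes>\<^sub>M gauss_array) gauss_array"
  unfolding gauss_array_def by (rule measurable_comb_seq)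

lemma concat_measurable [measurable]:
  "(\<lambda>(x, y). comb_seq (tau x) x y) \<in> measurable (gauss_array \<Otimes>\<^sub>M gauss_array) gauss_array"
proof -
  have "(\<lambda>p. (\<lambda>(x, y). comb_seq m x y) p) \<in> measurable (gauss_array \<Otimes>\<^sub>M gauss_array) gauss_array" for m
    by measurable
  moreover have "(\<lambda>p. tau (fst p)) \<in> measurable (gauss_array \<Otimes>\<^sub>M gauss_array) (count_space UNIV)"
    by measurable
  ultimately have "(\<lambda>p. (\<lambda>(x, y). comb_seq (tau (fst p)) x y) p) \<in> measurable (gauss_array \<Otimes>\<^sub>M gauss_array) gauss_array"
    by (rule measurable_compose_countable)
  then show ?thesis
    by (simp add: split_beta')
qed

text \<open>
  On \<open>tau = m\<close> the concatenation is the fixed splice at \<open>m\<close>, which preserves the law and, as \<open>tau\<close> is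
  a stopping rule, also the event \<open>tau = m\<close>.
\<close>

lemma concat_law:
  "distr (gauss_array \<Otimes>\<^sub>M gauss_array) gauss_array (\<lambda>(x, y). comb_seq (tau x) x y) = gauss_array"
    (is "distr ?GG _ ?c = _")
proof (rule measure_eqI)
  fix A assume "A \<in> sets (distr ?GG gauss_array ?c)"
  then have A [measurable]: "A \<in> sets gauss_array" by simp
  interpret G: prob_space gauss_array by (rule prob_space_gauss_array)
  interpret GG: pair_prob_space gauss_array gauss_array ..
  define B where "B m = {z\<in>space gauss_array. fin z \<and> tau z = m \<and> z \<in> A}" for m
  have [measurable]: "B m \<in> sets gauss_array" for m
    unfolding B_def by measurable
  define C where "C m = (\<lambda>(x, y). comb_seq m x y) -` B m \<inter> space ?GG" for m
  have C [measurable]: "C m \<in> sets ?GG" for m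
    unfolding C_def by measurable
  have C_eq: "C m = {p\<in>space ?GG. fin (fst p) \<and> tau (fst p) = m \<and> ?c p \<in> A}" for m
  proof -
    have "(fin (comb_seq m x y) \<and> tau (comb_seq m x y) = m) \<longleftrightarrow> (fin x \<and> tau x = m)" for x y
    proof
      assume "fin (comb_seq m x y) \<and> tau (comb_seq m x y) = m"
      then show "fin x \<and> tau x = m"
        using tau_cong[of "comb_seq m x y" x] by (auto simp: comb_seq_less)
    next
      assume "fin x \<and> tau x = m"
      then show "fin (comb_seq m x y) \<and> tau (comb_seq m x y) = m"
        using tau_cong[of x "comb_seq m x y"] by (auto simp: comb_seq_less)
    qed
    note key = this
    show ?thesis
    proof (rule set_eqI)
      fix p :: "(nat \<Rightarrow> nat \<Rightarrow> real) \<times> (nat \<Rightarrow> nat \<Rightarrow> real)"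
      obtain x y where p: "p = (x, y)" by (cases p)
      show "p \<in> C m \<longleftrightarrow> p \<in> {p\<in>space ?GG. fin (fst p) \<and> tau (fst p) = m \<and> ?c p \<in> A}"
        using key[of x y] unfolding p C_def B_def by (cases "fin x \<and> tau x = m") auto
    qed
  qed
  have CB: "emeasure ?GG (C m) = emeasure gauss_array (B m)" for m
  proof -
    have "emeasure gauss_array (B m) = emeasure (distr ?GG gauss_array (\<lambda>(x, y). comb_seq m x y)) (B m)"
      by (simp add: gauss_array_comb_seq)
    also have "\<dots> = emeasure ?GG (C m)"
      unfolding C_def by (rule emeasure_distr) measurable
    finally show ?thesis by simp
  qed
  have AEGG: "AE p in ?GG. fin (fst p)"
  proof (rule AE_distrD[of fst ?GG gauss_array])
    show "AE x in distr ?GG gauss_array fst. fin x"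
      unfolding prob_space.distr_pair_fst[OF prob_space_gauss_array, of gauss_array] by (rule AE_fin)
  qed measurable
  have "emeasure (distr ?GG gauss_array ?c) A = emeasure ?GG (?c -` A \<inter> space ?GG)"
    by (rule emeasure_distr) measurable
  also have "\<dots> = emeasure ?GG (\<Union>m. C m)"
    by (rule emeasure_eq_AE) (use AEGG in \<open>auto simp: C_eq elim: eventually_mono\<close>)
  also have "\<dots> = (\<Sum>m. emeasure ?GG (C m))"
    by (rule suminf_emeasure[symmetric]) (auto simp: disjoint_family_on_def C_eq)
  also have "\<dots> = (\<Sum>m. emeasure gauss_array (B m))"
    by (simp add: CB)
  also have "\<dots> = emeasure gauss_array (\<Union>m. B m)"
  proof (rule suminf_emeasure)
    show "disjoint_family B"
      by (auto simp: disjoint_family_on_def B_def)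
  qed auto
  also have "\<dots> = emeasure gauss_array A"
  proof (rule emeasure_eq_AE)
    show "AE x in gauss_array. x \<in> (\<Union>m. B m) \<longleftrightarrow> x \<in> A"
      using AE_fin by eventually_elim (auto simp: B_def)
  qed auto
  finally show "emeasure (distr ?GG gauss_array ?c) A = emeasure gauss_array A" .
qed simp

section \<open>Finite and infinite concatenations\<close>

text \<open>The last array is kept unstopped, so that every finite stage is again a full array and
  can have the law \<open>gauss_array\<close>.\<close>

fun chain :: "nat \<Rightarrow> int \<Rightarrow> (int \<Rightarrow> nat \<Rightarrow> nat \<Rightarrow> real) \<Rightarrow> nat \<Rightarrow> nat \<Rightarrow> real" where
  "chain 0 k w = w k"
| "chain (Suc K) k w = comb_seq (tau (w k)) (w k) (chain K (k + 1) w)"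

text \<open>Entry \<open>j\<close> of the infinite concatenation is settled after \<open>j\<close> blocks because \<open>0 < tau\<close>.\<close>

definition splice :: "int \<Rightarrow> (int \<Rightarrow> nat \<Rightarrow> nat \<Rightarrow> real) \<Rightarrow> nat \<Rightarrow> nat \<Rightarrow> real" where
  "splice k w j = chain j k w j"

lemma chain_Suc_eq: "j \<le> K \<Longrightarrow> chain (Suc K) k w j = chain K k w j"
proof (induction K arbitrary: k j)
  case 0
  then show ?case using tau_pos by (simp add: comb_seq_def)
next
  case (Suc K)
  have "j - tau (w k) \<le> K"
    using Suc.prems tau_pos[of "w k"] by simp
  then show ?case
    using Suc.IH[of "j - tau (w k)" "k + 1"] by (subst (1 2) chain.simps(2)) (simp add: comb_seq_def del: chain.simps)
qed

lemma chain_splice: "j \<le> K \<Longrightarrow> chain K k w j = splice k w j"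
proof (induction K rule: dec_induct)
  case base
  then show ?case by (simp add: splice_def)
next
  case (step K)
  then show ?case using chain_Suc_eq by metis
qed

lemma splice_rec: "splice k w = comb_seq (tau (w k)) (w k) (splice (k + 1) w)"
proof
  fix j
  have "splice k w j = chain (Suc j) k w j"
    by (rule chain_splice[symmetric]) simp
  also have "\<dots> = comb_seq (tau (w k)) (w k) (splice (k + 1) w) j"
    by (simp add: comb_seq_def chain_splice)
  finally show "splice k w j = comb_seq (tau (w k)) (w k) (splice (k + 1) w) j" .
qed

lemma splice_less: "j < tau (w k) \<Longrightarrow> splice k w j = w k j"
  by (subst splice_rec) (simp add: comb_seq_def)

lemma splice_add: "splice k w (tau (w k) + j) = splice (k + 1) w j"
  by (subst splice_rec) (simp add: comb_seq_def)

lemma chain_cong: "(\<And>j. k \<le> j \<Longrightarrow> w j = w' j) \<Longrightarrow> chain K k w = chain K k w'"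
proof (induction K arbitrary: k)
  case (Suc K)
  then have "chain K (k + 1) w = chain K (k + 1) w'" "w k = w' k"
    by auto
  then show ?case by simp
qed simp

lemma chain_measurable:
  "{k..} \<subseteq> B \<Longrightarrow> chain K k \<in> measurable (PiM B (\<lambda>_. gauss_array)) gauss_array"
proof (induction K arbitrary: k)
  case 0
  then show ?case
    by (auto intro!: measurable_component_singleton)
next
  case (Suc K)
  have "(\<lambda>w. w k) \<in> measurable (PiM B (\<lambda>_. gauss_array)) gauss_array"
    using Suc.prems by (intro measurable_component_singleton) auto
  moreover have "chain K (k + 1) \<in> measurable (PiM B (\<lambda>_. gauss_array)) gauss_array"
    using Suc.prems by (intro Suc.IH) auto
  ultimately have "(\<lambda>w. (w k, chain K (k + 1) w)) \<in>
      measurable (PiM B (\<lambda>_. gauss_array)) (gauss_array \<Otimes>\<^sub>M gauss_array)"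
    by (rule measurable_Pair)
  from measurable_compose[OF this concat_measurable] show ?case
    by simp
qed

end

locale block_family = prob_space M + stopping_rule P
  for M :: "'a measure" and P :: "nat \<Rightarrow> (nat \<Rightarrow> real) \<Rightarrow> bool" +
  fixes \<xi> :: "int \<Rightarrow> 'a \<Rightarrow> nat \<Rightarrow> nat \<Rightarrow> real"
  assumes indep_\<xi>: "indep_vars (\<lambda>_. gauss_array) \<xi> UNIV"
    and law_\<xi>: "\<And>k. distr M gauss_array (\<xi> k) = gauss_array"
begin

abbreviation w :: "'a \<Rightarrow> int \<Rightarrow> nat \<Rightarrow> nat \<Rightarrow> real" where
  "w \<omega> \<equiv> (\<lambda>k. \<xi> k \<omega>)"

lemma \<xi>_measurable [measurable]: "\<xi> k \<in> measurable M gauss_array"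
  using indep_\<xi> by (simp add: indep_vars_def)

lemma w_measurable: "w \<in> measurable M (\<Pi>\<^sub>M k\<in>UNIV. gauss_array)"
  by (rule measurable_PiM_single') (auto simp: \<xi>_measurable)

lemma chain_w_measurable [measurable]: "(\<lambda>\<omega>. chain K k (w \<omega>)) \<in> measurable M gauss_array"
  by (rule measurable_compose[OF w_measurable chain_measurable]) simp

text \<open>The induction adds blocks on the left: the chain from \<open>k + 1\<close> reads later
  blocks only, hence is independent of \<open>\<xi> k\<close>, and the pair has the product law that
  \<open>concat_law\<close> asks for.\<close>

lemma chain_law: "distr M gauss_array (\<lambda>\<omega>. chain K k (w \<omega>)) = gauss_array"
proof (induction K arbitrary: k)
  case 0
  then show ?case by (simp add: law_\<xi>)
next
  case (Suc K)
  let ?A = "{k}" and ?B = "{k + 1..}"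
  have "indep_var (PiM ?A (\<lambda>_. gauss_array)) (\<lambda>\<omega>. restrict (\<lambda>i. \<xi> i \<omega>) ?A)
      (PiM ?B (\<lambda>_. gauss_array)) (\<lambda>\<omega>. restrict (\<lambda>i. \<xi> i \<omega>) ?B)"
    by (rule indep_var_restrict[OF indep_\<xi>]) auto
  then have "indep_var gauss_array ((\<lambda>y. y k) \<circ> (\<lambda>\<omega>. restrict (\<lambda>i. \<xi> i \<omega>) ?A))
      gauss_array (chain K (k + 1) \<circ> (\<lambda>\<omega>. restrict (\<lambda>i. \<xi> i \<omega>) ?B))"
    by (rule indep_var_compose) (auto intro: chain_measurable)
  moreover have "chain K (k + 1) \<circ> (\<lambda>\<omega>. restrict (\<lambda>i. \<xi> i \<omega>) ?B) = (\<lambda>\<omega>. chain K (k + 1) (w \<omega>))"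
    by (auto simp: fun_eq_iff intro!: fun_cong[OF fun_cong[OF chain_cong]])
  moreover have "(\<lambda>y. y k) \<circ> (\<lambda>\<omega>. restrict (\<lambda>i. \<xi> i \<omega>) ?A) = \<xi> k"
    by auto
  ultimately have "indep_var gauss_array (\<xi> k) gauss_array (\<lambda>\<omega>. chain K (k + 1) (w \<omega>))"
    by simp
  then have "distr M (gauss_array \<Otimes>\<^sub>M gauss_array) (\<lambda>\<omega>. (\<xi> k \<omega>, chain K (k + 1) (w \<omega>)))
      = gauss_array \<Otimes>\<^sub>M gauss_array"
    by (simp add: indep_var_distribution_eq law_\<xi> Suc.IH)
  then have "gauss_array = distr (distr M (gauss_array \<Otimes>\<^sub>M gauss_array) (\<lambda>\<omega>. (\<xi> k \<omega>, chain K (k + 1) (w \<omega>))))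
      gauss_array (\<lambda>(x, y). comb_seq (tau x) x y)"
    by (simp add: concat_law)
  also have "\<dots> = distr M gauss_array (\<lambda>\<omega>. chain (Suc K) k (w \<omega>))"
    by (subst distr_distr) (auto simp: comp_def)
  finally show ?case by simp
qed

lemma splice_measurable [measurable]: "(\<lambda>\<omega>. splice k (w \<omega>)) \<in> measurable M gauss_array"
  unfolding gauss_array_def
proof (rule measurable_PiM_single')
  fix j
  have "(\<lambda>\<omega>. chain j k (w \<omega>) j) \<in> measurable M gauss_seq"
    by (rule measurable_compose[OF chain_w_measurable])
      (simp add: gauss_array_def)
  then show "(\<lambda>\<omega>. splice k (w \<omega>) j) \<in> measurable M gauss_seq"
    by (simp add: splice_def)
qed (use sets_eq_imp_space_eq[OF sets_gauss_seq] in \<open>auto simp: space_PiM\<close>)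

text \<open>A cylinder set inspects finitely many rows, and there the infinite concatenation agrees
  with a long enough \<open>chain\<close>.\<close>

lemma splice_law: "distr M gauss_array (\<lambda>\<omega>. splice k (w \<omega>)) = gauss_array"
proof -
  interpret PP: product_prob_space "\<lambda>_. gauss_seq" UNIV
    by (intro product_prob_spaceI prob_space_gauss_seq)
  have "distr M gauss_array (\<lambda>\<omega>. splice k (w \<omega>)) = PiM UNIV (\<lambda>_::nat. gauss_seq)"
  proof (rule PP.PiM_eq)
    fix J :: "nat set" and F :: "nat \<Rightarrow> (nat \<Rightarrow> real) set"
    assume J: "finite J" "J \<subseteq> UNIV" and F: "\<And>j. j \<in> J \<Longrightarrow> F j \<in> sets gauss_seq"
    let ?E = "prod_emb UNIV (\<lambda>_. gauss_seq) J (PiE J F)"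
    have E: "?E \<in> sets gauss_array"
      unfolding gauss_array_def using J F by (intro sets_PiM_I) auto
    define K where "K = Max (insert 0 J)"
    have K: "j \<le> K" if "j \<in> J" for j
      using that J by (simp add: K_def)
    have mem: "splice k v \<in> ?E \<longleftrightarrow> chain K k v \<in> ?E" for v
      unfolding prod_emb_def
      using K chain_splice sets_eq_imp_space_eq[OF sets_gauss_seq]
      by (auto simp: space_PiM PiE_iff)
    have "emeasure (distr M gauss_array (\<lambda>\<omega>. splice k (w \<omega>))) ?E
      = emeasure (distr M gauss_array (\<lambda>\<omega>. chain K k (w \<omega>))) ?E"
      using E by (simp add: emeasure_distr vimage_def mem)
    also have "\<dots> = emeasure (PiM UNIV (\<lambda>_. gauss_seq)) ?E"
      unfolding chain_law by (simp add: gauss_array_def)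
    also have "\<dots> = (\<Prod>j\<in>J. emeasure gauss_seq (F j))"
      using J F by (intro PP.emeasure_PiM_emb) auto
    finally show "emeasure (distr M gauss_array (\<lambda>\<omega>. splice k (w \<omega>))) ?E = (\<Prod>j\<in>J. emeasure gauss_seq (F j))" .
  qed (simp add: gauss_array_def)
  then show ?thesis by (simp add: gauss_array_def)
qed

text \<open>The spliced sources provide the forward property and the continuity of the whole path;
  the block sources below provide the Brownian motions of the decomposition and their
  filtrations.\<close>

sublocale splice: brownian_source M "\<lambda>\<omega>. splice k (w \<omega>)" for k
  by standard (auto simp: splice_law)

sublocale block: brownian_source M "\<xi> k" for k
  by standard (auto simp: law_\<xi>)

end

subsection \<open>The concatenated process\<close>

text \<open>The discrete antiderivative on the integers that vanishes at \<open>0\<close>; the sign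
  for negative \<open>k\<close> makes \<open>isum_Suc\<close> hold on both sides.\<close>

definition isum :: "(int \<Rightarrow> 'b::ab_group_add) \<Rightarrow> int \<Rightarrow> 'b" where
  "isum a k = (if 0 \<le> k then sum a {0..<k} else - sum a {k..<0})"

lemma isum_0 [simp]: "isum a 0 = 0"
  by (simp add: isum_def)

lemma isum_Suc: "isum a (k + 1) = isum a k + a k"
proof (cases "0 \<le> k")
  case True
  then have "{0..<k + 1} = insert k {0..<k}" by auto
  with True show ?thesis by (simp add: isum_def add.commute)
next
  case False
  then have "{k..<0} = insert k {k + 1..<0}" by auto
  with False show ?thesis by (simp add: isum_def)
qed

lemma isum_add: "isum a (k + int m) = isum a k + (\<Sum>i<m. a (k + int i))"
proof (induction m)
  case (Suc m)
  have "isum a (k + int (Suc m)) = isum a (k + int m) + a (k + int m)"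
    using isum_Suc[of a "k + int m"] by (simp add: add.assoc add.commute[of 1])
  with Suc show ?case by (simp add: add.assoc)
qed simp

lemma suminf_ge_1_eq_infinity:
  fixes a :: "nat \<Rightarrow> ennreal"
  assumes "\<And>n. 1 \<le> a n"
  shows "(\<Sum>n. a n) = \<infinity>"
proof (rule ccontr)
  assume "(\<Sum>n. a n) \<noteq> \<infinity>"
  then obtain n where n: "(\<Sum>n. a n) < of_nat n"
    using ennreal_Ex_less_of_nat[of "\<Sum>n. a n"] by (auto simp: top.not_eq_extremum)
  have "of_nat n = (\<Sum>i<n. 1 :: ennreal)" by simp
  also have "\<dots> \<le> (\<Sum>i<n. a i)"
    by (intro sum_mono assms)
  also have "\<dots> \<le> (\<Sum>n. a n)"
    by (intro sum_le_suminf) auto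
  finally show False
    using n by simp
qed

lemma unit_path_0 [simp]: "unit_path z 0 = 0"
  by (simp add: unit_path_def)

text \<open>Needed because \<open>fbm_shift\<close> identifies the shifted process with
  \<open>brown\<close> for nonnegative times only.\<close>

lemma (in prob_space) standard_brownian_motion_cong:
  assumes B: "standard_brownian_motion B" and eq: "\<And>t. 0 \<le> t \<Longrightarrow> B' t = B t"
  shows "standard_brownian_motion B'"
  unfolding standard_brownian_motion_def
proof (intro conjI allI impI)
  note * = B[unfolded standard_brownian_motion_def]
  show "B' t \<in> borel_measurable M" if "0 \<le> t" for t
    using * eq that by simp
  show "AE \<omega> in M. B' 0 \<omega> = 0"
    using * eq by simp
  have "continuous_on {0..} (\<lambda>t. B' t \<omega>) = continuous_on {0..} (\<lambda>t. B t \<omega>)" for \<omega>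
    using eq by (intro continuous_on_cong) auto
  then show "AE \<omega> in M. continuous_on {0..} (\<lambda>t. B' t \<omega>)"
    using * by simp
  show "distributed M lborel (\<lambda>\<omega>. B' t \<omega> - B' s \<omega>) (\<lambda>x. ennreal (normal_density 0 (sqrt (t - s)) x))"
    if "0 \<le> s" "s < t" for s t
    using * eq that by simp
  fix n :: nat and \<tau> :: "nat \<Rightarrow> real"
  assume \<tau>: "0 \<le> \<tau> 0" "\<forall>i<n. \<tau> i < \<tau> (Suc i)"
  have pos: "0 \<le> \<tau> i" if "i \<le> n" for i
    using that
  proof (induction i)
    case (Suc i)
    then show ?case using \<tau>(2) by (metis Suc_le_lessD Suc_leD less_imp_le order_trans)
  qed (simp add: \<tau>(1))
  have "indep_vars (\<lambda>_. borel) (\<lambda>i \<omega>. B (\<tau> (Suc i)) \<omega> - B (\<tau> i) \<omega>) {..<n}"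
    using * \<tau> by blast
  then show "indep_vars (\<lambda>_. borel) (\<lambda>i \<omega>. B' (\<tau> (Suc i)) \<omega> - B' (\<tau> i) \<omega>) {..<n}"
    by (subst indep_vars_cong[OF refl]) (auto simp: eq pos)
qed

context stopping_rule
begin

definition pos :: "(int \<Rightarrow> nat \<Rightarrow> nat \<Rightarrow> real) \<Rightarrow> int \<Rightarrow> int" where
  "pos v = isum (\<lambda>k. int (tau (v k)))"

text \<open>
  Block \<open>-\<bar>p\<bar>\<close> starts at or before \<open>p\<close>, so the noise at position \<open>p\<close> can be read off the concatenation
  starting there.
\<close>

definition line :: "(int \<Rightarrow> nat \<Rightarrow> nat \<Rightarrow> real) \<Rightarrow> int \<Rightarrow> nat \<Rightarrow> real" where
  "line v p = splice (- \<bar>p\<bar>) v (nat (p - pos v (- \<bar>p\<bar>)))"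

definition fbm :: "(int \<Rightarrow> nat \<Rightarrow> nat \<Rightarrow> real) \<Rightarrow> real \<Rightarrow> real" where
  "fbm v t = isum (\<lambda>p. line v p 0) \<lfloor>t\<rfloor> + unit_path (line v \<lfloor>t\<rfloor>) (frac t)"

lemma pos_0 [simp]: "pos v 0 = 0"
  by (simp add: pos_def)

lemma pos_Suc: "pos v (k + 1) = pos v k + int (tau (v k))"
  by (simp add: pos_def isum_Suc)

lemma pos_ge: "pos v k + int m \<le> pos v (k + int m)"
proof -
  have "(\<Sum>i<m. 1) \<le> (\<Sum>i<m. int (tau (v (k + int i))))"
    using tau_pos by (intro sum_mono) (simp add: Suc_le_eq)
  then show ?thesis
    by (simp add: pos_def isum_add)
qed

lemma pos_le: "k \<le> 0 \<Longrightarrow> pos v k \<le> k"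
  using pos_ge[of v k "nat (- k)"] by simp

lemma splice_shift:
  "pos v (k + int m) \<le> p \<Longrightarrow>
    splice k v (nat (p - pos v k)) = splice (k + int m) v (nat (p - pos v (k + int m)))"
proof (induction m)
  case (Suc m)
  let ?k = "k + int m"
  have eq: "k + int (Suc m) = ?k + 1" by simp
  have le: "pos v (?k + 1) \<le> p"
    using Suc.prems unfolding eq .
  then have "nat (p - pos v ?k) = tau (v ?k) + nat (p - pos v (?k + 1))"
    using pos_Suc[of v ?k] by simp
  moreover have "pos v ?k \<le> p"
    using le pos_Suc[of v ?k] by simp
  ultimately show ?case
    using Suc.IH splice_add unfolding eq by metis
qed simp

text \<open>The choice of reference block in \<open>line\<close> is immaterial: of two blocks that
  start at or before \<open>p\<close>, the concatenation from the earlier one runs into that from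
  the later one.\<close>

lemma line_eq:
  assumes "pos v k \<le> p"
  shows "line v p = splice k v (nat (p - pos v k))"
proof -
  let ?k = "- \<bar>p\<bar>"
  have p: "pos v ?k \<le> p"
    using pos_le[of ?k v] by simp
  show ?thesis
  proof (cases "k \<le> ?k")
    case True
    then have "?k = k + int (nat (?k - k))" by simp
    then show ?thesis
      using splice_shift[of v k "nat (?k - k)" p] p unfolding line_def by metis
  next
    case False
    then have "k = ?k + int (nat (k - ?k))" by simp
    then show ?thesis
      using splice_shift[of v ?k "nat (k - ?k)" p] assms unfolding line_def by metis
  qed
qed

lemma line_pos_add: "line v (pos v k + int i) = splice k v i"
  by (simp add: line_eq[of v k])

lemma fbm_0 [simp]: "fbm v 0 = 0"
  by (simp add: fbm_def)

text \<open>Block starts are integers, so the shift acts on the floor and leaves \<open>frac\<close>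
  alone. The identity holds for every family of arrays, without an exceptional null set.\<close>

lemma fbm_shift:
  assumes "0 \<le> t"
  shows "fbm v (of_int (pos v k) + t) - fbm v (of_int (pos v k)) = brown (splice k v) t"
proof -
  have fl: "\<lfloor>of_int (pos v k) + t\<rfloor> = pos v k + int (nat \<lfloor>t\<rfloor>)"
    using assms by (simp add: floor_add_int[symmetric] add.commute)
  have fr: "frac (of_int (pos v k) + t) = frac t"
    by (simp add: frac_def)
  show ?thesis
    unfolding fbm_def fl fr isum_add line_pos_add by (simp add: brown_def line_pos_add)
qed

lemma fbm_block:
  assumes "i \<le> tau (v k)"
  shows "fbm v (of_int (pos v k + int i)) = fbm v (of_int (pos v k)) + (\<Sum>j<i. v k j 0)"
proof -
  have "(\<Sum>j<i. splice k v j 0) = (\<Sum>j<i. v k j 0)"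
    using assms by (intro sum.cong) (auto simp: splice_less)
  then show ?thesis
    using fbm_shift[of "real i" v k] by (simp add: brown_of_nat)
qed

lemma fbm_continuous:
  assumes "\<And>k. tame (splice k v)"
  shows "continuous_on UNIV (fbm v)"
proof (rule continuous_at_imp_continuous_on, rule ballI)
  fix t :: real
  \<comment> \<open>The \<open>- 1\<close> places \<open>t\<close> strictly after the block start,
    so that the half-line is a neighbourhood of \<open>t\<close>.\<close>
  define k where "k = min 0 \<lfloor>t\<rfloor> - 1"
  let ?s = "real_of_int (pos v k)"
  have "pos v k \<le> k"
    by (rule pos_le) (simp add: k_def)
  then have st: "?s < t"
    by (simp add: k_def) linarith
  have "continuous_on {?s<..} (\<lambda>u. fbm v ?s + brown (splice k v) (u - ?s))"
    by (intro continuous_intros continuous_on_compose2[OF tame_continuous[OF assms[of k]]]) auto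
  moreover have "fbm v ?s + brown (splice k v) (u - ?s) = fbm v u" if "u \<in> {?s<..}" for u
    using fbm_shift[of "u - ?s" v k] that by simp
  ultimately have "continuous_on {?s<..} (fbm v)"
    by (rule continuous_on_eq)
  then show "isCont (fbm v) t"
    using st by (simp add: continuous_on_eq_continuous_at)
qed

text \<open>One fixed functional of the driving array, so that the stopped pairs inherit
  independence and equality of laws from the arrays.\<close>

definition block_pair :: "(nat \<Rightarrow> nat \<Rightarrow> real) \<Rightarrow> real \<times> (real \<Rightarrow> real)" where
  "block_pair x = (real (tau x), \<lambda>t\<in>{0..}. brown x (min t (real (tau x))))"

lemma block_pair_measurable [measurable]: "block_pair \<in> measurable gauss_array stopped_pair_space"
proof -
  have "(\<lambda>x. brown x (min t (real (tau x)))) \<in> borel_measurable gauss_array" for t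
    by (rule measurable_compose_countable[where f = "\<lambda>n x. brown x (min t (real n))"]) measurable
  then show ?thesis
    unfolding block_pair_def[abs_def] stopped_pair_space_def by measurable
qed

end

section \<open>Forward property and strong decomposition\<close>

context block_family
begin

abbreviation X :: "real \<Rightarrow> 'a \<Rightarrow> real" where
  "X t \<omega> \<equiv> fbm (w \<omega>) t"

abbreviation S :: "int \<Rightarrow> 'a \<Rightarrow> real" where
  "S k \<omega> \<equiv> real_of_int (pos (w \<omega>) k)"

lemma S_measurable [measurable]: "S k \<in> borel_measurable M"
proof -
  have "S k = (\<lambda>\<omega>. if 0 \<le> k then \<Sum>i\<in>{0..<k}. real (tau (\<xi> i \<omega>)) else - (\<Sum>i\<in>{k..<0}. real (tau (\<xi> i \<omega>))))"
    by (auto simp: pos_def isum_def)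
  then show ?thesis by simp
qed

lemma line_measurable [measurable]: "(\<lambda>\<omega>. line (w \<omega>) p) \<in> measurable M (\<Pi>\<^sub>M j\<in>UNIV. borel)"
proof -
  have 1: "(\<lambda>\<omega>. splice (- \<bar>p\<bar>) (w \<omega>) j) \<in> measurable M (\<Pi>\<^sub>M j\<in>UNIV. borel)" for j
    by (rule measurable_compose[OF splice_measurable measurable_array_component])
  have "(\<lambda>\<omega>. nat \<lfloor>real_of_int p - S (- \<bar>p\<bar>) \<omega>\<rfloor>) \<in> measurable M (count_space UNIV)"
    by measurable
  then have "(\<lambda>\<omega>. nat (p - pos (w \<omega>) (- \<bar>p\<bar>))) \<in> measurable M (count_space UNIV)"
    by (simp flip: of_int_diff)
  from measurable_compose_countable[OF 1 this] show ?thesis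
    by (simp add: line_def)
qed

lemma X_measurable [measurable]: "X t \<in> borel_measurable M"
proof -
  have "(\<lambda>\<omega>. line (w \<omega>) p 0) \<in> borel_measurable M" for p
    by (rule measurable_compose[OF line_measurable measurable_component_singleton]) simp
  moreover have "(\<lambda>\<omega>. unit_path (line (w \<omega>) p) s) \<in> borel_measurable M" for p s
    by (rule measurable_compose[OF line_measurable measurable_unit_path])
  ultimately show ?thesis
    unfolding fbm_def isum_def by (cases "0 \<le> \<lfloor>t\<rfloor>") simp_all
qed

lemma X_forward_brownian_motion: "forward_brownian_motion X"
  unfolding forward_brownian_motion_def
proof (intro conjI exI[of _ S] allI impI)
  have "filterlim (\<lambda>n. S n \<omega>) at_bot at_bot" for \<omega>
    unfolding filterlim_at_bot eventually_at_bot_linorder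
  proof (intro allI exI impI)
    fix Z :: real and n assume n: "n \<le> min 0 \<lfloor>Z\<rfloor>"
    then have "pos (w \<omega>) n \<le> n"
      by (intro pos_le) simp
    then show "S n \<omega> \<le> Z"
      using n by linarith
  qed
  then show "AE \<omega> in M. filterlim (\<lambda>n. S n \<omega>) at_bot at_bot"
    by simp
  fix n :: int
  show "standard_brownian_motion (\<lambda>t \<omega>. X (S n \<omega> + t) \<omega> - X (S n \<omega>) \<omega>)"
    by (rule standard_brownian_motion_cong[OF splice.brown_standard[of n]]) (simp add: fbm_shift)
qed measurable

text \<open>Up to the null set where the rule never applies, \<open>tau \<le> t\<close> is a finite
  union of events, each decided by unit increments that end by time \<open>t\<close>.\<close>

lemma tau_stopping_time: "stopping_time (block.filt k) (\<lambda>\<omega>. real (tau (\<xi> k \<omega>)))"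
  unfolding stopping_time_def
proof
  fix t :: real
  let ?F = "block.filt k t"
  show "Measurable.pred ?F (\<lambda>\<omega>. real (tau (\<xi> k \<omega>)) \<le> t)"
  proof (cases "t < 1")
    case True
    then have "\<not> real (tau x) \<le> t" for x
      using tau_pos[of x] by simp
    then show ?thesis by simp
  next
    case False
    then have t1: "1 \<le> t" by simp
    define m where "m = nat \<lfloor>t\<rfloor>"
    have m: "1 \<le> m" "real n \<le> t \<longleftrightarrow> n \<le> m" for n
      unfolding m_def using False by linarith+
    have P_F: "Measurable.pred ?F (\<lambda>\<omega>. P n (\<lambda>i. \<xi> k \<omega> i 0))" if "n \<le> m" for n
    proof -
      have nt: "real n \<le> t"
        using m that by simp
      \<comment> \<open>The rows from \<open>n\<close> on are replaced by zero to obtain a map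
        measurable in the past; by \<open>P_cong\<close> the rule does not notice.\<close>
      have "(\<lambda>\<omega>. if i < n then \<xi> k \<omega> i 0 else 0) \<in> borel_measurable (block.past k (real n))" for i
        using block.dinc_past[of i "real n" 0 k] by (cases "i < n") (simp_all add: dinc_def)
      then have "(\<lambda>\<omega> i. if i < n then \<xi> k \<omega> i 0 else 0) \<in> measurable (block.past k (real n)) (\<Pi>\<^sub>M i\<in>UNIV. borel)"
        by (intro measurable_PiM_single') auto
      from measurable_compose[OF this P_measurable]
      have "Measurable.pred (block.past k (real n)) (\<lambda>\<omega>. P n (\<lambda>i. if i < n then \<xi> k \<omega> i 0 else 0))" .
      moreover have "P n (\<lambda>i. if i < n then \<xi> k \<omega> i 0 else 0) \<longleftrightarrow> P n (\<lambda>i. \<xi> k \<omega> i 0)" for \<omega>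
        by (auto intro: P_cong[rotated])
      ultimately have "{\<omega>\<in>space M. P n (\<lambda>i. \<xi> k \<omega> i 0)} \<in> sets (block.past k (real n))"
        by (simp add: pred_def)
      then have "{\<omega>\<in>space M. P n (\<lambda>i. \<xi> k \<omega> i 0)} \<in> sets ?F"
        using block.past_mono[OF nt] block.past_filt[of t k] False by auto
      then show ?thesis
        by (simp add: pred_def)
    qed
    \<comment> \<open>Here \<open>tau\<close> has the junk value \<open>1\<close>, so this set
      belongs to \<open>tau \<le> t\<close> whenever \<open>1 \<le> t\<close>. It lies in the
      filtration because it differs from \<open>{}\<close> by a null set.\<close>
    have N_F: "Measurable.pred ?F (\<lambda>\<omega>. \<not> fin (\<xi> k \<omega>))"
    proof -
      have "AE \<omega> in M. fin (\<xi> k \<omega>)"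
        using AE_distrD[OF \<xi>_measurable[of k], of fin] AE_fin unfolding law_\<xi> by blast
      then have "{\<omega>\<in>space M. \<not> fin (\<xi> k \<omega>)} \<in> null_sets M"
        by (subst (asm) AE_iff_null) auto
      then have "{\<omega>\<in>space M. \<not> fin (\<xi> k \<omega>)} \<in> sets ?F"
        by (auto simp: block.sets_filt intro!: bexI[of _ "{}"])
      then show ?thesis
        by (simp add: pred_def)
    qed
    have eq: "real (tau x) \<le> t \<longleftrightarrow> (\<exists>n\<in>{..m}. P n (\<lambda>i. x i 0)) \<or> \<not> fin x" for x
    proof (cases "fin x")
      case True
      then have "P (tau x) (\<lambda>i. x i 0)"
        unfolding tau_def fin_def by (auto intro: LeastI_ex)
      moreover have "tau x \<le> n" if "P n (\<lambda>i. x i 0)" for n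
        using True that by (simp add: tau_def Least_le)
      ultimately show ?thesis
        using True m(2) by (auto intro: order_trans)
    next
      case False
      then show ?thesis
        using t1 by (simp add: tau_def)
    qed
    have "Measurable.pred ?F (\<lambda>\<omega>. \<exists>n\<in>{..m}. P n (\<lambda>i. \<xi> k \<omega> i 0))"
      by (intro pred_intros_finite) (auto intro: P_F)
    then show ?thesis
      unfolding eq by (rule pred_intros_logic(5)[OF _ N_F])
  qed
qed

lemma X_decomposition:
  assumes "complete_measure M"
  shows "decomposition block.filt (\<lambda>k t \<omega>. brown (\<xi> k \<omega>) t) (\<lambda>k \<omega>. real (tau (\<xi> k \<omega>))) S X"
  unfolding decomposition_def
proof (intro conjI allI ballI)
  have pair: "stopped_pair (\<lambda>\<omega>. real (tau (\<xi> k \<omega>))) (\<lambda>t \<omega>. brown (\<xi> k \<omega>) t) \<omega> = block_pair (\<xi> k \<omega>)" for k \<omega>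
    by (simp add: stopped_pair_def block_pair_def)
  show "indep_vars (\<lambda>_. stopped_pair_space)
      (\<lambda>k. stopped_pair (\<lambda>\<omega>. real (tau (\<xi> k \<omega>))) (\<lambda>t \<omega>. brown (\<xi> k \<omega>) t)) UNIV"
    unfolding pair[abs_def] by (rule indep_vars_compose2[OF indep_\<xi>]) simp
  have one: "1 \<le> ennreal (real (tau x))" for x
    using tau_pos[of x] by (simp flip: ennreal_1)
  show "AE \<omega> in M. (\<Sum>n. ennreal (real (tau (\<xi> (int (Suc n)) \<omega>)))) = \<infinity>"
       "AE \<omega> in M. (\<Sum>n. ennreal (real (tau (\<xi> (- int (Suc n)) \<omega>)))) = \<infinity>"
    by (simp_all only: suminf_ge_1_eq_infinity[OF one]) simp_all
  have "AE \<omega> in M. \<forall>k. tame (splice k (w \<omega>))"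
    unfolding AE_all_countable using splice.AE_tame by blast
  then show "AE \<omega> in M. continuous_on UNIV (\<lambda>t. X t \<omega>)"
    by eventually_elim (rule fbm_continuous, blast)
  have "X (S k \<omega> + t) \<omega> - X (S k \<omega>) \<omega> = brown (\<xi> k \<omega>) t" if "t \<in> {0..<real (tau (\<xi> k \<omega>))}" for k t \<omega>
  proof -
    \<comment> \<open>Strictly before the end of the block, the row in use still belongs to the
      block.\<close>
    have "nat \<lfloor>t\<rfloor> < tau (\<xi> k \<omega>)"
      using that by (auto simp: nat_less_iff floor_less_iff)
    then have "brown (splice k (w \<omega>)) t = brown (\<xi> k \<omega>) t"
      by (intro brown_cong) (simp add: splice_less)
    then show ?thesis
      using that by (simp add: fbm_shift)
  qed
  then show "AE \<omega> in M. \<forall>k. \<forall>t\<in>{0..<real (tau (\<xi> k \<omega>))}.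
      X (S k \<omega> + t) \<omega> - X (S k \<omega>) \<omega> = brown (\<xi> k \<omega>) t"
    by simp
  show "normal_filtration (block.filt k)" for k
    by (rule block.filt_normal[OF assms])
qed (auto simp: pos_Suc block.brown_wrt_filt tau_stopping_time)

lemma X_strongly_decomposable:
  assumes "complete_measure M"
  shows "strongly_decomposable X"
  unfolding strongly_decomposable_def
proof (intro conjI allI)
  let ?B = "\<lambda>k t \<omega>. brown (\<xi> k \<omega>) t" and ?T = "\<lambda>k \<omega>. real (tau (\<xi> k \<omega>))"
  have pair: "distr M stopped_pair_space (stopped_pair (?T k) (?B k)) =
      distr gauss_array stopped_pair_space block_pair" for k
  proof -
    have "stopped_pair (?T k) (?B k) = block_pair \<circ> \<xi> k"
      by (auto simp: stopped_pair_def block_pair_def)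
    then show ?thesis
      using distr_distr[of block_pair gauss_array stopped_pair_space "\<xi> k" M] by (simp add: law_\<xi>)
  qed
  show "\<exists>U \<F> B T S. U \<in> borel_measurable M \<and>
      decomposition \<F> B T S (\<lambda>t \<omega>. X (U \<omega> + t) \<omega> - X (U \<omega>) \<omega>) \<and>
      (\<forall>j k. distr M stopped_pair_space (stopped_pair (T j) (B j)) =
        distr M stopped_pair_space (stopped_pair (T k) (B k)))"
    using X_decomposition[OF assms] pair
    by (intro exI[of _ "\<lambda>_. 0"] exI[of _ block.filt] exI[of _ ?B] exI[of _ ?T] exI[of _ S]) simp
qed measurable

end

subsection \<open>Choice of the thresholds\<close>

text \<open>The uniform lower bound \<open>p\<close> stands in for identical distribution: the first
  \<open>n + 1\<close> events all fail with probability at most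
  \<open>(1 - p) ^ (n + 1)\<close>.\<close>

lemma (in prob_space) AE_Ex_indep:
  assumes ind: "indep_vars N Z (UNIV :: nat set)"
    and A: "\<And>j. {z\<in>space (N j). A j z} \<in> sets (N j)"
    and p: "0 < p" "\<And>j. p \<le> prob {\<omega>\<in>space M. A j (Z j \<omega>)}"
  shows "AE \<omega> in M. \<exists>j. A j (Z j \<omega>)"
proof -
  have rv: "Z j \<in> measurable M (N j)" for j
    using ind by (simp add: indep_vars_def)
  have A': "{\<omega>\<in>space M. A j (Z j \<omega>)} \<in> events" for j
  proof -
    have "{\<omega>\<in>space M. A j (Z j \<omega>)} = Z j -` {z\<in>space (N j). A j z} \<inter> space M"
      using measurable_space[OF rv] by auto
    then show ?thesis
      using measurable_sets[OF rv A] by simp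
  qed
  define B where "B j = {\<omega>\<in>space M. \<not> A j (Z j \<omega>)}" for j
  have B: "B j \<in> events" "prob (B j) \<le> 1 - p" for j
  proof -
    have "B j = space M - {\<omega>\<in>space M. A j (Z j \<omega>)}"
      by (auto simp: B_def)
    then show "B j \<in> events" "prob (B j) \<le> 1 - p"
      using A'[of j] prob_compl[OF A'[of j]] p(2)[of j] by auto
  qed
  have "{z\<in>space (N j). \<not> A j z} \<in> sets (N j)" for j
  proof -
    have "{z\<in>space (N j). \<not> A j z} = space (N j) - {z\<in>space (N j). A j z}" by auto
    then show ?thesis using A[of j] by simp
  qed
  then have indB: "indep_events B UNIV"
    unfolding B_def by (rule indep_eventsI_indep_vars[OF ind])
  have le: "prob (\<Inter>j. B j) \<le> (1 - p) ^ Suc n" for n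
  proof -
    have "prob (\<Inter>j. B j) \<le> prob (\<Inter>j<Suc n. B j)"
      using B(1) by (intro finite_measure_mono sets.finite_INT) auto
    also have "\<dots> = (\<Prod>j<Suc n. prob (B j))"
      by (rule indB[unfolded indep_events_def, THEN conjunct2, rule_format]) auto
    also have "\<dots> \<le> (\<Prod>j<Suc n. 1 - p)"
      by (intro prod_mono) (auto simp: B)
    finally show ?thesis by simp
  qed
  have "0 \<le> 1 - p"
    using B(2)[of 0] measure_nonneg[of M "B 0"] by linarith
  then have "(\<lambda>n. (1 - p) ^ Suc n) \<longlonglongrightarrow> 0"
    using p(1) by (intro LIMSEQ_Suc LIMSEQ_realpow_zero) auto
  then have "prob (\<Inter>j. B j) \<le> 0"
    by (rule LIMSEQ_le_const) (use le in auto)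
  then have "prob (\<Inter>j. B j) = 0"
    using measure_nonneg[of M "\<Inter>j. B j"] by linarith
  then have "(\<Inter>j. B j) \<in> null_sets M"
    using B(1) by (auto simp: null_sets_def emeasure_eq_measure)
  then show ?thesis
    by (rule AE_I') (auto simp: B_def)
qed

lemma (in prob_space) ex_tail_le:
  fixes Q :: "'a \<Rightarrow> real"
  assumes [measurable]: "Q \<in> borel_measurable M" and e: "0 < e"
  shows "\<exists>c\<ge>d. prob {\<omega>\<in>space M. c < Q \<omega>} \<le> e"
proof -
  have "(\<lambda>n. prob {\<omega>\<in>space M. d + real n < Q \<omega>}) \<longlonglongrightarrow> prob (\<Inter>n. {\<omega>\<in>space M. d + real n < Q \<omega>})"
    by (rule finite_Lim_measure_decseq) (auto simp: decseq_def)
  moreover have "(\<Inter>n. {\<omega>\<in>space M. d + real n < Q \<omega>}) = {}"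
  proof -
    have "\<exists>n. \<not> d + real n < Q \<omega>" for \<omega>
    proof -
      obtain n where "Q \<omega> - d < real n"
        using reals_Archimedean2 by blast
      then show ?thesis
        by (intro exI[of _ n]) simp
    qed
    then show ?thesis by blast
  qed
  ultimately have "(\<lambda>n. prob {\<omega>\<in>space M. d + real n < Q \<omega>}) \<longlonglongrightarrow> 0"
    by simp
  then have "\<forall>\<^sub>F n in sequentially. prob {\<omega>\<in>space M. d + real n < Q \<omega>} < e"
    using e by (rule order_tendstoD)
  then obtain n where "prob {\<omega>\<in>space M. d + real n < Q \<omega>} < e"
    by (auto simp: eventually_sequentially)
  then show ?thesis
    by (intro exI[of _ "d + real n"]) auto
qed

lemma std_normal_interval_pos:
  assumes "a < b"
  shows "0 < measure std_normal_distribution {a..b}"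
proof -
  interpret N: prob_space std_normal_distribution
    by (rule prob_space_std_normal)
  have "emeasure std_normal_distribution {a..b} \<noteq> 0"
  proof
    assume "emeasure std_normal_distribution {a..b} = 0"
    then have "(\<integral>\<^sup>+x. ennreal (std_normal_density x) * indicator {a..b} x \<partial>lborel) = 0"
      by (simp add: emeasure_density)
    then have "AE x in lborel. ennreal (std_normal_density x) * indicator {a..b} x = 0"
      by (subst (asm) nn_integral_0_iff_AE) auto
    moreover have "ennreal (std_normal_density x) \<noteq> 0" for x
      using normal_density_pos[of 1 0 x] by simp
    ultimately have "AE x in lborel. x \<notin> {a..b}"
      by (auto elim!: eventually_mono split: split_indicator_asm)
    then have "emeasure lborel {a..b} = 0"
      by (subst (asm) AE_iff_measurable[where N = "{a..b}"]) auto
    with assms show False by simp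
  qed
  then show ?thesis
    by (simp add: N.emeasure_eq_measure less_le)
qed

context brownian_source
begin

lemma entry_prob: "A \<in> sets borel \<Longrightarrow> prob {\<omega>\<in>space M. Y \<omega> i 0 \<in> A} = measure std_normal_distribution A"
proof -
  assume A: "A \<in> sets borel"
  have "distr M lborel (\<lambda>\<omega>. Y \<omega> i 0) = std_normal_distribution"
    using array_entry_normal(2)[of i 0] by (simp add: distributed_def)
  moreover have "measure (distr M lborel (\<lambda>\<omega>. Y \<omega> i 0)) A = prob {\<omega>\<in>space M. Y \<omega> i 0 \<in> A}"
    using A by (subst measure_distr) (auto intro!: arg_cong[where f = prob])
  ultimately show ?thesis by simp
qed

lemma heads_indep: "indep_vars (\<lambda>_. borel) (\<lambda>i \<omega>. Y \<omega> i 0) UNIV"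
  using dinc_indep[of 0] by (simp add: dinc_def)

end

section \<open>The spike rule\<close>

definition level :: "real \<Rightarrow> nat" where
  "level z = nat \<lfloor>\<bar>z\<bar>\<rfloor>"

text \<open>The last two increments sum to at least \<open>(2 * b + 1) - (b + 1) = b\<close>, for
  \<open>b\<close> the threshold of the block; this is why the final fall is bounded from below as
  well. \<open>3 \<le> n\<close> keeps both increments apart from the first one, which sets the
  level.\<close>

definition spike :: "(nat \<Rightarrow> real) \<Rightarrow> nat \<Rightarrow> (nat \<Rightarrow> real) \<Rightarrow> bool" where
  "spike b n g \<longleftrightarrow> 3 \<le> n \<and> g (n - 1) \<in> {- b (level (g 0)) - 1..- b (level (g 0))} \<and>
     2 * b (level (g 0)) + 1 \<le> g (n - 2)"

lemma level_measurable [measurable]: "level \<in> measurable borel (count_space UNIV)"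
  unfolding level_def[abs_def] by measurable

text \<open>Conditioning on the level is avoided: for each constant threshold the pattern occurs
  almost surely, hence for all \<open>b m\<close> at once, and then the random level may be
  inserted.\<close>

lemma AE_spike:
  "AE x in gauss_array. \<exists>n. spike b n (\<lambda>i. x i 0)"
proof -
  interpret G: prob_space gauss_array by (rule prob_space_gauss_array)
  interpret Y: brownian_source gauss_array "\<lambda>x. x"
    by standard auto
  have "AE x in gauss_array. \<exists>j. x (2 * j + 2) 0 \<in> {- c - 1..- c} \<and> 2 * c + 1 \<le> x (2 * j + 1) 0" for c :: real
  proof -
    \<comment> \<open>Disjoint pairs of positions make the trials independent; starting at
      \<open>1\<close> leaves position \<open>0\<close> to the level.\<close>
    define K where "K j = {2 * j + 1, 2 * j + 2}" for j :: nat
    define A where "A j y \<longleftrightarrow> y (2 * j + 2) \<in> {- c - 1..- c} \<and> 2 * c + 1 \<le> y (2 * j + 1)"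
      for j and y :: "nat \<Rightarrow> real"
    define p where "p = measure std_normal_distribution {- c - 1..- c} *
      measure std_normal_distribution {2 * c + 1..2 * c + 2}"
    have "AE x in gauss_array. \<exists>j. A j (\<lambda>i\<in>K j. x i 0)"
    proof (rule G.AE_Ex_indep[where Z = "\<lambda>j x. \<lambda>i\<in>K j. x i 0" and A = A and p = p])
      show "G.indep_vars (\<lambda>j. PiM (K j) (\<lambda>_. borel)) (\<lambda>j x. \<lambda>i\<in>K j. x i 0) UNIV"
        by (rule G.indep_vars_restrict[OF Y.heads_indep]) (auto simp: K_def disjoint_family_on_def)
      show "{z\<in>space (PiM (K j) (\<lambda>_. borel)). A j z} \<in> sets (PiM (K j) (\<lambda>_. borel))" for j
      proof -
        have "(\<lambda>z. z (2 * j + 2)) \<in> borel_measurable (PiM (K j) (\<lambda>_. borel :: real measure))"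
            "(\<lambda>z. z (2 * j + 1)) \<in> borel_measurable (PiM (K j) (\<lambda>_. borel :: real measure))"
          by (auto intro!: measurable_component_singleton simp: K_def)
        note m = measurable_sets[OF this(1), of "{- c - 1..- c}"] measurable_sets[OF this(2), of "{2 * c + 1..}"]
        have eq: "{z\<in>space (PiM (K j) (\<lambda>_. borel)). A j z} =
            ((\<lambda>z. z (2 * j + 2)) -` {- c - 1..- c} \<inter> space (PiM (K j) (\<lambda>_. borel))) \<inter>
            ((\<lambda>z. z (2 * j + 1)) -` {2 * c + 1..} \<inter> space (PiM (K j) (\<lambda>_. borel)))"
          by (auto simp: A_def)
        show ?thesis
          unfolding eq by (intro sets.Int m) simp_all
      qed
      show "0 < p"
        unfolding p_def by (intro mult_pos_pos std_normal_interval_pos) auto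
      fix j
      \<comment> \<open>The half-line for the climb is cut to a unit interval, so that both factors
        are probabilities of bounded intervals.\<close>
      define D where "D i = (if i = 2 * j + 2 then {- c - 1..- c} else {2 * c + 1..2 * c + 2})" for i :: nat
      have "p = (\<Prod>i\<in>K j. G.prob ((\<lambda>x. x i 0) -` D i \<inter> space gauss_array))"
        using Y.entry_prob by (simp add: p_def K_def D_def vimage_def mult.commute)
      also have "\<dots> = G.prob (\<Inter>i\<in>K j. (\<lambda>x. x i 0) -` D i \<inter> space gauss_array)"
        by (rule G.indep_varsD[OF Y.heads_indep, symmetric]) (auto simp: K_def D_def)
      also have "\<dots> \<le> G.prob {x\<in>space gauss_array. A j (\<lambda>i\<in>K j. x i 0)}"
      proof (rule G.finite_measure_mono)
        have "{x\<in>space gauss_array. x (2 * j + 2) 0 \<in> {- c - 1..- c} \<and> 2 * c + 1 \<le> x (2 * j + 1) 0}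
            \<in> sets gauss_array"
          by measurable
        then show "{x\<in>space gauss_array. A j (\<lambda>i\<in>K j. x i 0)} \<in> sets gauss_array"
          by (simp add: A_def K_def)
      qed (auto simp: K_def D_def A_def)
      finally show "p \<le> G.prob {x\<in>space gauss_array. A j (\<lambda>i\<in>K j. x i 0)}" .
    qed
    then show ?thesis
      by (simp add: A_def K_def)
  qed
  then have "AE x in gauss_array. \<forall>m. \<exists>j. x (2 * j + 2) 0 \<in> {- b m - 1..- b m} \<and> 2 * b m + 1 \<le> x (2 * j + 1) 0"
    unfolding AE_all_countable by blast
  then show ?thesis
  proof eventually_elim
    case (elim x)
    then obtain j where "x (2 * j + 2) 0 \<in> {- b (level (x 0 0)) - 1..- b (level (x 0 0))}"
        "2 * b (level (x 0 0)) + 1 \<le> x (2 * j + 1) 0"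
      by blast
    then show ?case
      by (intro exI[of _ "2 * j + 3"]) (simp add: spike_def)
  qed
qed

interpretation spike: stopping_rule "spike b" for b
proof
  fix n
  have c: "(\<lambda>g. g i) \<in> borel_measurable (\<Pi>\<^sub>M i\<in>UNIV. borel :: real measure)" for i :: nat
    by (rule measurable_component_singleton) simp
  have "(\<lambda>g. level (g 0)) \<in> measurable (\<Pi>\<^sub>M i\<in>(UNIV :: nat set). borel :: real measure) (count_space UNIV)"
    by (rule measurable_compose[OF c[of 0] level_measurable])
  from measurable_compose[OF this, of b borel]
  have "(\<lambda>g. b (level (g 0))) \<in> borel_measurable (\<Pi>\<^sub>M i\<in>(UNIV :: nat set). borel :: real measure)"
    by simp
  with c show "Measurable.pred (\<Pi>\<^sub>M i\<in>UNIV. borel) (spike b n)"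
    unfolding spike_def[abs_def] by simp
next
  fix n and g g' :: "nat \<Rightarrow> real"
  assume "\<And>i. i < n \<Longrightarrow> g i = g' i" "spike b n g"
  moreover from this(2) have "0 < n" "n - 1 < n" "n - 2 < n"
    by (auto simp: spike_def)
  ultimately show "spike b n g'"
    by (simp add: spike_def)
next
  fix n g assume "spike b n g"
  then show "0 < n" by (simp add: spike_def)
qed (rule AE_spike)

lemma spike_tau:
  assumes "spike.fin b x"
  shows "spike b (spike.tau b x) (\<lambda>i. x i 0)"
  using assms unfolding spike.tau_def spike.fin_def by (auto intro: LeastI_ex)

text \<open>The duration of a block involves a single threshold, that of its level; the recursive
  choice of \<open>b\<close> rests on this.\<close>

lemma spike_tau_cong:
  assumes "b (level (x 0 0)) = b' (level (x 0 0))"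
  shows "spike.tau b x = spike.tau b' x"
proof -
  have "spike b n (\<lambda>i. x i 0) = spike b' n (\<lambda>i. x i 0)" for n
    using assms by (simp add: spike_def)
  then show ?thesis
    by (simp add: spike.tau_def spike.fin_def)
qed

section \<open>The obstacle before the first high block\<close>

text \<open>Index \<open>j\<close> stands for block \<open>-j\<close>, counted backwards from time
  \<open>0\<close>. The default \<open>1\<close> keeps the index at least \<open>1\<close> even if
  no block is high enough.\<close>

definition first_block :: "nat \<Rightarrow> (int \<Rightarrow> nat \<Rightarrow> nat \<Rightarrow> real) \<Rightarrow> nat" where
  "first_block m v = (if \<exists>j\<ge>1. m \<le> level (v (- int j) 0 0)
     then LEAST j. 1 \<le> j \<and> m \<le> level (v (- int j) 0 0) else 1)"

definition block_sum :: "(nat \<Rightarrow> real) \<Rightarrow> (nat \<Rightarrow> nat \<Rightarrow> real) \<Rightarrow> real" where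
  "block_sum b x = (\<Sum>i<spike.tau b x. x i 0)"

text \<open>Block \<open>1 - first_block\<close> follows the high block in time, so its start is the
  end of the high block. The \<open>+ 2\<close> accounts for the spikes, the earlier of which lies
  two time units before that end.\<close>

definition obstacle :: "(real \<Rightarrow> real) \<Rightarrow> (nat \<Rightarrow> real) \<Rightarrow> nat \<Rightarrow> (int \<Rightarrow> nat \<Rightarrow> nat \<Rightarrow> real) \<Rightarrow> real" where
  "obstacle f b m v = f (real_of_int (- spike.pos b v (1 - int (first_block m v))) + 2) +
     \<bar>isum (\<lambda>k. block_sum b (v k)) (1 - int (first_block m v))\<bar>"

text \<open>Expresses the value at a block boundary through the blocks between it and time
  \<open>0\<close>, which shows on which thresholds it depends.\<close>

lemma fbm_pos: "spike.fbm b v (of_int (spike.pos b v k)) = isum (\<lambda>k. block_sum b (v k)) k"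
proof (induction k rule: int_induct[where k = 0])
  have step: "spike.fbm b v (of_int (spike.pos b v (k + 1))) =
      spike.fbm b v (of_int (spike.pos b v k)) + block_sum b (v k)" for k
    using spike.fbm_block[of "spike.tau b (v k)" b v k] by (simp add: spike.pos_Suc block_sum_def)
  show "spike.fbm b v (of_int (spike.pos b v 0)) = isum (\<lambda>k. block_sum b (v k)) 0"
    by simp
  show "spike.fbm b v (of_int (spike.pos b v (i + 1))) = isum (\<lambda>k. block_sum b (v k)) (i + 1)"
    if "spike.fbm b v (of_int (spike.pos b v i)) = isum (\<lambda>k. block_sum b (v k)) i" for i
    using that step[of i] by (simp add: isum_Suc)
  show "spike.fbm b v (of_int (spike.pos b v (i - 1))) = isum (\<lambda>k. block_sum b (v k)) (i - 1)"
    if "spike.fbm b v (of_int (spike.pos b v i)) = isum (\<lambda>k. block_sum b (v k)) i" for i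
    using that step[of "i - 1"] isum_Suc[of "\<lambda>k. block_sum b (v k)" "i - 1"] by simp
qed

lemma first_block_ge_1: "1 \<le> first_block m v"
  unfolding first_block_def by (auto intro: LeastI2_ex)

lemma first_block_level:
  assumes "\<exists>j\<ge>1. m \<le> level (v (- int j) 0 0)"
  shows "m \<le> level (v (- int (first_block m v)) 0 0)"
  using LeastI_ex[of "\<lambda>j. 1 \<le> j \<and> m \<le> level (v (- int j) 0 0)"] assms by (simp add: first_block_def)

lemma before_first_block:
  assumes "1 \<le> j" "j < first_block m v"
  shows "level (v (- int j) 0 0) < m"
proof (rule ccontr)
  assume "\<not> level (v (- int j) 0 0) < m"
  then have j: "1 \<le> j \<and> m \<le> level (v (- int j) 0 0)"
    using assms by simp
  then have "first_block m v \<le> j"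
    unfolding first_block_def using Least_le[of "\<lambda>j. 1 \<le> j \<and> m \<le> level (v (- int j) 0 0)" j] by auto
  with assms show False by simp
qed

lemma isum_cong_neg:
  assumes "k \<le> 0" "\<And>i. k \<le> i \<Longrightarrow> i < 0 \<Longrightarrow> a i = a' i"
  shows "isum a k = isum a' k"
  using assms by (cases "k = 0") (auto simp: isum_def intro!: sum.cong)

text \<open>Both sums run over the blocks \<open>-1\<close> down to \<open>1 - first_block\<close>,
  which omits the high block itself; all of these have levels below \<open>m\<close>. With the
  default index the sums are empty.\<close>

lemma obstacle_cong:
  assumes "\<And>i. i < m \<Longrightarrow> b i = b' i"
  shows "obstacle f b m v = obstacle f b' m v"
proof -
  let ?k = "1 - int (first_block m v)"
  have k: "?k \<le> 0"
    using first_block_ge_1[of m v] by simp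
  have tau: "spike.tau b (v i) = spike.tau b' (v i)" if "?k \<le> i" "i < 0" for i
  proof -
    have "level (v (- int (nat (- i))) 0 0) < m"
      using that by (intro before_first_block) auto
    then show ?thesis
      using that assms by (intro spike_tau_cong) simp
  qed
  have "spike.pos b v ?k = spike.pos b' v ?k"
    unfolding spike.pos_def using k tau by (intro isum_cong_neg) auto
  moreover have "isum (\<lambda>k. block_sum b (v k)) ?k = isum (\<lambda>k. block_sum b' (v k)) ?k"
    using k tau by (intro isum_cong_neg) (auto simp: block_sum_def)
  ultimately show ?thesis
    by (simp add: obstacle_def)
qed

text \<open>The blocks \<open>-1\<close> to \<open>-N\<close> have only finitely many levels, so
  anything above their maximum is first met further back. This sends the spikes to minus infinity in
  time.\<close>

lemma first_block_unbounded: "\<exists>m0. \<forall>m\<ge>m0. (\<exists>j\<ge>1. m \<le> level (v (- int j) 0 0)) \<longrightarrow> N < first_block m v"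
proof -
  define m0 where "m0 = Suc (Max (insert 0 ((\<lambda>j. level (v (- int j) 0 0)) ` {1..N})))"
  have "N < first_block m v" if "m0 \<le> m" "\<exists>j\<ge>1. m \<le> level (v (- int j) 0 0)" for m
  proof (rule ccontr)
    assume "\<not> N < first_block m v"
    then have "level (v (- int (first_block m v)) 0 0) < m0"
      unfolding m0_def less_Suc_eq_le using first_block_ge_1[of m v] by (intro Max_ge) auto
    with first_block_level[of m v, OF that(2)] that(1) show False by simp
  qed
  then show ?thesis by blast
qed

text \<open>Let \<open>p\<close> be the end of the first block of level at least \<open>m\<close>.
  The spikes at \<open>p - 1\<close> and \<open>p - 2\<close> overcome the obstacle, whose term
  \<open>f (2 - p)\<close> covers \<open>f\<close> at both times by monotonicity.\<close>

lemma spikes_reach: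
  assumes f: "mono_on {0..} f" and b: "mono b"
    and levels: "\<And>m. \<exists>j\<ge>1. m \<le> level (v (- int j) 0 0)"
    and fin: "\<And>k. spike.fin b (v k)"
    and obs: "\<forall>\<^sub>F m in sequentially. obstacle f b m v \<le> b m"
  shows "\<exists>t\<le>T. f (- t) \<le> spike.fbm b v t" "\<exists>t\<le>T. spike.fbm b v t \<le> - f (- t)"
proof -
  obtain m1 where m1: "\<And>m. m1 \<le> m \<Longrightarrow> obstacle f b m v \<le> b m"
    using obs by (auto simp: eventually_sequentially)
  obtain m0 where m0: "\<And>m. m0 \<le> m \<Longrightarrow> nat \<lceil>\<bar>T\<bar>\<rceil> < first_block m v"
    using first_block_unbounded[of v "nat \<lceil>\<bar>T\<bar>\<rceil>"] levels by blast
  define m where "m = max m0 m1"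
  define k where "k = - int (first_block m v)"
  define n where "n = spike.tau b (v k)"
  \<comment> \<open>The level of this block may exceed \<open>m\<close>; monotonicity of
    \<open>b\<close> carries the bound from \<open>b m\<close> over to the actual threshold
    \<open>c\<close>.\<close>
  define c where "c = b (level (v k 0 0))"
  define p where "p = spike.pos b v (k + 1)"
  have "m \<le> level (v k 0 0)"
    unfolding k_def by (rule first_block_level[of m v, OF levels])
  then have cb: "b m \<le> c"
    unfolding c_def by (rule monoD[OF b])
  have k: "k + 1 \<le> 0" "real_of_int (k + 1) \<le> T"
    using m0[of m] by (auto simp: m_def k_def) linarith+
  have pk: "p \<le> k + 1"
    unfolding p_def by (rule spike.pos_le[OF k(1)])
  have sp: "3 \<le> n" "- c - 1 \<le> v k (n - 1) 0" "v k (n - 1) 0 \<le> - c" "2 * c + 1 \<le> v k (n - 2) 0"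
    using spike_tau[OF fin[of k]] by (auto simp: spike_def n_def c_def)
  have pos: "p = spike.pos b v k + int n"
    by (simp add: p_def n_def spike.pos_Suc)
  have val: "spike.fbm b v (of_int (spike.pos b v k + int i)) =
      spike.fbm b v (of_int (spike.pos b v k)) + (\<Sum>j<i. v k j 0)" if "i \<le> n" for i
    using that unfolding n_def by (rule spike.fbm_block)
  have n1: "Suc (n - 1) = n" "Suc (n - 2) = n - 1"
    using sp(1) by auto
  have pp: "p - 1 = spike.pos b v k + int (n - 1)" "p - 2 = spike.pos b v k + int (n - 2)"
    using pos sp(1) by auto
  let ?s = "\<lambda>i. spike.fbm b v (of_int (spike.pos b v k)) + (\<Sum>j<i. v k j 0)"
  have vals: "spike.fbm b v (of_int p) = ?s n" "spike.fbm b v (of_int (p - 1)) = ?s (n - 1)"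
      "spike.fbm b v (of_int (p - 2)) = ?s (n - 2)"
    unfolding pp unfolding pos by (rule val; simp)+
  have F1: "spike.fbm b v (of_int p) = spike.fbm b v (of_int (p - 1)) + v k (n - 1) 0"
    using sum.lessThan_Suc[of "\<lambda>j. v k j 0" "n - 1"] unfolding vals n1 by linarith
  have F2: "spike.fbm b v (of_int (p - 1)) = spike.fbm b v (of_int (p - 2)) + v k (n - 2) 0"
    using sum.lessThan_Suc[of "\<lambda>j. v k j 0" "n - 2"] unfolding vals n1 by linarith
  have "obstacle f b m v = f (real_of_int (- p) + 2) + \<bar>spike.fbm b v (of_int p)\<bar>"
    unfolding obstacle_def fbm_pos[symmetric] p_def k_def by (simp add: add.commute)
  then have O: "f (real_of_int (- p) + 2) + \<bar>spike.fbm b v (of_int p)\<bar> \<le> c"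
    using m1[of m] cb by (simp add: m_def)
  have "f (real_of_int (- p) + 1) \<le> f (real_of_int (- p) + 2)"
    using pk k(1) by (intro mono_onD[OF f]) auto
  then have "f (- real_of_int (p - 1)) \<le> spike.fbm b v (of_int (p - 1))"
    using O F1 sp by simp
  moreover have "real_of_int (p - 1) \<le> T" "real_of_int (p - 2) \<le> T"
    using pk k(2) by linarith+
  moreover have "spike.fbm b v (of_int (p - 2)) \<le> - f (- real_of_int (p - 2))"
    using O F1 F2 sp by simp
  ultimately show "\<exists>t\<le>T. f (- t) \<le> spike.fbm b v t" "\<exists>t\<le>T. spike.fbm b v t \<le> - f (- t)"
    by blast+
qed

section \<open>Recursive choice of the thresholds\<close>

text \<open>The arrays come before the thresholds: every \<open>b\<close> gives a
  \<open>block_family\<close> on the same arrays, so that obstacles for different \<open>b\<close>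
  can be compared pointwise.\<close>

locale gaussian_blocks = prob_space M for M :: "'a measure" +
  fixes \<xi> :: "int \<Rightarrow> 'a \<Rightarrow> nat \<Rightarrow> nat \<Rightarrow> real"
  assumes indep_rows: "indep_vars (\<lambda>_. gauss_array) \<xi> UNIV"
    and law_rows: "\<And>k. distr M gauss_array (\<xi> k) = gauss_array"
begin

sublocale blocks: block_family M "spike b" \<xi> for b
  by standard (rule indep_rows, rule law_rows)

lemma AE_levels: "AE \<omega> in M. \<forall>m. \<exists>j\<ge>1. m \<le> level (\<xi> (- int j) \<omega> 0 0)"
  unfolding AE_all_countable
proof
  fix m :: nat
  have "AE \<omega> in M. \<exists>j. m \<le> level (\<xi> (- int (Suc j)) \<omega> 0 0)"
  proof (rule AE_Ex_indep[where Z = "\<lambda>j. \<xi> (- int (Suc j))" and A = "\<lambda>_ x. m \<le> level (x 0 0)"])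
    show "indep_vars (\<lambda>_. gauss_array) (\<lambda>j. \<xi> (- int (Suc j))) UNIV"
      by (rule indep_vars_reindex[OF indep_rows]) (auto simp: inj_on_def)
    show "{z\<in>space gauss_array. m \<le> level (z 0 0)} \<in> sets gauss_array"
      by measurable
    show "0 < measure std_normal_distribution {real m..real m + 1}"
      by (rule std_normal_interval_pos) simp
    fix j
    have "measure std_normal_distribution {real m..real m + 1} =
        prob {\<omega>\<in>space M. \<xi> (- int (Suc j)) \<omega> 0 0 \<in> {real m..real m + 1}}"
      by (rule blocks.block.entry_prob[symmetric]) simp
    also have "\<dots> \<le> prob {\<omega>\<in>space M. m \<le> level (\<xi> (- int (Suc j)) \<omega> 0 0)}"
    proof (rule finite_measure_mono)
      show "{\<omega>\<in>space M. \<xi> (- int (Suc j)) \<omega> 0 0 \<in> {real m..real m + 1}}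
          \<subseteq> {\<omega>\<in>space M. m \<le> level (\<xi> (- int (Suc j)) \<omega> 0 0)}"
        by (auto simp: level_def le_nat_iff le_floor_iff)
    qed measurable
    finally show "measure std_normal_distribution {real m..real m + 1}
        \<le> prob {\<omega>\<in>space M. m \<le> level (\<xi> (- int (Suc j)) \<omega> 0 0)}" .
  qed
  then show "AE \<omega> in M. \<exists>j\<ge>1. m \<le> level (\<xi> (- int j) \<omega> 0 0)"
    by eventually_elim (metis Suc_le_mono One_nat_def le0)
qed

text \<open>\<open>f\<close> is evaluated at integer-valued random times only, so its composition
  with them is measurable whatever \<open>f\<close> is.\<close>

lemma obstacle_measurable [measurable]: "(\<lambda>\<omega>. obstacle f b m (\<lambda>k. \<xi> k \<omega>)) \<in> borel_measurable M"
proof -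
  have level [measurable]: "(\<lambda>\<omega>. level (\<xi> k \<omega> 0 0)) \<in> measurable M (count_space UNIV)" for k
    by measurable
  have K: "(\<lambda>\<omega>. first_block m (\<lambda>k. \<xi> k \<omega>)) \<in> measurable M (count_space UNIV)"
    unfolding first_block_def by measurable
  have "(\<lambda>\<omega>. block_sum b (\<xi> k \<omega>)) \<in> borel_measurable M" for k
    unfolding block_sum_def
    by (rule measurable_compose_countable[where f = "\<lambda>n \<omega>. \<Sum>i<n. \<xi> k \<omega> i 0"]) measurable
  then have sum: "(\<lambda>\<omega>. isum (\<lambda>k. block_sum b (\<xi> k \<omega>)) l) \<in> borel_measurable M" for l
    unfolding isum_def by (cases "0 \<le> l") simp_all
  have "(\<lambda>\<omega>. \<lfloor>blocks.S b l \<omega>\<rfloor>) \<in> measurable M (count_space UNIV)" for l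
    by measurable
  then have pos: "(\<lambda>\<omega>. spike.pos b (\<lambda>k. \<xi> k \<omega>) l) \<in> measurable M (count_space UNIV)" for l
    by simp
  have "(\<lambda>\<omega>. f (real_of_int (- spike.pos b (\<lambda>k. \<xi> k \<omega>) l) + 2)) \<in> borel_measurable M" for l
    by (rule measurable_compose[OF pos]) simp
  then have 1: "(\<lambda>\<omega>. f (real_of_int (- spike.pos b (\<lambda>k. \<xi> k \<omega>) l) + 2) +
     \<bar>isum (\<lambda>k. block_sum b (\<xi> k \<omega>)) l\<bar>) \<in> borel_measurable M" for l
    by (intro borel_measurable_add borel_measurable_abs sum)
  define Q where "Q j \<omega> = f (real_of_int (- spike.pos b (\<lambda>k. \<xi> k \<omega>) (1 - int j)) + 2) +
     \<bar>isum (\<lambda>k. block_sum b (\<xi> k \<omega>)) (1 - int j)\<bar>" for j \<omega>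
  have "Q j \<in> borel_measurable M" for j
    unfolding Q_def by (rule 1)
  then have "(\<lambda>\<omega>. Q (first_block m (\<lambda>k. \<xi> k \<omega>)) \<omega>) \<in> borel_measurable M"
    by (rule measurable_compose_countable[OF _ K])
  then show ?thesis
    unfolding Q_def obstacle_def .
qed

text \<open>By \<open>obstacle_cong\<close> the obstacle at \<open>m\<close> reads only earlier
  thresholds although it is given the whole function \<open>b\<close>, so well-founded choice
  applies. The bound \<open>(1/2) ^ m\<close> is there to be summable, and
  \<open>b i \<le> r\<close> makes \<open>b\<close> monotone for
  \<open>spikes_reach\<close>.\<close>

lemma ex_thresholds:
  "\<exists>b. mono b \<and> (\<forall>m. prob {\<omega>\<in>space M. b m < obstacle f b m (\<lambda>k. \<xi> k \<omega>)} \<le> (1/2) ^ m)"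
proof -
  let ?P = "\<lambda>b m r. (\<forall>i<m. b i \<le> r) \<and>
    prob {\<omega>\<in>space M. r < obstacle f b m (\<lambda>k. \<xi> k \<omega>)} \<le> (1/2) ^ m"
  have "\<exists>b. \<forall>m. ?P b m (b m)"
  proof (rule dependent_wf_choice[where R = "{(i, j :: nat). i < j}"])
    show "wf {(i, j :: nat). i < j}"
      by (rule wf_less)
    show "?P b m r = ?P b' m r" if "\<And>i. (i, m) \<in> {(i, j :: nat). i < j} \<Longrightarrow> b i = b' i" for b b' m r
    proof -
      have "b i = b' i" if "i < m" for i
        using that \<open>\<And>i. (i, m) \<in> {(i, j :: nat). i < j} \<Longrightarrow> b i = b' i\<close> by simp
      then show ?thesis
        using obstacle_cong[of m b b' f] by simp
    qed
    fix m and b :: "nat \<Rightarrow> real"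
    obtain d where d: "\<And>i. i < m \<Longrightarrow> b i \<le> d"
    proof
      show "b i \<le> Max (insert 0 (b ` {..<m}))" if "i < m" for i
        using that by (intro Max_ge) auto
    qed
    have "\<exists>c\<ge>d. prob {\<omega>\<in>space M. c < obstacle f b m (\<lambda>k. \<xi> k \<omega>)} \<le> (1/2) ^ m"
      by (rule ex_tail_le) auto
    with d show "\<exists>r. ?P b m r"
      by (meson order_trans)
  qed
  then obtain b where b: "\<And>m. ?P b m (b m)" by blast
  then have "mono b"
    by (intro monoI) (metis le_neq_implies_less order_refl)
  with b show ?thesis by blast
qed

lemma ex_reaching:
  assumes f: "mono_on {0..} f"
  shows "\<exists>b. AE \<omega> in M. \<forall>T. (\<exists>t\<le>T. f (- t) \<le> spike.fbm b (\<lambda>k. \<xi> k \<omega>) t) \<and>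
    (\<exists>t\<le>T. spike.fbm b (\<lambda>k. \<xi> k \<omega>) t \<le> - f (- t))"
proof -
  obtain b where b: "mono b"
      "\<And>m. prob {\<omega>\<in>space M. b m < obstacle f b m (\<lambda>k. \<xi> k \<omega>)} \<le> (1/2) ^ m"
    using ex_thresholds by blast
  have "summable (\<lambda>m. (1/2 :: real) ^ m)"
    by (rule summable_geometric) simp
  then have "summable (\<lambda>m. prob {\<omega>\<in>space M. b m < obstacle f b m (\<lambda>k. \<xi> k \<omega>)})"
    by (rule summable_comparison_test'[where N = 0]) (use b(2) in simp)
  then have obs: "AE \<omega> in M. \<forall>\<^sub>F m in sequentially.
      \<omega> \<in> space M - {\<omega>\<in>space M. b m < obstacle f b m (\<lambda>k. \<xi> k \<omega>)}"
    by (intro borel_cantelli_AE1) (auto simp: emeasure_eq_measure)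
  have "AE \<omega> in M. spike.fin b (\<xi> k \<omega>)" for k
    using AE_distrD[OF blocks.\<xi>_measurable[of k], of "spike.fin b"] spike.AE_fin[of b]
    unfolding law_rows by blast
  then have fin: "AE \<omega> in M. \<forall>k. spike.fin b (\<xi> k \<omega>)"
    unfolding AE_all_countable by blast
  have "AE \<omega> in M. \<forall>T. (\<exists>t\<le>T. f (- t) \<le> spike.fbm b (\<lambda>k. \<xi> k \<omega>) t) \<and>
    (\<exists>t\<le>T. spike.fbm b (\<lambda>k. \<xi> k \<omega>) t \<le> - f (- t))"
    using obs fin AE_levels
  proof eventually_elim
    case (elim \<omega>)
    have "\<forall>\<^sub>F m in sequentially. obstacle f b m (\<lambda>k. \<xi> k \<omega>) \<le> b m"
      using elim(1) by eventually_elim auto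
    then show ?case
      using spikes_reach[OF f b(1), of "\<lambda>k. \<xi> k \<omega>"] elim(2,3) by blast
  qed
  then show ?thesis by blast
qed

end

section \<open>Limits along negative times and the sample space\<close>

lemma Limsup_ge_frequently:
  fixes g :: "'a \<Rightarrow> ereal"
  assumes "\<exists>\<^sub>F t in F. 0 \<le> g t"
  shows "0 \<le> Limsup F g"
proof (rule ccontr)
  assume "\<not> 0 \<le> Limsup F g"
  then have "\<forall>\<^sub>F t in F. g t < 0"
    by (intro Limsup_lessD) simp
  with assms show False
    by (auto simp: frequently_def not_le)
qed

lemma Liminf_le_frequently:
  fixes g :: "'a \<Rightarrow> ereal"
  assumes "\<exists>\<^sub>F t in F. g t \<le> 0"
  shows "Liminf F g \<le> 0"
proof (rule ccontr)
  assume "\<not> Liminf F g \<le> 0"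
  then have "\<forall>\<^sub>F t in F. 0 < g t"
    by (intro less_LiminfD) simp
  with assms show False
    by (auto simp: frequently_def not_le)
qed

lemma frequently_at_bot_iff: "(\<exists>\<^sub>F t :: real in at_bot. A t) \<longleftrightarrow> (\<forall>T. \<exists>t\<le>T. A t)"
  unfolding frequently_def eventually_at_bot_linorder by auto

text \<open>Sample points carry one index per block, whereas each block needs an array with two, so
  the product measure is transported along the pairing of natural numbers. For this it suffices that
  \<open>\<psi>\<close> is a left inverse of \<open>\<phi>\<close>.\<close>

lemma ex_gaussian_blocks:
  "\<exists>(M :: (int \<Rightarrow> nat \<Rightarrow> real) measure) \<xi>. gaussian_blocks M \<xi> \<and> complete_measure M"
proof -
  let ?W = "\<Pi>\<^sub>M k\<in>(UNIV :: int set). gauss_array"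
  interpret W: prob_space ?W
    by (intro prob_space_PiM prob_space_gauss_array)
  have spW: "space ?W = UNIV"
    by (simp add: space_PiM)
  define \<phi> where "\<phi> v k n = (case prod_decode n of (i, j) \<Rightarrow> v k i j)"
    for v :: "int \<Rightarrow> nat \<Rightarrow> nat \<Rightarrow> real" and k n
  define \<psi> where "\<psi> \<omega> k i j = \<omega> k (prod_encode (i, j))"
    for \<omega> :: "int \<Rightarrow> nat \<Rightarrow> real" and k i j
  have \<psi>\<phi>: "\<psi> (\<phi> v) = v" for v
    by (simp add: fun_eq_iff \<phi>_def \<psi>_def)
  define M0 where "M0 = distr ?W (vimage_algebra UNIV \<psi> ?W) \<phi>"
  have \<psi>: "\<psi> \<in> measurable (vimage_algebra UNIV \<psi> ?W) ?W"
    by (rule measurable_vimage_algebra1) (simp add: spW)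
  have \<phi>: "\<phi> \<in> measurable ?W (vimage_algebra UNIV \<psi> ?W)"
    by (rule measurable_vimage_algebra2) (simp_all add: \<psi>\<phi>)
  have "prob_space M0"
    unfolding M0_def by (rule W.prob_space_distr[OF \<phi>])
  \<comment> \<open>The completion supplies the subsets of null sets that a normal filtration must
    contain.\<close>
  then have M: "prob_space (completion M0)"
    by (rule prob_space.prob_space_completion)
  have \<psi>M0: "\<psi> \<in> measurable M0 ?W"
    unfolding M0_def using \<psi> by simp
  have "distr M0 ?W \<psi> = distr ?W ?W (\<lambda>v. v)"
    unfolding M0_def distr_distr[OF \<psi> \<phi>] by (simp add: comp_def \<psi>\<phi>)
  then have law: "distr (completion M0) ?W \<psi> = ?W"
    using distr_completion[OF \<psi>M0] by simp
  have \<psi>M: "\<psi> \<in> measurable (completion M0) ?W"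
    by (rule measurable_completion[OF \<psi>M0])
  note c = prob_space.coordinates_of_PiM[OF M \<psi>M law prob_space_gauss_array]
  have "gaussian_blocks (completion M0) (\<lambda>k \<omega>. \<psi> \<omega> k)"
    unfolding gaussian_blocks_def gaussian_blocks_axioms_def using M c by blast
  then show ?thesis
    using completion.complete_measure_axioms by blast
qed

theorem theorem3p3:
  fixes f :: "real \<Rightarrow> real"
  assumes "mono_on {0..} f" and "f \<in> {0..} \<rightarrow> {0..}"
  shows "\<exists>(M :: (int \<Rightarrow> nat \<Rightarrow> real) measure) X.
    prob_space M \<and>
    prob_space.forward_brownian_motion M X \<and>
    prob_space.strongly_decomposable M X \<and>
    (AE \<omega> in M.
       Limsup at_bot (\<lambda>t. ereal (X t \<omega> - f (- t))) \<ge> 0 \<and>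
       Liminf at_bot (\<lambda>t. ereal (X t \<omega> + f (- t))) \<le> 0)"
proof -
  obtain M :: "(int \<Rightarrow> nat \<Rightarrow> real) measure" and \<xi>
    where blocks: "gaussian_blocks M \<xi>" and complete: "complete_measure M"
    using ex_gaussian_blocks by blast
  interpret gaussian_blocks M \<xi> by (rule blocks)
  obtain b where "AE \<omega> in M. \<forall>T. (\<exists>t\<le>T. f (- t) \<le> blocks.X b t \<omega>) \<and> (\<exists>t\<le>T. blocks.X b t \<omega> \<le> - f (- t))"
    using ex_reaching[OF assms(1)] by blast
  then have "AE \<omega> in M. Limsup at_bot (\<lambda>t. ereal (blocks.X b t \<omega> - f (- t))) \<ge> 0 \<and>
      Liminf at_bot (\<lambda>t. ereal (blocks.X b t \<omega> + f (- t))) \<le> 0"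
  proof eventually_elim
    case (elim \<omega>)
    have "\<exists>\<^sub>F t in at_bot. 0 \<le> ereal (blocks.X b t \<omega> - f (- t))"
      unfolding frequently_at_bot_iff using elim by simp
    moreover have "\<exists>\<^sub>F t in at_bot. ereal (blocks.X b t \<omega> + f (- t)) \<le> 0"
      unfolding frequently_at_bot_iff
    proof
      fix T
      obtain t where "t \<le> T" "blocks.X b t \<omega> \<le> - f (- t)"
        using elim by blast
      then show "\<exists>t\<le>T. ereal (blocks.X b t \<omega> + f (- t)) \<le> 0"
        by (intro exI[of _ t]) simp
    qed
    ultimately show ?case
      by (intro conjI Limsup_ge_frequently Liminf_le_frequently)
  qed
  then show ?thesis
    by (intro exI[of _ M] exI[of _ "blocks.X b"] conjI prob_space_axioms
        blocks.X_forward_brownian_motion blocks.X_strongly_decomposable complete)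
qed

end
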